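(* Let $\rho\ge1$ and, for $n\in\mathbb N$, let $\mu_n,\nu_n\in\mathcal P_\rho(\mathbb R)$ be such that $\mu_n\le_{cx}\nu_n$, and suppose that $\mu_n$ and $\nu_n$ respectively converge to $\mu$ and $\nu$ in $\mathcal W_\rho$ as $n\to+\infty$. Suppose that asymptotically, any jump of $F_\mu$ is included in a jump of $F_{\mu_n}$, that is: for all $x\in\mathbb R$ with $\mu(\{x\})>0$ there exists a sequence $(x_n)_{n\in\mathbb N}\in\mathbb R^{\mathbb N}$ such that $$\big(F_{\mu_n}(x_n)\wedge F_\mu(x)\big)-\big(F_{\mu_n}(x_n-)\vee F_\mu(x-)\big)\underset{n\to+\infty}{\longrightarrow}\mu(\{x\})$$ (which is for instance satisfied if $\mu$ is non-atomic). Then $$\mathcal{AW}_\rho(M_n^{IT},M^{IT})\underset{n\to+\infty}{\longrightarrow}0,$$ where $M_n^{IT}$, resp. $M^{IT}$, denotes the inverse transform martingale coupling between $\mu_n$ and $\nu_n$, resp. $\mu$ and $\nu$.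
   Context: $\mathcal P_\rho(\mathbb R)$ is the set of probability measures on $\mathbb R$ with finite moment of order $\rho\ge1$. $\mathcal W_\rho$ is the Wasserstein distance of order $\rho$ on $\mathcal P_\rho(\mathbb R)$ for the cost $|x-y|^\rho$. $\Pi(\mu,\nu)$ is the set of couplings of $\mu,\nu$; $(\pi_x)_{x\in\mathbb R}$ denotes the disintegration $\pi(dx,dy)=\mu(dx)\,\pi_x(dy)$. $\mu\le_{cx}\nu$ (convex order) means $\int f\,d\mu\le\int f\,d\nu$ for all convex $f:\mathbb R\to\mathbb R$ (the limits then also satisfy $\mu\le_{cx}\nu$). $F_\eta(x)=\eta((-\infty,x])$, $F_\eta(x-)$ its left limit, $F_\eta^{-1}(u)=\inf\{x\in\mathbb R: F_\eta(x)\ge u\}$ for $u\in(0,1)$. $a\wedge b=\min(a,b)$, $a\vee b=\max(a,b)$. For $\pi\in\Pi(\mu,\nu)$, $\pi'\in\Pi(\mu',\nu')$, $$\mathcal{AW}_\rho(\pi,\pi')=\inf_{\chi\in\Pi(\mu,\mu')}\left(\int_{\mathbb R\times\mathbb R}\left(|x-x'|^\rho+\mathcal W_\rho^\rho(\pi_x,\pi'_{x'})\right)\chi(dx,dx')\right)^{1/\rho}.$$ **Inverse transform martingale coupling.** For $\mu\le_{cx}\nu$ in $\mathcal P_1(\mathbb R)$ let $\Psi_+(u)=\int_0^u(F_\mu^{-1}-F_\nu^{-1})^+(v)\,dv$ and $\Psi_-(u)=\int_0^u(F_\mu^{-1}-F_\nu^{-1})^-(v)\,dv$, $u\in[0,1]$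 (positive and negative parts); $\Psi_+(1)=\Psi_-(1)$. Let $\Psi_\pm^{-1}(w)=\inf\{r\in[0,1]:\Psi_\pm(r)\ge w\}$ be the left-continuous generalised inverses. Set $\varphi(u)=\Psi_-^{-1}(\Psi_+(u))$ if $F_\mu^{-1}(u)>F_\nu^{-1}(u)$, $\varphi(u)=\Psi_+^{-1}(\Psi_-(u))$ if $F_\mu^{-1}(u)<F_\nu^{-1}(u)$, and $\varphi(u)=u$ if $F_\mu^{-1}(u)=F_\nu^{-1}(u)$. Then $(\widetilde m^{IT}_u)_{u\in(0,1)}$ is the probability kernel satisfying for $du$-almost all $u\in(0,1)$ $$\widetilde m^{IT}_u=p(u)\,\delta_{F_\nu^{-1}(\varphi(u))}+(1-p(u))\,\delta_{F_\nu^{-1}(u)},\qquad p(u)=\mathbf 1_{\{F_\mu^{-1}(u)\neq F_\nu^{-1}(u)\}}\frac{F_\mu^{-1}(u)-F_\nu^{-1}(u)}{F_\nu^{-1}(\varphi(u))-F_\nu^{-1}(u)}$$ (for almost all $u$ with $F_\mu^{-1}(u)\ne F_\nu^{-1}(u)$ one has $\varphi(u)\in(0,1)$ and $p(u)\in[0,1]$), and the inverse transform martingale coupling between $\mu$ and $\nu$ is $M^{IT}(dx,dy)=\int_0^1\delta_{F_\mu^{-1}(u)}(dx)\,\widetilde m^{IT}_u(dy)\,du$. $M^{IT}_n$ is the same object with $(\mu_n,\nu_n)$ in place of $(\mu,\nu)$. *)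

theory Defs
  imports "HOL-Probability.Probability"
begin

definition prob_moment :: "real \<Rightarrow> real measure set" where
  "prob_moment \<rho> = {\<mu>. real_distribution \<mu> \<and> integrable \<mu> (\<lambda>x. \<bar>x\<bar> powr \<rho>)}"

text \<open>Power of an extended nonnegative real with a positive exponent, with infinity mapped to
  infinity.\<close>
definition epowr :: "ennreal \<Rightarrow> real \<Rightarrow> ennreal" where
  "epowr x p = (if x = \<top> then \<top> else ennreal (enn2real x powr p))"

definition couplings :: "real measure \<Rightarrow> real measure \<Rightarrow> (real \<times> real) measure set" where
  "couplings \<mu> \<nu> = {\<pi>. prob_space \<pi> \<and> sets \<pi> = sets (borel \<Otimes>\<^sub>M borel) \<and>
     distr \<pi> borel fst = \<mu> \<and> distr \<pi> borel snd = \<nu>}"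

definition wasserstein :: "real \<Rightarrow> real measure \<Rightarrow> real measure \<Rightarrow> ennreal" where
  "wasserstein \<rho> \<mu> \<nu> =
     epowr (INF \<pi>\<in>couplings \<mu> \<nu>. \<integral>\<^sup>+ z. ennreal (\<bar>fst z - snd z\<bar> powr \<rho>) \<partial>\<pi>) (1 / \<rho>)"

text \<open>Integral of the positive part minus integral of the negative part. A convex function on
  the line is bounded below by an affine function, so for probability measures with finite first
  moment the subtracted term is finite when \<open>f\<close> is convex, while the first one may be infinite.\<close>
definition ext_integral :: "'a measure \<Rightarrow> ('a \<Rightarrow> real) \<Rightarrow> ereal" where
  "ext_integral M f =
     enn2ereal (\<integral>\<^sup>+ x. ennreal (max 0 (f x)) \<partial>M) - enn2ereal (\<integral>\<^sup>+ x. ennreal (max 0 (- f x)) \<partial>M)"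

definition convex_le :: "real measure \<Rightarrow> real measure \<Rightarrow> bool" where
  "convex_le \<mu> \<nu> \<longleftrightarrow>
     (\<forall>f :: real \<Rightarrow> real. convex_on UNIV f \<longrightarrow> ext_integral \<mu> f \<le> ext_integral \<nu> f)"

definition cdf_left :: "real measure \<Rightarrow> real \<Rightarrow> real" where
  "cdf_left \<eta> x = Lim (at_left x) (cdf \<eta>)"

text \<open>Only meaningful for \<open>u\<close> in the open unit interval.\<close>
definition quantile :: "real measure \<Rightarrow> real \<Rightarrow> real" where
  "quantile \<eta> u = Inf {x. u \<le> cdf \<eta> x}"

definition is_disintegration :: "(real \<times> real) measure \<Rightarrow> (real \<Rightarrow> real measure) \<Rightarrow> bool" where
  "is_disintegration \<pi> K \<longleftrightarrow>
     K \<in> borel \<rightarrow>\<^sub>M prob_algebra borel \<and>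
     \<pi> = distr \<pi> borel fst \<bind> (\<lambda>x. distr (K x) (borel \<Otimes>\<^sub>M borel) (\<lambda>y. (x, y)))"

text \<open>A disintegration exists for every probability measure on the plane and is unique up to a
  null set of the first marginal, so the choice of version does not affect \<open>adapted_wasserstein\<close>,
  where the kernels are only integrated against couplings of the first marginals.\<close>
definition disintegration :: "(real \<times> real) measure \<Rightarrow> real \<Rightarrow> real measure" where
  "disintegration \<pi> = (SOME K. is_disintegration \<pi> K)"

definition adapted_wasserstein ::
    "real \<Rightarrow> (real \<times> real) measure \<Rightarrow> (real \<times> real) measure \<Rightarrow> ennreal" where
  "adapted_wasserstein \<rho> \<pi> \<pi>' =
     epowr (INF \<gamma>\<in>couplings (distr \<pi> borel fst) (distr \<pi>' borel fst).
       \<integral>\<^sup>+ z. (ennreal (\<bar>fst z - snd z\<bar> powr \<rho>)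
          + epowr (wasserstein \<rho> (disintegration \<pi> (fst z)) (disintegration \<pi>' (snd z))) \<rho>) \<partial>\<gamma>)
       (1 / \<rho>)"

definition Psi_plus :: "real measure \<Rightarrow> real measure \<Rightarrow> real \<Rightarrow> real" where
  "Psi_plus \<mu> \<nu> u = (LINT v:{0<..<u}|lborel. max 0 (quantile \<mu> v - quantile \<nu> v))"

definition Psi_minus :: "real measure \<Rightarrow> real measure \<Rightarrow> real \<Rightarrow> real" where
  "Psi_minus \<mu> \<nu> u = (LINT v:{0<..<u}|lborel. max 0 (- (quantile \<mu> v - quantile \<nu> v)))"

definition left_inverse01 :: "(real \<Rightarrow> real) \<Rightarrow> real \<Rightarrow> real" where
  "left_inverse01 \<Psi> w = Inf {r \<in> {0..1}. w \<le> \<Psi> r}"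

definition IT_phi :: "real measure \<Rightarrow> real measure \<Rightarrow> real \<Rightarrow> real" where
  "IT_phi \<mu> \<nu> u =
     (if quantile \<mu> u > quantile \<nu> u then left_inverse01 (Psi_minus \<mu> \<nu>) (Psi_plus \<mu> \<nu> u)
      else if quantile \<mu> u < quantile \<nu> u then left_inverse01 (Psi_plus \<mu> \<nu>) (Psi_minus \<mu> \<nu> u)
      else u)"

definition IT_p :: "real measure \<Rightarrow> real measure \<Rightarrow> real \<Rightarrow> real" where
  "IT_p \<mu> \<nu> u =
     (if quantile \<mu> u \<noteq> quantile \<nu> u
      then (quantile \<mu> u - quantile \<nu> u) / (quantile \<nu> (IT_phi \<mu> \<nu> u) - quantile \<nu> u)
      else 0)"

text \<open>The mixture \<open>p \<delta>\<^sub>a + (1 - p) \<delta>\<^sub>b\<close> for \<open>p\<close> in the closed unit interval. Other values of \<open>p\<close>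
  are truncated to that interval by \<open>bernoulli_pmf\<close>; in \<open>IT_kernel\<close> this happens only for \<open>u\<close> in a
  Lebesgue null set.\<close>
definition two_point :: "real \<Rightarrow> real \<Rightarrow> real \<Rightarrow> real measure" where
  "two_point p a b = distr (measure_pmf (bernoulli_pmf p)) borel (\<lambda>c. if c then a else b)"

definition IT_kernel :: "real measure \<Rightarrow> real measure \<Rightarrow> real \<Rightarrow> real measure" where
  "IT_kernel \<mu> \<nu> u =
     two_point (IT_p \<mu> \<nu> u) (quantile \<nu> (IT_phi \<mu> \<nu> u)) (quantile \<nu> u)"

definition IT_coupling :: "real measure \<Rightarrow> real measure \<Rightarrow> (real \<times> real) measure" where
  "IT_coupling \<mu> \<nu> =
     restrict_space lborel {0<..<1} \<bind>
       (\<lambda>u. distr (IT_kernel \<mu> \<nu> u) (borel \<Otimes>\<^sub>M borel) (\<lambda>y. (quantile \<mu> u, y)))"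

end

theory Submission
  imports Defs
begin

text \<open>
  Let \<open>Q\<close> and \<open>R\<close> be the quantile functions of \<open>\<mu>\<close> and \<open>\<nu>\<close>, and let \<open>u\<close>, \<open>v\<close> be independent and uniform
  on the unit interval. The inverse transform martingale coupling is the law of \<open>(Q u, Y u v)\<close>, where
  \<open>Y u v\<close> is the partner \<open>R (\<phi> u)\<close> if \<open>v < p u\<close> and \<open>R u\<close> otherwise (\<open>IT_coupling_eq_lift_law\<close>).
  The same \<open>u\<close> and \<open>v\<close> serve for the approximating pairs, with \<open>Q\<^sub>n\<close>, \<open>R\<^sub>n\<close> and \<open>Y\<^sub>n\<close>, and the first
  marginals are coupled by \<open>(Q\<^sub>n u, Q u)\<close>. The proof then has two parts.

  First, \<open>Y\<^sub>n\<close> converges to \<open>Y\<close> in \<open>L\<^sup>1\<close> of the unit square (\<open>IT_lift_L1_tendsto\<close>). Where \<open>Q u \<noteq> R u\<close>,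
  the partner is obtained by inverting one of the two primitives at a level of the other, and all of
  these are monotone functions that converge; so \<open>Y\<^sub>n\<close> converges outside of countably many \<open>u\<close>. Where
  \<open>Q u = R u\<close>, the partners need not converge, but the martingale property makes the mean distance of
  \<open>Y\<^sub>n u\<close> from \<open>R\<^sub>n u\<close> equal to \<open>\<bar>Q\<^sub>n u - R\<^sub>n u\<bar>\<close>, which tends to 0. Finally \<open>Y\<^sub>n\<close> has law \<open>\<nu>\<^sub>n\<close>
  (\<open>nn_integral_IT_lift\<close>), so that convergence in measure and convergence of the moments of \<open>\<nu>\<^sub>n\<close> give
  convergence in mean.

  Second, the adapted distance compares the disintegrations and not \<open>Y\<^sub>n\<close> and \<open>Y\<close> themselves. The
  kernel at \<open>Q u\<close> averages the law of \<open>Y u\<close> over the interval of all \<open>u\<close> with the same value of \<open>Q\<close>: its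
  distribution function at \<open>y\<close> is the conditional expectation of the probability of \<open>Y u \<le> y\<close> given
  \<open>Q\<close> (\<open>cexp_lift_cdf_AE\<close>). Conditional expectations are contractions, so the first part reduces the
  problem to the convergence of \<open>E[f | Q\<^sub>n]\<close> to \<open>E[f | Q]\<close> for fixed \<open>f\<close> (\<open>cexp_conv_integrable\<close>).
  Functions of \<open>Q\<close> pose no problem, because \<open>Q\<^sub>n\<close> converges to \<open>Q\<close>. The hypothesis on jumps takes care
  of functions that live on an interval where \<open>Q\<close> is constant: up to a small set, \<open>Q\<^sub>n\<close> is constant
  there as well, so that conditioning on \<open>Q\<^sub>n\<close> averages over the same interval. Integrating the
  difference of distribution functions over \<open>y\<close> yields convergence in \<open>L\<^sup>1\<close> of the quantile functions
  of the kernels, and since their moments of order \<open>\<rho>\<close> average to those of \<open>\<nu>\<^sub>n\<close> and \<open>\<nu>\<close>, also in \<open>L\<^sup>\<rho>\<close>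
  (\<open>adapted_wasserstein_lift_law_tendsto_zero\<close>).
\<close>

section \<open>Quantile functions and the uniform distribution\<close>

abbreviation (input) L1_dist :: "'a measure \<Rightarrow> ('a \<Rightarrow> real) \<Rightarrow> ('a \<Rightarrow> real) \<Rightarrow> ennreal" where
  "L1_dist M f g \<equiv> \<integral>\<^sup>+ x. ennreal \<bar>f x - g x\<bar> \<partial>M"

abbreviation (input) jointly_measurable :: "(real \<Rightarrow> real \<Rightarrow> 'b :: topological_space) \<Rightarrow> bool" where
  "jointly_measurable Y \<equiv> (\<lambda>z. Y (fst z) (snd z)) \<in> borel_measurable (borel \<Otimes>\<^sub>M borel)"

definition unif :: "real measure" where
  "unif = restrict_space lborel {0<..<1}"

lemma space_unif [simp]: "space unif = {0<..<1}"
  by (simp add: unif_def space_restrict_space)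

lemma sets_unif [measurable_cong]: "sets unif = sets (restrict_space borel {0<..<1})"
  unfolding unif_def by (intro sets_restrict_space_cong) simp

lemma prob_space_unif: "prob_space unif"
  unfolding unif_def by (auto simp: emeasure_restrict_space space_restrict_space intro!: prob_spaceI)

interpretation unif: prob_space unif
  by (rule prob_space_unif)

interpretation unif2: pair_prob_space unif unif ..

lemma measurable_unif_ident [measurable]: "(\<lambda>x. x) \<in> unif \<rightarrow>\<^sub>M borel"
  unfolding measurable_cong_sets[OF sets_unif refl]
  by (rule measurable_restrict_space1) simp

lemma measurable_unif: "f \<in> borel \<rightarrow>\<^sub>M N \<Longrightarrow> f \<in> unif \<rightarrow>\<^sub>M N"
  using measurable_compose[OF measurable_unif_ident] by simp

lemma measurable_unif2_ident [measurable]: "(\<lambda>x. x) \<in> unif \<Otimes>\<^sub>M unif \<rightarrow>\<^sub>M borel \<Otimes>\<^sub>M borel"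
proof -
  have "(\<lambda>x. (fst x, snd x)) \<in> unif \<Otimes>\<^sub>M unif \<rightarrow>\<^sub>M borel \<Otimes>\<^sub>M borel"
    by (intro measurable_Pair measurable_compose[OF measurable_fst measurable_unif_ident]
      measurable_compose[OF measurable_snd measurable_unif_ident])
  then show ?thesis by simp
qed

lemma nn_integral_unif:
  "(\<integral>\<^sup>+ u. f u \<partial>unif) = (\<integral>\<^sup>+ u. f u * indicator {0<..<1} u \<partial>lborel)"
  unfolding unif_def by (subst nn_integral_restrict_space) auto

lemma emeasure_unif: "A \<in> sets borel \<Longrightarrow> emeasure unif (A \<inter> {0<..<1}) = emeasure lborel (A \<inter> {0<..<1})"
  unfolding unif_def by (subst emeasure_restrict_space) auto

lemma AE_unif_countable:
  assumes "countable C" "\<And>u. 0 < u \<Longrightarrow> u < 1 \<Longrightarrow> u \<notin> C \<Longrightarrow> P u"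
  shows "AE u in unif. P u"
proof -
  have "AE u in lborel. u \<notin> C"
    using countable_imp_null_set_lborel[OF assms(1)] by (auto intro!: AE_I'[of C])
  then have "AE u in lborel. u \<in> {0<..<1} \<longrightarrow> P u"
    by eventually_elim (use assms(2) in auto)
  then show ?thesis
    unfolding unif_def by (subst AE_restrict_space_iff) auto
qed

text \<open>Together with Fubini this turns distances of random variables into distances of the
  indicators of their sublevel sets, integrated over the level.\<close>
lemma abs_diff_eq_nn_integral_indicator:
  "ennreal \<bar>a - b\<bar> = (L1_dist lborel (indicator {a..}) (indicator {b..}))"
  for a b :: real
proof -
  have *: "ennreal \<bar>a - b\<bar> = (L1_dist lborel (indicator {a..}) (indicator {b..}))"
    if "a \<le> b" for a b :: real
  proof -
    have "(L1_dist lborel (indicator {a..}) (indicator {b..})) =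
        (\<integral>\<^sup>+ y. indicator {a..<b} y \<partial>lborel)"
      using that by (intro nn_integral_cong) (auto split: split_indicator)
    also have "\<dots> = ennreal \<bar>a - b\<bar>" using that by simp
    finally show ?thesis ..
  qed
  show ?thesis
  proof (cases "a \<le> b")
    case False
    then show ?thesis using *[of b a] by (simp add: abs_minus_commute)
  qed (rule *)
qed

lemma quantile_le_iff:
  assumes "real_distribution \<mu>" "0 < u" "u < 1"
  shows "quantile \<mu> u \<le> x \<longleftrightarrow> u \<le> cdf \<mu> x"
proof -
  interpret cdf_distribution \<mu> by (simp add: cdf_distribution_def assms)
  show ?thesis using pseudoinverse[of u x] assms by (simp add: quantile_def)
qed

lemma mono_on_quantile: "real_distribution \<mu> \<Longrightarrow> mono_on {0<..<1} (quantile \<mu>)"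
  using quantile_le_iff by (intro mono_onI) (meson greaterThanLessThan_iff order.trans order_refl)

text \<open>Outside of the unit interval the quantile function takes the default values of \<open>Inf\<close> on the
  whole line and on the empty set. They matter only for Borel measurability on the line.\<close>
lemma quantile_outside:
  assumes "real_distribution \<mu>"
  shows "u \<le> 0 \<Longrightarrow> quantile \<mu> u = quantile \<mu> 0" "u > 1 \<Longrightarrow> quantile \<mu> u = quantile \<mu> 2"
proof -
  interpret real_distribution \<mu> by fact
  have "{x. u \<le> cdf \<mu> x} = UNIV" if "u \<le> 0" for u
    using that cdf_nonneg by (auto intro: order_trans)
  then show "u \<le> 0 \<Longrightarrow> quantile \<mu> u = quantile \<mu> 0"
    by (simp add: quantile_def)
  have "{x. u \<le> cdf \<mu> x} = {}" if "u > 1" for u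
    using that cdf_bounded_prob by (auto simp: not_le intro: le_less_trans)
  then show "u > 1 \<Longrightarrow> quantile \<mu> u = quantile \<mu> 2"
    by (simp add: quantile_def)
qed

lemma borel_measurable_quantile:
  assumes "real_distribution \<mu>"
  shows "quantile \<mu> \<in> borel_measurable borel"
proof (rule borel_measurable_piecewise_mono[of "{{..0}, {0<..<1}, {1}, {1<..}}"])
  fix c :: "real set" assume "c \<in> {{..0}, {0<..<1}, {1}, {1<..}}"
  then show "mono_on c (quantile \<mu>)"
  proof (elim insertE emptyE)
    assume c: "c = {..0}"
    show ?thesis
      unfolding c using quantile_outside(1)[OF assms] by (intro mono_onI) (metis atMost_iff order_refl)
  next
    assume c: "c = {1<..}"
    show ?thesis
      unfolding c using quantile_outside(2)[OF assms] by (intro mono_onI) (metis greaterThan_iff order_refl)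
  qed (use mono_on_quantile[OF assms] in \<open>auto simp: mono_on_def\<close>)
next
  show "\<Union> {{..0}, {0<..<1}, {1}, {1<..}} = (UNIV :: real set)"
    by (auto simp: not_le not_less)
qed auto

lemma distr_quantile: "real_distribution \<mu> \<Longrightarrow> distr unif borel (quantile \<mu>) = \<mu>"
  using cdf_distribution.distr_I_eq_M[of \<mu>]
  by (simp add: cdf_distribution_def quantile_def[abs_def] unif_def)

text \<open>For a monotone function this lower bound amounts to left-continuity. It later makes
  primitives strictly increasing to the left of each point at which their density is positive.\<close>
lemma quantile_left_continuous:
  assumes "real_distribution \<mu>" "0 < u" "u < 1" "x < quantile \<mu> u"
  obtains s where "0 < s" "s < u" "\<And>t. s < t \<Longrightarrow> t \<le> u \<Longrightarrow> x < quantile \<mu> t"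
proof -
  have "cdf \<mu> x < u" using assms quantile_le_iff[of \<mu> u x] by auto
  moreover have "cdf \<mu> x \<ge> 0" using assms(1) 
    by (simp add: finite_borel_measure.cdf_nonneg real_distribution.finite_borel_measure_M)
  moreover have "x < quantile \<mu> t" if "cdf \<mu> x < t" "t \<le> u" for t
    using that assms quantile_le_iff[of \<mu> t x] \<open>cdf \<mu> x \<ge> 0\<close> by auto
  ultimately show ?thesis
    using that[of "(cdf \<mu> x + u)/2"] assms by auto
qed

lemma nn_integral_unif_indicator_diff:
  assumes "0 \<le> a" "a \<le> 1" "0 \<le> b" "b \<le> 1"
  shows "(\<integral>\<^sup>+ u. ennreal \<bar>indicator {u..} a - indicator {u..} b\<bar> \<partial>unif) = ennreal \<bar>a - b\<bar>"
proof -
  have *: "(\<integral>\<^sup>+ u. ennreal \<bar>indicator {u..} a - indicator {u..} b\<bar> \<partial>unif) = ennreal \<bar>a - b\<bar>"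
    if "0 \<le> a" "b \<le> 1" "a \<le> b" for a b :: real
  proof -
    have "(\<integral>\<^sup>+ u. ennreal \<bar>indicator {u..} a - indicator {u..} b\<bar> \<partial>unif)
       = (\<integral>\<^sup>+ u. indicator ({a<..b} \<inter> {0<..<1}) u \<partial>lborel)"
      unfolding nn_integral_unif using that
      by (intro nn_integral_cong) (auto split: split_indicator)
    also have "\<dots> = (\<integral>\<^sup>+ u. indicator {a<..b} u \<partial>lborel)"
    proof (rule nn_integral_cong_AE)
      have "AE u in lborel. u \<noteq> (1::real)" by (rule AE_lborel_singleton)
      then show "AE u in lborel. (indicator ({a<..b} \<inter> {0<..<1}) u :: ennreal) = indicator {a<..b} u"
        by eventually_elim (use that in \<open>auto split: split_indicator\<close>)
    qed
    also have "\<dots> = ennreal \<bar>a - b\<bar>" using that by simp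
    finally show ?thesis .
  qed
  show ?thesis
  proof (cases "a \<le> b")
    case True then show ?thesis using * assms by simp
  next
    case False
    then show ?thesis using *[of b a] assms by (simp add: abs_minus_commute)
  qed
qed

text \<open>Both sides are the area between the two graphs, cut into vertical and into horizontal
  slices.\<close>
lemma nn_integral_cdf_diff_eq_quantile_diff:
  assumes "real_distribution \<mu>" "real_distribution \<nu>"
  shows "(L1_dist lborel (cdf \<mu>) (cdf \<nu>))
    = (L1_dist unif (quantile \<mu>) (quantile \<nu>))"
proof -
  interpret M: real_distribution \<mu> by fact
  interpret N: real_distribution \<nu> by fact
  note [measurable] = borel_measurable_quantile[OF assms(1)] borel_measurable_quantile[OF assms(2)]
  have "(L1_dist unif (quantile \<mu>) (quantile \<nu>)) = (\<integral>\<^sup>+ u. (\<integral>\<^sup>+ y.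
      ennreal \<bar>indicator {quantile \<mu> u..} y - indicator {quantile \<nu> u..} y\<bar> \<partial>lborel) \<partial>unif)"
    by (intro nn_integral_cong abs_diff_eq_nn_integral_indicator)
  also have "\<dots> = (\<integral>\<^sup>+ y. (\<integral>\<^sup>+ u.
      ennreal \<bar>indicator {quantile \<mu> u..} y - indicator {quantile \<nu> u..} y\<bar> \<partial>unif) \<partial>lborel)"
    by (intro pair_sigma_finite.Fubini')
      (auto simp: pair_sigma_finite_def unif.sigma_finite_measure_axioms sigma_finite_lborel indicator_def)
  also have "\<dots> = (\<integral>\<^sup>+ y. (\<integral>\<^sup>+ u.
      ennreal \<bar>indicator {u..} (cdf \<mu> y) - indicator {u..} (cdf \<nu> y)\<bar> \<partial>unif) \<partial>lborel)"
    using quantile_le_iff[OF assms(1)] quantile_le_iff[OF assms(2)]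
    by (intro nn_integral_cong) (auto split: split_indicator)
  also have "\<dots> = (L1_dist lborel (cdf \<mu>) (cdf \<nu>))"
    by (intro nn_integral_cong nn_integral_unif_indicator_diff)
      (auto simp: M.cdf_nonneg N.cdf_nonneg M.cdf_bounded_prob N.cdf_bounded_prob)
  finally show ?thesis ..
qed

section \<open>Convergence of powers from convergence of moments\<close>

lemma tendsto_zero_subseqI:
  fixes a :: "nat \<Rightarrow> ennreal"
  assumes "\<And>r :: nat \<Rightarrow> nat. strict_mono r \<Longrightarrow> \<exists>s :: nat \<Rightarrow> nat. strict_mono s \<and> (\<lambda>n. a (r (s n))) \<longlonglongrightarrow> 0"
  shows "a \<longlonglongrightarrow> 0"
proof (rule ccontr)
  assume "\<not> a \<longlonglongrightarrow> 0"
  then obtain e where e: "e > 0" "\<not> (\<forall>\<^sub>F n in sequentially. a n < e)"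
    by (auto simp: order_tendsto_iff)
  have "\<exists>\<^sub>\<infinity>n. a n \<ge> e"
    using e(2) by (simp add: frequently_def not_le cofinite_eq_sequentially)
  then obtain r :: "nat \<Rightarrow> nat" where r: "strict_mono r" "\<And>n. a (r n) \<ge> e"
    using infinite_enumerate[of "{n. a n \<ge> e}"] by (auto simp: frequently_cofinite)
  obtain s :: "nat \<Rightarrow> nat" where "strict_mono s" "(\<lambda>n. a (r (s n))) \<longlonglongrightarrow> 0"
    using assms[OF r(1)] by auto
  then have "\<forall>\<^sub>F n in sequentially. a (r (s n)) < e" using e(1) by (auto simp: order_tendsto_iff)
  then show False using r(2) by (auto simp: eventually_sequentially not_le[symmetric])
qed

lemma abs_diff_powr_le:
  fixes a b \<rho> :: real
  assumes "\<rho> \<ge> 1"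
  shows "\<bar>a - b\<bar> powr \<rho> \<le> 2 powr \<rho> * (\<bar>a\<bar> powr \<rho> + \<bar>b\<bar> powr \<rho>)"
proof -
  have "\<bar>a - b\<bar> powr \<rho> \<le> (2 * max \<bar>a\<bar> \<bar>b\<bar>) powr \<rho>"
    using assms by (intro powr_mono2) auto
  also have "\<dots> = 2 powr \<rho> * max \<bar>a\<bar> \<bar>b\<bar> powr \<rho>"
    by (simp add: powr_mult)
  also have "max \<bar>a\<bar> \<bar>b\<bar> powr \<rho> \<le> \<bar>a\<bar> powr \<rho> + \<bar>b\<bar> powr \<rho>"
    by (simp add: max_def)
  finally show ?thesis by simp
qed

text \<open>Made for use with the lemma of Fatou, which bounds the limit inferior of \<open>g\<close> from below by
  the limit of the whole sum.\<close>
lemma tendsto_zero_if_liminf_complement: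
  fixes d g :: "nat \<Rightarrow> ennreal"
  assumes "L < \<top>" "(\<lambda>n. d n + g n) \<longlonglongrightarrow> L" "L \<le> liminf g"
  shows "d \<longlonglongrightarrow> 0"
proof (rule order_tendstoI)
  fix e :: ennreal assume "0 < e"
  then obtain y where y: "0 < y" "y < e"
    using dense by blast
  then have "y < \<top>" by (metis less_trans top.not_eq_extremum)
  then obtain e' where e': "0 < e'" "ennreal e' < e"
    using y by (cases y) (auto simp: ennreal_less_zero_iff)
  obtain l where l: "L = ennreal l" "l \<ge> 0" using assms(1) by (cases L) auto
  have "L < ennreal (l + e'/2)" unfolding l using e' l by (intro ennreal_lessI) auto
  then have ev1: "\<forall>\<^sub>F n in sequentially. d n + g n < ennreal (l + e'/2)"
    using assms(2) by (auto simp: order_tendsto_iff)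
  show "\<forall>\<^sub>F n in sequentially. d n < e"
  proof (cases "l - e'/2 < 0")
    case True
    from ev1 show ?thesis
    proof eventually_elim
      case (elim n)
      have "d n \<le> d n + g n" by simp
      also have "\<dots> < ennreal (l + e'/2)" by fact
      also have "\<dots> \<le> ennreal e'" using True by (intro ennreal_leI) auto
      finally show ?case using e' by auto
    qed
  next
    case False
    have "ennreal (l - e'/2) < L" unfolding l using e' False by (intro ennreal_lessI) auto
    then have "\<forall>\<^sub>F n in sequentially. ennreal (l - e'/2) < g n"
      using assms(3) by (metis less_LiminfD less_le_trans)
    with ev1 show ?thesis
    proof eventually_elim
      case (elim n)
      then have "d n < \<top>" "g n < \<top>" by (auto simp: less_top[symmetric])
      then obtain x y where xy: "d n = ennreal x" "x \<ge> 0" "g n = ennreal y" "y \<ge> 0"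
        by (metis ennreal_cases less_irrefl)
      have "x + y < l + e'/2" using elim(1) l(2) e'(1) unfolding xy
        by (simp add: xy(2,4) ennreal_plus[symmetric] ennreal_less_iff del: ennreal_plus)
      moreover have "l - e'/2 < y" using elim(2) False unfolding xy by (simp add: ennreal_less_iff)
      ultimately have "x < e'" by simp
      then have "d n < ennreal e'" unfolding xy(1) using xy(2) by (simp add: ennreal_less_iff)
      then show ?case using e' by auto
    qed
  qed
qed simp

text \<open>The theorem of Riesz, starting from convergence in measure. Along a subsequence that
  converges almost everywhere, the lemma of Fatou applies to the functions \<open>c * (\<bar>fs n\<bar> powr \<rho> +
  \<bar>f\<bar> powr \<rho>) - \<bar>fs n - f\<bar> powr \<rho>\<close>, which are nonnegative for \<open>c = 2 powr \<rho>\<close>.\<close>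
lemma (in finite_measure) Lp_convergence_if_norm_convergence:
  fixes f :: "'a \<Rightarrow> real" and fs :: "nat \<Rightarrow> 'a \<Rightarrow> real"
  assumes \<rho>: "\<rho> \<ge> 1" and [measurable]: "\<And>n. fs n \<in> borel_measurable M" "f \<in> borel_measurable M"
    and conv: "(\<lambda>n. \<integral>\<^sup>+ x. ennreal (min 1 \<bar>fs n x - f x\<bar>) \<partial>M) \<longlonglongrightarrow> 0"
    and norm: "(\<lambda>n. \<integral>\<^sup>+ x. ennreal (\<bar>fs n x\<bar> powr \<rho>) \<partial>M) \<longlonglongrightarrow> (\<integral>\<^sup>+ x. ennreal (\<bar>f x\<bar> powr \<rho>) \<partial>M)"
    and fin: "(\<integral>\<^sup>+ x. ennreal (\<bar>f x\<bar> powr \<rho>) \<partial>M) < \<top>"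
  shows "(\<lambda>n. \<integral>\<^sup>+ x. ennreal (\<bar>fs n x - f x\<bar> powr \<rho>) \<partial>M) \<longlonglongrightarrow> 0"
proof (rule tendsto_zero_subseqI)
  fix r :: "nat \<Rightarrow> nat" assume r: "strict_mono r"
  define e where "e n x = min 1 \<bar>fs (r n) x - f x\<bar>" for n x
  have e_int: "integrable M (e n)" for n
    unfolding e_def by (rule integrable_const_bound[of _ 1]) auto
  have "(\<lambda>n. \<integral>\<^sup>+ x. ennreal (e n x) \<partial>M) \<longlonglongrightarrow> ennreal 0"
    unfolding e_def using LIMSEQ_subseq_LIMSEQ[OF conv r] by (simp add: o_def)
  moreover have "(\<integral>\<^sup>+ x. ennreal (e n x) \<partial>M) = ennreal (\<integral>x. norm (e n x) \<partial>M)" for n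
    using e_int[of n] by (subst nn_integral_eq_integral) (auto simp: e_def[abs_def])
  ultimately have "(\<lambda>n. ennreal (\<integral>x. norm (e n x) \<partial>M)) \<longlonglongrightarrow> ennreal 0"
    by simp
  then have "(\<lambda>n. \<integral>x. norm (e n x) \<partial>M) \<longlonglongrightarrow> 0"
    by (subst (asm) tendsto_ennreal_iff) auto
  from tendsto_L1_AE_subseq[OF e_int this] obtain s :: "nat \<Rightarrow> nat"
    where s: "strict_mono s" and AE0: "AE x in M. (\<lambda>n. e (s n) x) \<longlonglongrightarrow> 0" by auto
  from AE0 have AE: "AE x in M. (\<lambda>n. fs (r (s n)) x) \<longlonglongrightarrow> f x"
  proof eventually_elim
    case (elim x)
    have "(\<lambda>n. \<bar>fs (r (s n)) x - f x\<bar>) \<longlonglongrightarrow> 0"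
    proof (rule Lim_transform_eventually[OF elim])
      have "\<forall>\<^sub>F n in sequentially. e (s n) x < 1" using elim by (auto simp: order_tendsto_iff)
      then show "\<forall>\<^sub>F n in sequentially. e (s n) x = \<bar>fs (r (s n)) x - f x\<bar>"
        by eventually_elim (auto simp: e_def min_def split: if_splits)
    qed
    then show ?case using tendsto_rabs_zero_iff LIM_zero_iff by fastforce
  qed
  define F where "F n x = fs (r (s n)) x" for n x
  have [measurable]: "F n \<in> borel_measurable M" for n unfolding F_def by simp
  define c where "c = 2 powr \<rho>"
  have c: "c \<ge> 0" unfolding c_def by simp
  define g where "g n x = c * (\<bar>F n x\<bar> powr \<rho> + \<bar>f x\<bar> powr \<rho>) - \<bar>F n x - f x\<bar> powr \<rho>" for n x
  have g_nonneg: "g n x \<ge> 0" for n x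
    using abs_diff_powr_le[OF \<rho>, of "F n x" "f x"] by (simp add: g_def c_def)
  have [measurable]: "g n \<in> borel_measurable M" for n unfolding g_def[abs_def] by measurable
  define m where "m = (\<integral>\<^sup>+ x. ennreal (\<bar>f x\<bar> powr \<rho>) \<partial>M)"
  have norm': "(\<lambda>n. \<integral>\<^sup>+ x. ennreal (\<bar>F n x\<bar> powr \<rho>) \<partial>M) \<longlonglongrightarrow> m"
    using LIMSEQ_subseq_LIMSEQ[OF norm strict_mono_compose[OF r s]] by (simp add: o_def m_def F_def)
  have "(\<lambda>n. \<integral>\<^sup>+ x. ennreal (\<bar>F n x - f x\<bar> powr \<rho>) \<partial>M) \<longlonglongrightarrow> 0"
  proof (rule tendsto_zero_if_liminf_complement[where L = "ennreal c * (m + m)"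
        and g = "\<lambda>n. \<integral>\<^sup>+ x. ennreal (g n x) \<partial>M"])
    show "ennreal c * (m + m) < \<top>"
      using fin by (simp add: m_def ennreal_mult_less_top)
    have "(\<integral>\<^sup>+ x. ennreal (\<bar>F n x - f x\<bar> powr \<rho>) \<partial>M) + (\<integral>\<^sup>+ x. ennreal (g n x) \<partial>M)
       = ennreal c * ((\<integral>\<^sup>+ x. ennreal (\<bar>F n x\<bar> powr \<rho>) \<partial>M) + m)" for n
    proof -
      have "(\<integral>\<^sup>+ x. ennreal (\<bar>F n x - f x\<bar> powr \<rho>) \<partial>M) + (\<integral>\<^sup>+ x. ennreal (g n x) \<partial>M)
         = (\<integral>\<^sup>+ x. ennreal (\<bar>F n x - f x\<bar> powr \<rho>) + ennreal (g n x) \<partial>M)"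
        by (subst nn_integral_add) auto
      also have "\<dots> = (\<integral>\<^sup>+ x. ennreal c * (ennreal (\<bar>F n x\<bar> powr \<rho>) + ennreal (\<bar>f x\<bar> powr \<rho>)) \<partial>M)"
        using c g_nonneg by (intro nn_integral_cong)
          (simp add: ennreal_mult[symmetric] ennreal_plus[symmetric] g_def del: ennreal_plus)
      also have "\<dots> = ennreal c * ((\<integral>\<^sup>+ x. ennreal (\<bar>F n x\<bar> powr \<rho>) \<partial>M) + m)"
        unfolding m_def by (subst nn_integral_cmult) (auto simp: nn_integral_add)
      finally show ?thesis .
    qed
    moreover have "(\<lambda>n. ennreal c * ((\<integral>\<^sup>+ x. ennreal (\<bar>F n x\<bar> powr \<rho>) \<partial>M) + m)) \<longlonglongrightarrow> ennreal c * (m + m)"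
      by (intro ennreal_tendsto_cmult tendsto_add norm' tendsto_const) auto
    ultimately show "(\<lambda>n. (\<integral>\<^sup>+ x. ennreal (\<bar>F n x - f x\<bar> powr \<rho>) \<partial>M) + (\<integral>\<^sup>+ x. ennreal (g n x) \<partial>M))
      \<longlonglongrightarrow> ennreal c * (m + m)" by simp
    have "ennreal c * (m + m) = (\<integral>\<^sup>+ x. ennreal (c * (\<bar>f x\<bar> powr \<rho> + \<bar>f x\<bar> powr \<rho>)) \<partial>M)"
    proof -
      have "ennreal c * (m + m) = (\<integral>\<^sup>+ x. ennreal c * (ennreal (\<bar>f x\<bar> powr \<rho>) + ennreal (\<bar>f x\<bar> powr \<rho>)) \<partial>M)"
        unfolding m_def by (subst nn_integral_cmult, measurable) (subst nn_integral_add, auto)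
      also have "\<dots> = (\<integral>\<^sup>+ x. ennreal (c * (\<bar>f x\<bar> powr \<rho> + \<bar>f x\<bar> powr \<rho>)) \<partial>M)"
        by (intro nn_integral_cong, subst ennreal_mult[OF c], simp, subst ennreal_plus) auto
      finally show ?thesis .
    qed
    also have "\<dots> = (\<integral>\<^sup>+ x. liminf (\<lambda>n. ennreal (g n x)) \<partial>M)"
    proof (rule nn_integral_cong_AE, use AE in eventually_elim)
      case (elim x)
      then have "(\<lambda>n. F n x) \<longlonglongrightarrow> f x" by (simp add: F_def)
      then have "(\<lambda>n. g n x) \<longlonglongrightarrow> c * (\<bar>f x\<bar> powr \<rho> + \<bar>f x\<bar> powr \<rho>) - \<bar>f x - f x\<bar> powr \<rho>"
        unfolding g_def by (intro tendsto_intros) (use \<rho> in auto)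
      then have "(\<lambda>n. ennreal (g n x)) \<longlonglongrightarrow> ennreal (c * (\<bar>f x\<bar> powr \<rho> + \<bar>f x\<bar> powr \<rho>))"
        by (intro tendsto_ennrealI) simp
      then show ?case using lim_imp_Liminf by (metis trivial_limit_sequentially)
    qed
    also have "\<dots> \<le> liminf (\<lambda>n. \<integral>\<^sup>+ x. ennreal (g n x) \<partial>M)"
      by (intro nn_integral_liminf) auto
    finally show "ennreal c * (m + m) \<le> liminf (\<lambda>n. \<integral>\<^sup>+ x. ennreal (g n x) \<partial>M)" .
  qed
  then show "\<exists>s :: nat \<Rightarrow> nat. strict_mono s \<and>
      (\<lambda>n. \<integral>\<^sup>+ x. ennreal (\<bar>fs (r (s n)) x - f x\<bar> powr \<rho>) \<partial>M) \<longlonglongrightarrow> 0"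
    using s by (auto simp: F_def)
qed

text \<open>Convexity of the power at the point \<open>a + b = (1 - t) * (a / (1 - t)) + t * (b / t)\<close>. As \<open>t\<close>
  tends to 0 the first weight tends to 1, so that in limits this replaces the inequality of
  Minkowski.\<close>
lemma powr_add_le_weighted:
  fixes a b t \<rho> :: real
  assumes "a \<ge> 0" "b \<ge> 0" "0 < t" "t < 1" "\<rho> \<ge> 1"
  shows "(a + b) powr \<rho> \<le> (1 - t) powr (1 - \<rho>) * a powr \<rho> + t powr (1 - \<rho>) * b powr \<rho>"
proof (cases "a = 0 \<or> b = 0")
  case True
  have "s powr (1 - \<rho>) \<ge> 1" if "0 < s" "s < 1" for s
    using powr_le1[of "\<rho> - 1" s] that assms powr_minus_divide[of s "\<rho> - 1"] by simp
  from this[of t] this[of "1 - t"] show ?thesis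
    using True assms mult_right_mono[of 1 "t powr (1 - \<rho>)" "b powr \<rho>"]
      mult_right_mono[of 1 "(1 - t) powr (1 - \<rho>)" "a powr \<rho>"] by auto
next
  case False
  have "((1 - t) *\<^sub>R (a / (1 - t)) + t *\<^sub>R (b / t)) powr \<rho>
      \<le> (1 - t) * (a / (1 - t)) powr \<rho> + t * (b / t) powr \<rho>"
    using False assms by (intro convex_onD[OF powr_convex]) auto
  also have "(1 - t) *\<^sub>R (a / (1 - t)) + t *\<^sub>R (b / t) = a + b" using assms by simp
  also have "(1 - t) * (a / (1 - t)) powr \<rho> = (1 - t) powr (1 - \<rho>) * a powr \<rho>"
    using assms by (simp add: powr_divide powr_diff)
  also have "t * (b / t) powr \<rho> = t powr (1 - \<rho>) * b powr \<rho>"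
    using assms by (simp add: powr_divide powr_diff)
  finally show ?thesis .
qed

text \<open>For fixed \<open>t\<close> the error \<open>B t * cs n\<close> vanishes as \<open>n\<close> grows, however large \<open>B t\<close> is; only
  then does \<open>t\<close> tend to 0.\<close>
lemma tendsto_if_weighted_bounds:
  fixes m :: real and ms cs :: "nat \<Rightarrow> real" and A B :: "real \<Rightarrow> real"
  assumes le: "\<And>n t. 0 < t \<Longrightarrow> t < 1 \<Longrightarrow> ms n \<le> A t * m + B t * cs n"
      "\<And>n t. 0 < t \<Longrightarrow> t < 1 \<Longrightarrow> m \<le> A t * ms n + B t * cs n"
    and A: "(A \<longlongrightarrow> 1) (at_right 0)" and c: "cs \<longlonglongrightarrow> 0"
  shows "ms \<longlonglongrightarrow> m"
proof (rule order_tendstoI)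
  fix K assume K: "m < K"
  have "((\<lambda>t. A t * m) \<longlongrightarrow> 1 * m) (at_right 0)" by (intro tendsto_intros A)
  then have "\<forall>\<^sub>F t in at_right 0. A t * m < K" using K by (auto simp: order_tendsto_iff)
  moreover have "\<forall>\<^sub>F t in at_right 0. 0 < t \<and> t < (1::real)"
    by (intro eventually_at_rightI[of 0 1]) auto
  ultimately have "\<forall>\<^sub>F t in at_right 0. A t * m < K \<and> 0 < t \<and> t < 1" by eventually_elim auto
  then obtain t where t: "A t * m < K" "0 < t" "t < 1"
    using eventually_happens'[of "at_right (0::real)"] by auto
  have "(\<lambda>n. A t * m + B t * cs n) \<longlonglongrightarrow> A t * m + B t * 0" by (intro tendsto_intros c)
  then have "\<forall>\<^sub>F n in sequentially. A t * m + B t * cs n < K" using t by (auto simp: order_tendsto_iff)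
  then show "\<forall>\<^sub>F n in sequentially. ms n < K"
    by eventually_elim (use le(1)[OF t(2,3)] in \<open>auto intro: le_less_trans\<close>)
next
  fix K assume K: "K < m"
  have "((\<lambda>t. A t * K) \<longlongrightarrow> 1 * K) (at_right 0)" by (intro tendsto_intros A)
  then have "\<forall>\<^sub>F t in at_right 0. A t * K < m" using K by (auto simp: order_tendsto_iff)
  moreover have "\<forall>\<^sub>F t in at_right 0. A t > 0" using A by (auto simp: order_tendsto_iff)
  moreover have "\<forall>\<^sub>F t in at_right 0. 0 < t \<and> t < (1::real)"
    by (intro eventually_at_rightI[of 0 1]) auto
  ultimately have "\<forall>\<^sub>F t in at_right 0. A t * K < m \<and> A t > 0 \<and> 0 < t \<and> t < 1" by eventually_elim auto
  then obtain t where t: "A t * K < m" "A t > 0" "0 < t" "t < 1"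
    using eventually_happens'[of "at_right (0::real)"] by auto
  have "(\<lambda>n. m - B t * cs n) \<longlonglongrightarrow> m - B t * 0" by (intro tendsto_intros c)
  then have "\<forall>\<^sub>F n in sequentially. A t * K < m - B t * cs n" using t by (auto simp: order_tendsto_iff)
  then show "\<forall>\<^sub>F n in sequentially. K < ms n"
  proof eventually_elim
    case (elim n)
    have "A t * K < A t * ms n" using le(2)[OF t(3,4), of n] elim by simp
    then show ?case using t(2) by simp
  qed
qed

section \<open>Conditioning on converging monotone functions\<close>

lemma sets_borel_eq_sigma_atMost: "sets borel = sigma_sets UNIV (range (\<lambda>a::real. {..a}))"
  unfolding borel_eq_atMost by (rule sets_measure_of) simp

lemma tendsto_zero_approx:
  fixes a :: "nat \<Rightarrow> ennreal"
  assumes le: "\<And>k n. a n \<le> b k + c k n" and b: "b \<longlonglongrightarrow> 0" and c: "\<And>k :: nat. c k \<longlonglongrightarrow> 0"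
  shows "a \<longlonglongrightarrow> 0"
proof (rule order_tendstoI)
  fix e :: ennreal assume "0 < e"
  have "\<exists>d>0. d + d < e"
  proof -
    obtain y where y: "0 < y" "y < e" using dense \<open>0 < e\<close> by blast
    have "y / 2 + y / 2 = y" by (metis ennreal_divide_times ennreal_times_divide mult_2 mult_2_right
      ennreal_numeral_less_top ennreal_mult_divide_eq top.not_eq_extremum zero_neq_numeral)
    then show ?thesis using y by (intro exI[of _ "y/2"]) (auto simp: ennreal_zero_less_divide)
  qed
  then obtain d where d: "0 < d" "d + d < e" by blast
  have "\<forall>\<^sub>F k in sequentially. b k < d" using b d by (auto simp: order_tendsto_iff)
  then obtain k where k: "b k < d" by (auto simp: eventually_sequentially)
  have "\<forall>\<^sub>F n in sequentially. c k n < d" using c[of k] d by (auto simp: order_tendsto_iff)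
  then show "\<forall>\<^sub>F n in sequentially. a n < e"
  proof eventually_elim
    case (elim n)
    have "a n \<le> b k + c k n" by (rule le)
    also have "\<dots> \<le> d + d" using k elim by (intro add_mono) auto
    also have "\<dots> < e" by (rule d)
    finally show ?case .
  qed
qed simp

lemma tendsto_zero_le:
  fixes a b :: "nat \<Rightarrow> ennreal"
  assumes "b \<longlonglongrightarrow> 0" "\<And>n. a n \<le> b n"
  shows "a \<longlonglongrightarrow> 0"
  by (rule tendsto_sandwich[OF _ _ tendsto_const assms(1)]) (auto simp: assms(2))

lemma nn_integral_abs_triangle:
  fixes f g h :: "'a \<Rightarrow> real"
  assumes [measurable]: "f \<in> borel_measurable M" "g \<in> borel_measurable M" "h \<in> borel_measurable M"
  shows "(L1_dist M f h) \<le>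
    (L1_dist M f g) + (L1_dist M g h)"
proof -
  have "(L1_dist M f h) \<le> (\<integral>\<^sup>+ x. ennreal \<bar>f x - g x\<bar> + ennreal \<bar>g x - h x\<bar> \<partial>M)"
    by (intro nn_integral_mono) (simp add: ennreal_plus[symmetric] ennreal_leI del: ennreal_plus)
  then show ?thesis by (simp add: nn_integral_add)
qed

lemma (in finite_measure) bounded_convergence_L1:
  fixes f :: "'a \<Rightarrow> real"
  assumes [measurable]: "\<And>n. fs n \<in> borel_measurable M" "f \<in> borel_measurable M"
    and "AE x in M. (\<lambda>n. fs n x) \<longlonglongrightarrow> f x" and "\<And>n x. \<bar>fs n x - f x\<bar> \<le> B"
  shows "(\<lambda>n. L1_dist M (fs n) f) \<longlonglongrightarrow> 0"
proof -
  have "(\<lambda>n. L1_dist M (fs n) f) \<longlonglongrightarrow> (\<integral>\<^sup>+ x. 0 \<partial>M)"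
  proof (rule nn_integral_dominated_convergence[where w="\<lambda>_. ennreal B"])
    show "AE x in M. (\<lambda>n. ennreal \<bar>fs n x - f x\<bar>) \<longlonglongrightarrow> 0"
      using assms(3)
    proof eventually_elim
      case (elim x)
      then have "(\<lambda>n. \<bar>fs n x - f x\<bar>) \<longlonglongrightarrow> 0" using LIM_zero tendsto_rabs_zero by blast
      then show ?case using tendsto_ennrealI by fastforce
    qed
  qed (auto intro!: ennreal_leI assms simp: emeasure_eq_measure ennreal_mult_less_top)
  then show ?thesis by simp
qed

text \<open>Conditional expectation, under the uniform law on the unit interval, given the random
  variable \<open>q\<close>.\<close>
definition cexp :: "(real \<Rightarrow> real) \<Rightarrow> (real \<Rightarrow> real) \<Rightarrow> real \<Rightarrow> real" where
  "cexp q f = real_cond_exp unif (vimage_algebra {0<..<1} q borel) f"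

lemma subalgebra_vimage_unif:
  assumes "q \<in> borel_measurable borel"
  shows "finite_measure_subalgebra unif (vimage_algebra {0<..<1} q borel)"
proof (intro finite_measure_subalgebra.intro finite_measure_subalgebra_axioms.intro)
  show "subalgebra unif (vimage_algebra {0<..<1} q borel)"
    using measurable_unif[OF assms] unfolding subalgebra_def
    by (auto simp: sets_vimage_algebra2 dest: measurable_sets)
qed (rule unif.finite_measure_axioms)

lemma cexp_borel_measurable [measurable]: "cexp q f \<in> borel_measurable unif"
  unfolding cexp_def by simp

context
  fixes q :: "real \<Rightarrow> real"
  assumes q [measurable]: "q \<in> borel_measurable borel"
begin

interpretation finite_measure_subalgebra unif "vimage_algebra {0<..<1} q borel"
  by (rule subalgebra_vimage_unif[OF q])

lemma cexp_L1_le: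
  assumes [measurable]: "integrable unif f"
  shows "(\<integral>\<^sup>+ u. ennreal \<bar>cexp q f u\<bar> \<partial>unif) \<le> (\<integral>\<^sup>+ u. ennreal \<bar>f u\<bar> \<partial>unif)"
proof -
  let ?F = "vimage_algebra {0<..<1} q borel"
  have [measurable]: "f \<in> borel_measurable unif" using assms by auto
  have "(\<integral>\<^sup>+ u. ennreal \<bar>cexp q f u\<bar> \<partial>unif) \<le> (\<integral>\<^sup>+ u. nn_cond_exp unif ?F (\<lambda>u. ennreal \<bar>f u\<bar>) u \<partial>unif)"
    unfolding cexp_def by (intro nn_integral_mono_AE real_cond_exp_abs) auto
  also have "\<dots> = (\<integral>\<^sup>+ u. ennreal \<bar>f u\<bar> \<partial>unif)"
    using nn_cond_exp_intg[of "\<lambda>_. 1" "\<lambda>u. ennreal \<bar>f u\<bar>"] by simp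
  finally show ?thesis .
qed

lemma cexp_diff_AE:
  "integrable unif f \<Longrightarrow> integrable unif g \<Longrightarrow>
    AE u in unif. cexp q (\<lambda>u. f u - g u) u = cexp q f u - cexp q g u"
  unfolding cexp_def by (rule real_cond_exp_diff)

lemma cexp_add_AE:
  "integrable unif f \<Longrightarrow> integrable unif g \<Longrightarrow>
    AE u in unif. cexp q (\<lambda>u. f u + g u) u = cexp q f u + cexp q g u"
  unfolding cexp_def by (rule real_cond_exp_add)

lemma cexp_cmult_AE:
  "integrable unif f \<Longrightarrow> AE u in unif. cexp q (\<lambda>u. c * f u) u = c * cexp q f u"
  unfolding cexp_def by (rule real_cond_exp_cmult)

lemma cexp_contraction:
  assumes "integrable unif f" "integrable unif g"
  shows "(L1_dist unif (cexp q f) (cexp q g)) \<le> (L1_dist unif f g)"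
proof -
  have "(L1_dist unif (cexp q f) (cexp q g))
      = (\<integral>\<^sup>+ u. ennreal \<bar>cexp q (\<lambda>u. f u - g u) u\<bar> \<partial>unif)"
    by (rule nn_integral_cong_AE) (use cexp_diff_AE[OF assms] in eventually_elim, simp)
  also have "\<dots> \<le> (L1_dist unif f g)"
    using assms by (intro cexp_L1_le) auto
  finally show ?thesis .
qed

lemma cexp_charact:
  assumes [measurable]: "integrable unif f" "g \<in> borel_measurable borel" and "integrable unif (\<lambda>u. g (q u))"
    and eq: "\<And>B. B \<in> sets borel \<Longrightarrow>
      (\<integral>u. indicator B (q u) * f u \<partial>unif) = (\<integral>u. indicator B (q u) * g (q u) \<partial>unif)"
  shows "AE u in unif. cexp q f u = g (q u)"
  unfolding cexp_def
proof (rule real_cond_exp_charact)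
  fix A assume "A \<in> sets (vimage_algebra {0<..<1} q borel)"
  then obtain B where B: "A = q -` B \<inter> {0<..<1}" "B \<in> sets borel"
    by (auto simp: sets_vimage_algebra2)
  have "(\<integral>u\<in>A. f u \<partial>unif) = (\<integral>u. indicator B (q u) * f u \<partial>unif)"
    unfolding set_lebesgue_integral_def B(1)
    by (intro Bochner_Integration.integral_cong) (auto split: split_indicator)
  also have "\<dots> = (\<integral>u. indicator B (q u) * g (q u) \<partial>unif)" by (rule eq[OF B(2)])
  also have "\<dots> = (\<integral>u\<in>A. g (q u) \<partial>unif)"
    unfolding set_lebesgue_integral_def B(1)
    by (intro Bochner_Integration.integral_cong) (auto split: split_indicator)
  finally show "(\<integral>u\<in>A. f u \<partial>unif) = (\<integral>u\<in>A. g (q u) \<partial>unif)" .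
next
  show "(\<lambda>u. g (q u)) \<in> borel_measurable (vimage_algebra {0<..<1} q borel)"
    by (rule measurable_compose[OF measurable_vimage_algebra1 assms(2)]) auto
qed fact+

lemma cexp_of_function_AE:
  assumes [measurable]: "g \<in> borel_measurable borel" and "integrable unif (\<lambda>u. g (q u))"
  shows "AE u in unif. cexp q (\<lambda>u. g (q u)) u = g (q u)"
  by (rule cexp_charact) (use assms in auto)

text \<open>The event \<open>q = x\<close> is an atom of the sigma-algebra of \<open>q\<close>, so conditioning replaces \<open>h\<close> there
  by its average. If the event has probability 0, then \<open>h\<close> vanishes almost everywhere, in
  accordance with division by zero.\<close>
lemma cexp_supported_on_atom_AE:
  assumes h: "integrable unif h" and supp: "\<And>u. 0 < u \<Longrightarrow> u < 1 \<Longrightarrow> q u \<noteq> x \<Longrightarrow> h u = 0"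
  shows "AE u in unif. cexp q h u
    = (\<integral>v. h v \<partial>unif) / measure unif {v \<in> {0<..<1}. q v = x} * indicator {x} (q u)"
proof (rule cexp_charact)
  let ?J = "{v \<in> {0<..<1}. q v = x}"
  have "Measurable.pred unif (\<lambda>u. q u = x)" by measurable
  then have J: "?J \<in> sets unif" by (simp add: pred_def)
  define I where "I = (\<integral>v. h v \<partial>unif)"
  fix B :: "real set" assume B: "B \<in> sets borel"
  have "(\<integral>u. indicator B (q u) * h u \<partial>unif) = (\<integral>u. indicator B x * h u \<partial>unif)"
    using supp by (intro Bochner_Integration.integral_cong) (auto split: split_indicator)
  also have "\<dots> = indicator B x * I" by (simp add: I_def)
  also have "I = I / measure unif ?J * measure unif ?J"
  proof (cases "measure unif ?J = 0")
    case True
    then have "?J \<in> null_sets unif"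
      using J by (auto simp: null_sets_def unif.emeasure_eq_measure)
    then have "AE u in unif. u \<notin> ?J" by (rule AE_not_in)
    then have "AE u in unif. h u = 0"
      using AE_space by eventually_elim (use supp in auto)
    then have "I = (\<integral>v. 0 \<partial>unif)"
      unfolding I_def using h by (intro integral_cong_AE) auto
    then show ?thesis by simp
  qed simp
  also have "indicator B x * (I / measure unif ?J * measure unif ?J)
      = (\<integral>u. indicator B x * (I / measure unif ?J * indicator ?J u) \<partial>unif)"
  proof -
    have "?J \<inter> {0<..<1} = ?J" by blast
    then show ?thesis using J by simp
  qed
  also have "\<dots> = (\<integral>u. indicator B (q u) * (I / measure unif ?J * indicator {x} (q u)) \<partial>unif)"
    by (intro Bochner_Integration.integral_cong) (auto split: split_indicator)
  finally show "(\<integral>u. indicator B (q u) * h u \<partial>unif) =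
    (\<integral>u. indicator B (q u) * (I / measure unif ?J * indicator {x} (q u)) \<partial>unif)" .
next
  show "integrable unif (\<lambda>u. integral\<^sup>L unif h / measure unif {v \<in> {0<..<1}. q v = x} * indicator {x} (q u))"
    by (intro integrable_mult_right unif.integrable_const_bound[of _ 1]) (auto split: split_indicator)
qed (use h in auto)

end


text \<open>Since conditional expectations are linear contractions, the functions with this property
  form a closed subspace of \<open>L\<^sup>1\<close>. Under the assumptions below it is shown step by step to be all
  of \<open>L\<^sup>1\<close>.\<close>
definition cexp_conv :: "(nat \<Rightarrow> real \<Rightarrow> real) \<Rightarrow> (real \<Rightarrow> real) \<Rightarrow> (real \<Rightarrow> real) \<Rightarrow> bool" where
  "cexp_conv qs q f \<longleftrightarrow> (\<lambda>n. L1_dist unif (cexp (qs n) f) (cexp q f)) \<longlonglongrightarrow> 0"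

context
  fixes q :: "real \<Rightarrow> real" and qs :: "nat \<Rightarrow> real \<Rightarrow> real"
  assumes q [measurable]: "q \<in> borel_measurable borel"
    and qs [measurable]: "\<And>n. qs n \<in> borel_measurable borel"
begin

lemma cexp_conv_cong:
  assumes "integrable unif f" "integrable unif g" "\<And>u. 0 < u \<Longrightarrow> u < 1 \<Longrightarrow> f u = g u" "cexp_conv qs q g"
  shows "cexp_conv qs q f"
proof -
  have "AE u in unif. cexp p f u = cexp p g u" if "p \<in> borel_measurable borel" for p
  proof -
    interpret finite_measure_subalgebra unif "vimage_algebra {0<..<1} p borel"
      by (rule subalgebra_vimage_unif[OF that])
    show ?thesis unfolding cexp_def using assms by (intro real_cond_exp_cong AE_I2) auto
  qed
  then have "(L1_dist unif (cexp (qs n) f) (cexp q f))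
      = (L1_dist unif (cexp (qs n) g) (cexp q g))" for n
    by (intro nn_integral_cong_AE) (use q qs in \<open>smt (verit) eventually_elim2\<close>)
  then show ?thesis using assms(4) by (simp add: cexp_conv_def)
qed

lemma cexp_conv_limit:
  assumes f: "integrable unif f" and fk: "\<And>k :: nat. integrable unif (fk k)" "\<And>k. cexp_conv qs q (fk k)"
    and lim: "(\<lambda>k. L1_dist unif (fk k) f) \<longlonglongrightarrow> 0"
  shows "cexp_conv qs q f"
  unfolding cexp_conv_def
proof (rule tendsto_zero_approx)
  let ?d = "\<lambda>k. L1_dist unif (fk k) f"
  let ?c = "\<lambda>k n. L1_dist unif (cexp (qs n) (fk k)) (cexp q (fk k))"
  show "(L1_dist unif (cexp (qs n) f) (cexp q f)) \<le> (?d k + ?d k) + ?c k n" for k n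
  proof -
    have "(L1_dist unif (cexp (qs n) f) (cexp q f)) \<le>
        (L1_dist unif (cexp (qs n) f) (cexp (qs n) (fk k))) +
        (L1_dist unif (cexp (qs n) (fk k)) (cexp q f))"
      by (rule nn_integral_abs_triangle) auto
    also have "\<dots> \<le> (L1_dist unif (cexp (qs n) f) (cexp (qs n) (fk k))) +
        (?c k n + (L1_dist unif (cexp q (fk k)) (cexp q f)))"
      by (intro add_left_mono nn_integral_abs_triangle) auto
    also have "(L1_dist unif (cexp (qs n) f) (cexp (qs n) (fk k))) \<le> ?d k"
      using cexp_contraction[OF qs f fk(1)] by (simp add: abs_minus_commute)
    also have "(L1_dist unif (cexp q (fk k)) (cexp q f)) \<le> ?d k"
      by (rule cexp_contraction[OF q fk(1) f])
    finally show ?thesis by (simp add: add_mono ac_simps)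
  qed
  show "(\<lambda>k. ?d k + ?d k) \<longlonglongrightarrow> 0" using tendsto_add[OF lim lim] by simp
  show "?c k \<longlonglongrightarrow> 0" for k using fk(2)[of k] by (simp add: cexp_conv_def)
qed

lemma cexp_conv_add:
  assumes f: "integrable unif f" "cexp_conv qs q f" and g: "integrable unif g" "cexp_conv qs q g"
  shows "cexp_conv qs q (\<lambda>u. f u + g u)"
  unfolding cexp_conv_def
proof (rule tendsto_zero_le)
  show "(\<lambda>n. (L1_dist unif (cexp (qs n) f) (cexp q f))
    + (L1_dist unif (cexp (qs n) g) (cexp q g))) \<longlonglongrightarrow> 0"
    using tendsto_add[OF f(2)[unfolded cexp_conv_def] g(2)[unfolded cexp_conv_def]] by simp
  fix n
  have "(\<integral>\<^sup>+ u. ennreal \<bar>cexp (qs n) (\<lambda>u. f u + g u) u - cexp q (\<lambda>u. f u + g u) u\<bar> \<partial>unif)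
    \<le> (\<integral>\<^sup>+ u. ennreal \<bar>cexp (qs n) f u - cexp q f u\<bar> + ennreal \<bar>cexp (qs n) g u - cexp q g u\<bar> \<partial>unif)"
  proof (rule nn_integral_mono_AE, use cexp_add_AE[OF q f(1) g(1)] cexp_add_AE[OF qs f(1) g(1), of n] in eventually_elim)
    case (elim u)
    then show ?case by (simp add: ennreal_plus[symmetric] ennreal_leI del: ennreal_plus)
  qed
  then show "(\<integral>\<^sup>+ u. ennreal \<bar>cexp (qs n) (\<lambda>u. f u + g u) u - cexp q (\<lambda>u. f u + g u) u\<bar> \<partial>unif)
    \<le> (L1_dist unif (cexp (qs n) f) (cexp q f))
      + (L1_dist unif (cexp (qs n) g) (cexp q g))"
    by (simp add: nn_integral_add)
qed

lemma cexp_conv_cmult: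
  assumes f: "integrable unif f" "cexp_conv qs q f"
  shows "cexp_conv qs q (\<lambda>u. c * f u)"
proof -
  have "(\<integral>\<^sup>+ u. ennreal \<bar>cexp (qs n) (\<lambda>u. c * f u) u - cexp q (\<lambda>u. c * f u) u\<bar> \<partial>unif)
    = ennreal \<bar>c\<bar> * (L1_dist unif (cexp (qs n) f) (cexp q f))" for n
  proof -
    have "(\<integral>\<^sup>+ u. ennreal \<bar>cexp (qs n) (\<lambda>u. c * f u) u - cexp q (\<lambda>u. c * f u) u\<bar> \<partial>unif)
      = (\<integral>\<^sup>+ u. ennreal \<bar>c\<bar> * ennreal \<bar>cexp (qs n) f u - cexp q f u\<bar> \<partial>unif)"
    proof (rule nn_integral_cong_AE, use cexp_cmult_AE[OF q f(1), of c] cexp_cmult_AE[OF qs f(1), of n c] in eventually_elim)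
      case (elim u)
      then show ?case by (simp add: ennreal_mult[symmetric] abs_mult[symmetric] right_diff_distrib)
    qed
    then show ?thesis by (simp add: nn_integral_cmult)
  qed
  moreover have "(\<lambda>n. ennreal \<bar>c\<bar> * (L1_dist unif (cexp (qs n) f) (cexp q f))) \<longlonglongrightarrow> ennreal \<bar>c\<bar> * 0"
    using f(2) unfolding cexp_conv_def by (intro ennreal_tendsto_cmult) auto
  ultimately show ?thesis by (simp add: cexp_conv_def)
qed

context
  assumes L1: "(\<lambda>n. L1_dist unif (qs n) q) \<longlonglongrightarrow> 0"
begin

text \<open>By contraction the conditional expectation of \<open>g (q u)\<close> given \<open>qs n\<close> is close to that of \<open>g
  (qs n u)\<close>, which is \<open>g (qs n u)\<close> itself and hence close to \<open>g (q u)\<close>.\<close>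
lemma cexp_conv_lipschitz:
  assumes lip: "\<And>x y. \<bar>g x - g y\<bar> \<le> c * \<bar>x - y\<bar>" and bdd: "\<And>x. \<bar>g x\<bar> \<le> b"
    and g [measurable]: "g \<in> borel_measurable borel"
  shows "cexp_conv qs q (\<lambda>u. g (q u))"
  unfolding cexp_conv_def
proof (rule tendsto_zero_le)
  let ?e = "\<lambda>n. ennreal c * (L1_dist unif (qs n) q)"
  have "?e \<longlonglongrightarrow> ennreal c * 0" by (intro ennreal_tendsto_cmult L1) auto
  then show "(\<lambda>n. ?e n + ?e n) \<longlonglongrightarrow> 0" using tendsto_add[of ?e 0 sequentially ?e 0] by simp
  have int: "integrable unif (\<lambda>u. g (p u))" if [measurable]: "p \<in> borel_measurable borel" for p
    using bdd by (intro unif.integrable_const_bound[of _ b]) auto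
  have c: "c \<ge> 0" using lip[of 0 1] by simp
  fix n
  have e: "(\<integral>\<^sup>+ u. ennreal \<bar>g (qs n u) - g (q u)\<bar> \<partial>unif) \<le> ?e n"
  proof -
    have "(\<integral>\<^sup>+ u. ennreal \<bar>g (qs n u) - g (q u)\<bar> \<partial>unif) \<le> (\<integral>\<^sup>+ u. ennreal c * ennreal \<bar>qs n u - q u\<bar> \<partial>unif)"
      using c by (intro nn_integral_mono) (simp add: ennreal_mult[symmetric] ennreal_leI lip)
    then show ?thesis by (simp add: nn_integral_cmult)
  qed
  have "(\<integral>\<^sup>+ u. ennreal \<bar>cexp (qs n) (\<lambda>u. g (q u)) u - cexp q (\<lambda>u. g (q u)) u\<bar> \<partial>unif)
     \<le> (\<integral>\<^sup>+ u. ennreal \<bar>cexp (qs n) (\<lambda>u. g (q u)) u - cexp (qs n) (\<lambda>u. g (qs n u)) u\<bar> \<partial>unif)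
     + (\<integral>\<^sup>+ u. ennreal \<bar>cexp (qs n) (\<lambda>u. g (qs n u)) u - cexp q (\<lambda>u. g (q u)) u\<bar> \<partial>unif)"
    by (rule nn_integral_abs_triangle) auto
  also have "(\<integral>\<^sup>+ u. ennreal \<bar>cexp (qs n) (\<lambda>u. g (q u)) u - cexp (qs n) (\<lambda>u. g (qs n u)) u\<bar> \<partial>unif) \<le> ?e n"
    using cexp_contraction[OF qs int[OF q] int[OF qs]] e
    by (simp add: abs_minus_commute) (rule order_trans)
  also have "(\<integral>\<^sup>+ u. ennreal \<bar>cexp (qs n) (\<lambda>u. g (qs n u)) u - cexp q (\<lambda>u. g (q u)) u\<bar> \<partial>unif)
     = (\<integral>\<^sup>+ u. ennreal \<bar>g (qs n u) - g (q u)\<bar> \<partial>unif)"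
  proof (rule nn_integral_cong_AE)
    show "AE u in unif. ennreal \<bar>cexp (qs n) (\<lambda>u. g (qs n u)) u - cexp q (\<lambda>u. g (q u)) u\<bar>
        = ennreal \<bar>g (qs n u) - g (q u)\<bar>"
      using cexp_of_function_AE[OF q g int[OF q]] cexp_of_function_AE[OF qs g int[OF qs], of n]
      by eventually_elim simp
  qed
  also note e
  finally show "(\<integral>\<^sup>+ u. ennreal \<bar>cexp (qs n) (\<lambda>u. g (q u)) u - cexp q (\<lambda>u. g (q u)) u\<bar> \<partial>unif) \<le> ?e n + ?e n"
    by (simp add: add_mono)
qed

lemma cexp_conv_lipschitz_limit:
  fixes g :: "nat \<Rightarrow> real \<Rightarrow> real"
  assumes "\<And>k x y. \<bar>g k x - g k y\<bar> \<le> real k * \<bar>x - y\<bar>" "\<And>k x. 0 \<le> g k x" "\<And>k x. g k x \<le> 1"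
    and [measurable]: "\<And>k. g k \<in> borel_measurable borel" "A \<in> sets borel"
    and lim: "\<And>x. (\<lambda>k. g k x) \<longlonglongrightarrow> indicator A x"
  shows "cexp_conv qs q (\<lambda>u. indicator A (q u))"
proof (rule cexp_conv_limit)
  show "cexp_conv qs q (\<lambda>u. g k (q u))" for k
    using assms by (intro cexp_conv_lipschitz[where c = "real k" and b = 1]) auto
  show "(\<lambda>k. \<integral>\<^sup>+ u. ennreal \<bar>g k (q u) - indicator A (q u)\<bar> \<partial>unif) \<longlonglongrightarrow> 0"
    using assms by (intro unif.bounded_convergence_L1[where B = 1] AE_I2 lim)
      (auto split: split_indicator)
  show "integrable unif (\<lambda>u. g k (q u))" for k
    using assms by (intro unif.integrable_const_bound[of _ 1]) auto
  show "integrable unif (\<lambda>u. indicator A (q u) :: real)"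
    by (intro unif.integrable_const_bound[of _ 1]) auto
qed

lemma cexp_conv_indicator_lessThan: "cexp_conv qs q (\<lambda>u. indicator {..<x} (q u))"
proof (rule cexp_conv_lipschitz_limit[where g = "\<lambda>k y. min 1 (max 0 (real k * (x - y)))"])
  fix k :: nat and y z :: real
  have "\<bar>min 1 (max 0 a) - min 1 (max 0 b)\<bar> \<le> \<bar>a - b\<bar>" for a b :: real by auto
  from this[of "real k * (x - y)" "real k * (x - z)"]
  show "\<bar>min 1 (max 0 (real k * (x - y))) - min 1 (max 0 (real k * (x - z)))\<bar> \<le> real k * \<bar>y - z\<bar>"
    by (simp add: right_diff_distrib[symmetric] abs_mult abs_minus_commute)
next
  fix y :: real
  show "(\<lambda>k. min 1 (max 0 (real k * (x - y)))) \<longlonglongrightarrow> indicator {..<x} y"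
  proof (cases "y < x")
    case True
    then obtain K :: nat where "1 < real K * (x - y)" using reals_Archimedean3[of "x - y"] by auto
    then have "\<forall>k\<ge>K. 1 \<le> real k * (x - y)"
      using True mult_right_mono[of "real K" _ "x - y"] by (smt (verit) of_nat_le_iff)
    then have "\<forall>k\<ge>K. min 1 (max 0 (real k * (x - y))) = indicator {..<x} y"
      using True by (auto simp: min_def max_def)
    then have "\<forall>\<^sub>F k in sequentially. min 1 (max 0 (real k * (x - y))) = indicator {..<x} y"
      by (auto simp: eventually_sequentially)
    then show ?thesis by (rule tendsto_eventually)
  next
    case False
    then have "min 1 (max 0 (real k * (x - y))) = 0" for k
      using mult_nonneg_nonpos[of "real k" "x - y"] by simp
    then show ?thesis using False by simp
  qed
qed auto

lemma cexp_conv_indicator_atMost: "cexp_conv qs q (\<lambda>u. indicator {..x} (q u))"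
proof (rule cexp_conv_limit[OF _ _ cexp_conv_indicator_lessThan])
  define y where "y k = x + 1 / real (Suc k)" for k
  have y: "y \<longlonglongrightarrow> x"
    unfolding y_def using tendsto_add[OF tendsto_const lim_1_over_n[THEN LIMSEQ_Suc], of x] by simp
  have "(\<lambda>k. indicator {..<y k} t) \<longlonglongrightarrow> (indicator {..x} t :: real)" for t
  proof (cases "t \<le> x")
    case True
    then have "t < y k" for k
      unfolding y_def by (intro le_less_trans[OF True]) simp
    then show ?thesis using True by (simp add: indicator_def)
  next
    case False
    then have "\<forall>\<^sub>F k in sequentially. y k < t" by (intro order_tendstoD(2)[OF y]) simp
    then have "\<forall>\<^sub>F k in sequentially. indicator {..<y k} t = (indicator {..x} t :: real)"
      by eventually_elim (use False in simp)
    then show ?thesis by (rule tendsto_eventually)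
  qed
  then show "(\<lambda>k. L1_dist unif (\<lambda>u. indicator {..<y k} (q u)) (\<lambda>u. indicator {..x} (q u))) \<longlonglongrightarrow> 0"
    by (intro unif.bounded_convergence_L1[where B = 1] AE_I2) (auto split: split_indicator)
qed (auto intro!: unif.integrable_const_bound[of _ 1] split: split_indicator)

text \<open>Every atom of \<open>q\<close> is asymptotically contained in an atom of \<open>qs n\<close>. Otherwise \<open>qs n\<close> could
  be injective on an atom of \<open>q\<close> for every \<open>n\<close>, and conditioning on \<open>qs n\<close> would retain what
  conditioning on \<open>q\<close> averages out.\<close>
context
  assumes jump: "\<And>x. measure unif {u \<in> {0<..<1}. q u = x} > 0 \<Longrightarrow>
    \<exists>xs. (\<lambda>n. emeasure unif {u \<in> {0<..<1}. q u = x \<and> qs n u \<noteq> xs n}) \<longlonglongrightarrow> 0"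
begin

text \<open>Given \<open>q\<close> the conditional expectation is 0, because \<open>h\<close> has mean 0 on the atom that carries
  it. The part of \<open>h\<close> outside of \<open>qs n = xs n\<close> is small in \<open>L\<^sup>1\<close>. The rest lives on a single atom
  of \<open>qs n\<close> and is replaced by its average, which is small as well: its integral is the opposite
  of the integral of the small part.\<close>
lemma cexp_conv_centred_on_atom:
  assumes h [measurable]: "h \<in> borel_measurable borel" and bdd: "\<And>u. \<bar>h u\<bar> \<le> 1"
    and supp: "\<And>u. 0 < u \<Longrightarrow> u < 1 \<Longrightarrow> q u \<noteq> x \<Longrightarrow> h u = 0"
    and centred: "(\<integral>u. h u \<partial>unif) = 0"
    and pos: "measure unif {u \<in> {0<..<1}. q u = x} > 0"
  shows "cexp_conv qs q h"
proof -
  obtain xs where xs: "(\<lambda>n. emeasure unif {u \<in> {0<..<1}. q u = x \<and> qs n u \<noteq> xs n}) \<longlonglongrightarrow> 0"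
    using jump[OF pos] by blast
  let ?d = "\<lambda>n. emeasure unif {u \<in> {0<..<1}. q u = x \<and> qs n u \<noteq> xs n}"
  have h_int: "integrable unif h" using bdd by (intro unif.integrable_const_bound[of _ 1]) auto
  have zero: "AE u in unif. cexp q h u = 0"
    using cexp_supported_on_atom_AE[OF q h_int supp] centred by simp
  show ?thesis unfolding cexp_conv_def
  proof (rule tendsto_zero_le)
    show "(\<lambda>n. ?d n + ?d n) \<longlonglongrightarrow> 0" using tendsto_add[OF xs xs] by simp
    fix n
    \<comment> \<open>\<open>h1\<close> lives on an atom of \<open>qs n\<close>, and \<open>h2\<close> on the part of the atom of \<open>q\<close> outside of it.\<close>
    define h1 where "h1 u = indicator {xs n} (qs n u) * h u" for u
    define h2 where "h2 u = h u - h1 u" for u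
    have h1_int: "integrable unif h1"
      unfolding h1_def using bdd by (intro unif.integrable_const_bound[of _ 1]) (auto split: split_indicator)
    have h2_int: "integrable unif h2" unfolding h2_def using h_int h1_int by auto
    have [measurable]: "h1 \<in> borel_measurable unif" "h2 \<in> borel_measurable unif" using h1_int h2_int by auto
    have "Measurable.pred unif (\<lambda>u. q u = x \<and> qs n u \<noteq> xs n)" by measurable
    then have D: "{u \<in> {0<..<1}. q u = x \<and> qs n u \<noteq> xs n} \<in> sets unif" by (simp add: pred_def)
    have "(\<integral>\<^sup>+ u. ennreal \<bar>h2 u\<bar> \<partial>unif) \<le> (\<integral>\<^sup>+ u. indicator {u \<in> {0<..<1}. q u = x \<and> qs n u \<noteq> xs n} u \<partial>unif)"
      using bdd supp by (intro nn_integral_mono) (auto simp: h2_def h1_def split: split_indicator)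
    then have h2_le: "(\<integral>\<^sup>+ u. ennreal \<bar>h2 u\<bar> \<partial>unif) \<le> ?d n" using D by simp
    have "(\<integral>u. h1 u \<partial>unif) = - (\<integral>u. h2 u \<partial>unif)"
      unfolding h2_def using h_int h1_int centred by simp
    then have "ennreal \<bar>\<integral>u. h1 u \<partial>unif\<bar> \<le> (\<integral>\<^sup>+ u. ennreal \<bar>h2 u\<bar> \<partial>unif)"
      using integral_norm_bound_ennreal[OF h2_int] by simp
    then have h1_le: "ennreal \<bar>\<integral>u. h1 u \<partial>unif\<bar> \<le> ?d n" using h2_le by (rule order_trans)
    let ?J = "{v \<in> {0<..<1}. qs n v = xs n}"
    have "Measurable.pred unif (\<lambda>u. qs n u = xs n)" by measurable
    then have J: "?J \<in> sets unif" by (simp add: pred_def)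
    have "(\<integral>\<^sup>+ u. ennreal \<bar>cexp (qs n) h1 u\<bar> \<partial>unif)
       = (\<integral>\<^sup>+ u. ennreal \<bar>(\<integral>v. h1 v \<partial>unif) / measure unif ?J\<bar> * indicator ?J u \<partial>unif)"
    proof (rule nn_integral_cong_AE)
      have "AE u in unif. cexp (qs n) h1 u
          = (\<integral>v. h1 v \<partial>unif) / measure unif ?J * indicator {xs n} (qs n u)"
        using h1_int by (intro cexp_supported_on_atom_AE qs) (auto simp: h1_def)
      then show "AE u in unif. ennreal \<bar>cexp (qs n) h1 u\<bar> =
          ennreal \<bar>(\<integral>v. h1 v \<partial>unif) / measure unif ?J\<bar> * indicator ?J u"
        using AE_space by eventually_elim (auto split: split_indicator)
    qed
    also have "\<dots> = ennreal \<bar>(\<integral>v. h1 v \<partial>unif) / measure unif ?J\<bar> * ennreal (measure unif ?J)"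
      using J by (simp add: nn_integral_cmult unif.emeasure_eq_measure)
    also have "\<dots> = ennreal (\<bar>(\<integral>v. h1 v \<partial>unif) / measure unif ?J\<bar> * measure unif ?J)"
      by (subst ennreal_mult) auto
    also have "\<dots> \<le> ennreal \<bar>\<integral>v. h1 v \<partial>unif\<bar>" by (intro ennreal_leI) auto
    also note h1_le
    finally have 1: "(\<integral>\<^sup>+ u. ennreal \<bar>cexp (qs n) h1 u\<bar> \<partial>unif) \<le> ?d n" .
    have 2: "(L1_dist unif (cexp (qs n) h) (cexp (qs n) h1)) \<le> ?d n"
      using cexp_contraction[OF qs h_int h1_int, of n] h2_le by (simp add: h2_def)
    have "(L1_dist unif (cexp (qs n) h) (cexp q h)) = (\<integral>\<^sup>+ u. ennreal \<bar>cexp (qs n) h u - 0\<bar> \<partial>unif)"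
      by (rule nn_integral_cong_AE, use zero in eventually_elim) simp
    also have "\<dots> \<le> (L1_dist unif (cexp (qs n) h) (cexp (qs n) h1))
        + (\<integral>\<^sup>+ u. ennreal \<bar>cexp (qs n) h1 u - 0\<bar> \<partial>unif)"
      by (rule nn_integral_abs_triangle) auto
    also have "\<dots> \<le> ?d n + ?d n" using 1 2 by (intro add_mono) auto
    finally show "(L1_dist unif (cexp (qs n) h) (cexp q h)) \<le> ?d n + ?d n" .
  qed
qed

lemma cexp_conv_zero: "cexp_conv qs q (\<lambda>_. 0)"
  using cexp_conv_lipschitz[of "\<lambda>_. 0" 0 0] by simp

text \<open>Subtracting the average over the atom leaves a centred function, and what is subtracted is a
  function of \<open>q\<close>.\<close>
lemma cexp_conv_on_atom:
  assumes A [measurable]: "A \<in> sets borel"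
  shows "cexp_conv qs q (\<lambda>u. indicator A u * indicator {x} (q u))"
proof -
  let ?f = "\<lambda>u. indicator A u * indicator {x} (q u) :: real"
  let ?p = "measure unif {u \<in> {0<..<1}. q u = x}"
  have f_int: "integrable unif ?f"
    by (intro unif.integrable_const_bound[of _ 1]) (auto split: split_indicator)
  have e_int: "integrable unif (\<lambda>u. indicator B (q u) :: real)" if "B \<in> sets borel" for B
    using that by (intro unif.integrable_const_bound[of _ 1]) (auto split: split_indicator)
  have p: "?p = (\<integral>u. indicator {x} (q u) \<partial>unif)"
  proof -
    have "Measurable.pred unif (\<lambda>u. q u = x)" by measurable
    then have J: "{u \<in> {0<..<1}. q u = x} \<in> sets unif" by (simp add: pred_def)
    have "(\<integral>u. indicator {x} (q u) \<partial>unif) = (\<integral>u. indicator {u \<in> {0<..<1}. q u = x} u \<partial>unif :: real)"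
      by (intro Bochner_Integration.integral_cong) (auto split: split_indicator)
    moreover have "{u \<in> {0<..<1}. q u = x} \<inter> {0<..<1} = {u \<in> {0<..<1}. q u = x}" by blast
    ultimately show ?thesis using J by simp
  qed
  have conv_atom: "cexp_conv qs q (\<lambda>u. indicator {x} (q u))"
  proof -
    have "cexp_conv qs q (\<lambda>u. indicator {..x} (q u) + (-1) * indicator {..<x} (q u))"
      by (intro cexp_conv_add cexp_conv_cmult cexp_conv_indicator_atMost cexp_conv_indicator_lessThan
        integrable_mult_right e_int) auto
    also have "(\<lambda>u. indicator {..x} (q u) + (-1) * indicator {..<x} (q u)) = (\<lambda>u. indicator {x} (q u) :: real)"
      by (auto split: split_indicator)
    finally show ?thesis .
  qed
  show ?thesis
  proof (cases "?p > 0")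
    case True
    define c where "c = (\<integral>u. ?f u \<partial>unif) / ?p"
    have fle: "0 \<le> (\<integral>u. ?f u \<partial>unif)" "(\<integral>u. ?f u \<partial>unif) \<le> ?p"
      unfolding p by (auto intro!: integral_mono f_int e_int Bochner_Integration.integral_nonneg split: split_indicator)
    then have c: "0 \<le> c" "c \<le> 1" using True by (auto simp: c_def)
    have "cexp_conv qs q (\<lambda>u. ?f u - c * indicator {x} (q u))"
    proof (rule cexp_conv_centred_on_atom[OF _ _ _ _ True])
      show "(\<integral>u. ?f u - c * indicator {x} (q u) \<partial>unif) = 0"
        using f_int e_int True by (simp add: p[symmetric]) (simp add: c_def)
    qed (use c in \<open>auto split: split_indicator\<close>)
    then have "cexp_conv qs q (\<lambda>u. (?f u - c * indicator {x} (q u)) + c * indicator {x} (q u))"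
      by (intro cexp_conv_add cexp_conv_cmult conv_atom e_int f_int Bochner_Integration.integrable_diff
        integrable_mult_right) auto
    then show ?thesis by simp
  next
    case False
    then have "?p = 0" by (simp add: less_le)
    show ?thesis
    proof (rule cexp_conv_limit[where fk = "\<lambda>_ _. 0"])
      have "(\<integral>\<^sup>+ u. ennreal \<bar>0 - ?f u\<bar> \<partial>unif) \<le> (\<integral>\<^sup>+ u. ennreal (indicator {x} (q u)) \<partial>unif)"
        by (intro nn_integral_mono) (auto split: split_indicator)
      also have "\<dots> = ennreal ?p"
        unfolding p using e_int by (intro nn_integral_eq_integral) auto
      also have "\<dots> = 0" using \<open>?p = 0\<close> by simp
      finally show "(\<lambda>k::nat. \<integral>\<^sup>+ u. ennreal \<bar>0 - ?f u\<bar> \<partial>unif) \<longlonglongrightarrow> 0" by simp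
    qed (auto simp: cexp_conv_zero f_int)
  qed
qed

context
  assumes mono: "mono_on {0<..<1} q"
begin

text \<open>By monotonicity of \<open>q\<close> a segment \<open>u \<le> a\<close> is the union of the event \<open>q u < q a\<close>, which is
  described by \<open>q\<close>, and a part of the atom \<open>q u = q a\<close>. The segments generate the Borel sets.\<close>
lemma cexp_conv_indicator_borel:
  assumes "A \<in> sets borel"
  shows "cexp_conv qs q (indicator A)"
proof -
  have ind_int: "integrable unif (indicator B :: real \<Rightarrow> real)" if "B \<in> sets borel" for B
    using that by (intro unif.integrable_const_bound[of _ 1]) (auto split: split_indicator)
  have e_int: "integrable unif (\<lambda>u. indicator B (q u) :: real)" if "B \<in> sets borel" for B
    using that by (intro unif.integrable_const_bound[of _ 1]) (auto split: split_indicator)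
  have one: "cexp_conv qs q (\<lambda>_. 1)"
    using cexp_conv_lipschitz[of "\<lambda>_. 1" 0 1] by simp
  have half: "cexp_conv qs q (indicator {..a})" for a
  proof -
    consider "a \<le> 0" | "a \<ge> 1" | "0 < a" "a < 1" by linarith
    then show ?thesis
    proof cases
      case 1
      then show ?thesis by (intro cexp_conv_cong[OF _ _ _ cexp_conv_zero]) (auto simp: ind_int)
    next
      case 2
      then show ?thesis by (intro cexp_conv_cong[OF _ _ _ one]) (auto simp: ind_int)
    next
      case 3
      show ?thesis
      proof (rule cexp_conv_cong)
        show "cexp_conv qs q (\<lambda>u. indicator {..<q a} (q u) + indicator {..a} u * indicator {q a} (q u))"
          by (intro cexp_conv_add cexp_conv_indicator_lessThan cexp_conv_on_atom e_int)
            (auto intro!: unif.integrable_const_bound[of _ 1] split: split_indicator)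
        show "indicator {..a} u = (indicator {..<q a} (q u) :: real) + indicator {..a} u * indicator {q a} (q u)"
          if "0 < u" "u < 1" for u
        proof -
          have "u \<le> a \<Longrightarrow> q u \<le> q a" "\<not> u \<le> a \<Longrightarrow> q a \<le> q u"
            using mono_onD[OF mono, of u a] mono_onD[OF mono, of a u] that 3 by auto
          then show ?thesis
            by (cases "q u" "q a" rule: linorder_cases; cases "u \<le> a") (simp_all add: indicator_def)
        qed
      qed (auto simp: ind_int e_int intro!: Bochner_Integration.integrable_add unif.integrable_const_bound[of _ 1]
            split: split_indicator)
    qed
  qed
  have "Int_stable (range (\<lambda>a::real. {..a}))" "range (\<lambda>a::real. {..a}) \<subseteq> Pow UNIV"
    "A \<in> sigma_sets UNIV (range (\<lambda>a::real. {..a}))"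
    using assms by (auto simp: sets_borel_eq_sigma_atMost Int_stable_def)
  then show ?thesis
  proof (induction rule: sigma_sets_induct_disjoint)
    case (basic A)
    then show ?case using half by auto
  next
    case empty
    then show ?case using cexp_conv_zero by (simp add: indicator_def)
  next
    case (compl A)
    then have [measurable]: "A \<in> sets borel"
      by (simp add: sets_borel_eq_sigma_atMost)
    have "cexp_conv qs q (\<lambda>u. 1 + (-1) * indicator A u)"
      by (intro cexp_conv_add cexp_conv_cmult compl one integrable_mult_right ind_int) auto
    also have "(\<lambda>u. 1 + (-1) * indicator A u) = (indicator (UNIV - A) :: real \<Rightarrow> real)"
      by (auto split: split_indicator)
    finally show ?case .
  next
    case (union A)
    then have [measurable]: "A i \<in> sets borel" for i
      by (auto simp: sets_borel_eq_sigma_atMost)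
    have fin: "cexp_conv qs q (indicator (\<Union>i<k. A i))" for k
    proof (induction k)
      case 0
      then show ?case using cexp_conv_zero by (simp add: indicator_def)
    next
      case (Suc k)
      have "cexp_conv qs q (\<lambda>u. indicator (\<Union>i<k. A i) u + indicator (A k) u)"
        by (intro cexp_conv_add Suc union ind_int) auto
      also have "(\<lambda>u. indicator (\<Union>i<k. A i) u + indicator (A k) u) = (indicator (\<Union>i<Suc k. A i) :: real \<Rightarrow> real)"
      proof
        fix u
        have "A i \<inter> A k = {}" if "i < k" for i
          using disjoint_family_onD[OF union(1), of i k] that by simp
        then have "(\<Union>i<k. A i) \<inter> A k = {}" by blast
        then show "indicator (\<Union>i<k. A i) u + indicator (A k) u = (indicator (\<Union>i<Suc k. A i) u :: real)"
          by (auto simp: lessThan_Suc split: split_indicator)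
      qed
      finally show ?case .
    qed
    show ?case
    proof (rule cexp_conv_limit[OF _ _ fin])
      show "(\<lambda>k. L1_dist unif (indicator (\<Union>i<k. A i)) (indicator (\<Union>(range A)))) \<longlonglongrightarrow> 0"
        by (intro unif.bounded_convergence_L1[where B = 1] AE_I2 LIMSEQ_indicator_UN)
          (auto split: split_indicator)
    qed (auto intro!: ind_int)
  qed
qed

theorem cexp_conv_integrable: "integrable unif f \<Longrightarrow> cexp_conv qs q f"
proof (induction f rule: integrable_induct)
  case (base A c)
  have A: "A \<in> sets borel"
    using base(1) by (simp add: sets_unif sets_restrict_space_iff)
  have "cexp_conv qs q (\<lambda>u. c * indicator A u)"
    by (intro cexp_conv_cmult cexp_conv_indicator_borel A)
      (use A in \<open>auto intro!: unif.integrable_const_bound[of _ 1] split: split_indicator\<close>)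
  then show ?case by (simp add: mult.commute)
next
  case (add f g)
  then show ?case by (intro cexp_conv_add)
next
  case (lim f s)
  have [measurable]: "f \<in> borel_measurable unif" "\<And>i. s i \<in> borel_measurable unif"
    using lim by auto
  show ?case
  proof (rule cexp_conv_limit[OF lim(4) lim(1) lim(5)])
    have "(\<lambda>k. L1_dist unif (s k) f) \<longlonglongrightarrow> (\<integral>\<^sup>+ u. 0 \<partial>unif)"
    proof (rule nn_integral_dominated_convergence[where w="\<lambda>u. ennreal (3 * \<bar>f u\<bar>)"])
      show "(\<integral>\<^sup>+ u. ennreal (3 * \<bar>f u\<bar>) \<partial>unif) < \<infinity>"
        using lim(4) by (auto simp: integrable_iff_bounded ennreal_mult nn_integral_cmult ennreal_mult_less_top)
      show "AE u in unif. ennreal \<bar>s k u - f u\<bar> \<le> ennreal (3 * \<bar>f u\<bar>)" for k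
      proof (rule AE_I2, rule ennreal_leI)
        fix u assume "u \<in> space unif"
        from lim(3)[OF this, of k] show "\<bar>s k u - f u\<bar> \<le> 3 * \<bar>f u\<bar>" by simp
      qed
      show "AE u in unif. (\<lambda>k. ennreal \<bar>s k u - f u\<bar>) \<longlonglongrightarrow> 0"
      proof (rule AE_I2)
        fix u assume "u \<in> space unif"
        from lim(2)[OF this] have "(\<lambda>k. \<bar>s k u - f u\<bar>) \<longlonglongrightarrow> 0" using LIM_zero tendsto_rabs_zero by blast
        then show "(\<lambda>k. ennreal \<bar>s k u - f u\<bar>) \<longlonglongrightarrow> 0" using tendsto_ennrealI by fastforce
      qed
    qed auto
    then show "(\<lambda>k. L1_dist unif (s k) f) \<longlonglongrightarrow> 0" by simp
  qed
qed

end
end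
end
end

section \<open>The randomised distribution function\<close>

lemma nn_integral_unif2:
  assumes "f \<in> borel_measurable (borel \<Otimes>\<^sub>M borel)"
  shows "(\<integral>\<^sup>+ z. f z \<partial>(unif \<Otimes>\<^sub>M unif)) = (\<integral>\<^sup>+ u. \<integral>\<^sup>+ v. f (u, v) \<partial>unif \<partial>unif)"
  using measurable_compose[OF measurable_unif2_ident assms]
  by (subst unif.nn_integral_fst[symmetric]) auto

lemma measure_lessThan_le_quantile:
  assumes "real_distribution \<mu>" "0 < u" "u < 1"
  shows "measure \<mu> {..<quantile \<mu> u} \<le> u"
proof -
  interpret real_distribution \<mu> by fact
  show ?thesis
  proof (rule tendsto_upperbound[OF cdf_at_left])
    have "cdf \<mu> y \<le> u" if "y < quantile \<mu> u" for y
      using quantile_le_iff[OF assms, of y] that by auto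
    then show "\<forall>\<^sub>F y in at_left (quantile \<mu> u). cdf \<mu> y \<le> u"
      by (auto simp: eventually_at_filter intro!: always_eventually)
  qed simp
qed

lemma le_cdf_quantile:
  assumes "real_distribution \<mu>" "0 < u" "u < 1"
  shows "u \<le> cdf \<mu> (quantile \<mu> u)"
  using quantile_le_iff[OF assms, of "quantile \<mu> u"] by simp

lemma cdf_eq_lessThan_plus_atom:
  assumes "real_distribution \<mu>"
  shows "cdf \<mu> x = measure \<mu> {..<x} + measure \<mu> {x}"
proof -
  interpret real_distribution \<mu> by fact
  have "measure \<mu> ({..<x} \<union> {x}) = measure \<mu> {..<x} + measure \<mu> {x}"
    by (intro finite_measure_Union) auto
  moreover have "{..<x} \<union> {x} = {..x}" by auto
  ultimately show ?thesis by (simp add: cdf_def)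
qed

text \<open>The distributional transform: the point that divides the jump of the distribution function
  at \<open>x\<close> in the proportion \<open>t\<close>.\<close>
definition randomized_cdf :: "real measure \<Rightarrow> real \<Rightarrow> real \<Rightarrow> real" where
  "randomized_cdf \<mu> x t = measure \<mu> {..<x} + t * measure \<mu> {x}"

text \<open>A level strictly inside the jump at \<open>x\<close> has quantile \<open>x\<close>. If there is no jump at \<open>x =
  quantile \<mu> u\<close>, then both one-sided values of the distribution function at \<open>x\<close> equal \<open>u\<close>, and the
  transform gives back \<open>u\<close>.\<close>
lemma quantile_randomized_cdf:
  assumes \<mu>: "real_distribution \<mu>" and u: "0 < u" "u < 1" and t: "0 < t" "t < 1"
  shows "quantile \<mu> (randomized_cdf \<mu> (quantile \<mu> u) t) = quantile \<mu> u"
    and "0 < randomized_cdf \<mu> (quantile \<mu> u) t" "randomized_cdf \<mu> (quantile \<mu> u) t < 1"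
proof -
  interpret real_distribution \<mu> by fact
  define x where "x = quantile \<mu> u"
  define l where "l = measure \<mu> {..<x}"
  define d where "d = measure \<mu> {x}"
  have F: "cdf \<mu> x = l + d" unfolding l_def d_def by (rule cdf_eq_lessThan_plus_atom[OF \<mu>])
  have l: "0 \<le> l" "l \<le> u" using measure_lessThan_le_quantile[OF \<mu> u] by (auto simp: l_def x_def)
  have ld: "u \<le> l + d" "l + d \<le> 1"
    using le_cdf_quantile[OF \<mu> u] cdf_bounded_prob[of x] by (auto simp: F[symmetric] x_def[symmetric])
  have "quantile \<mu> (l + t * d) = x \<and> 0 < l + t * d \<and> l + t * d < 1"
  proof (cases "d = 0")
    case True
    then show ?thesis using l ld u by (auto simp: x_def)
  next
    case False
    then have d: "d > 0" by (simp add: d_def less_le)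
    have td: "0 < t * d" "t * d < d" using d t by auto
    then have s: "0 < l + t * d" "l + t * d < 1" using l ld by auto
    have "quantile \<mu> (l + t * d) \<le> x" by (subst quantile_le_iff[OF \<mu> s]) (use td F in linarith)
    moreover have "\<not> quantile \<mu> (l + t * d) < x"
    proof
      assume *: "quantile \<mu> (l + t * d) < x"
      have "l + t * d \<le> cdf \<mu> (quantile \<mu> (l + t * d))" by (rule le_cdf_quantile[OF \<mu> s])
      also have "\<dots> \<le> l" unfolding cdf_def l_def using *[unfolded l_def] by (intro finite_measure_mono) auto
      finally show False using td by simp
    qed
    ultimately show ?thesis using s by auto
  qed
  then show "quantile \<mu> (randomized_cdf \<mu> (quantile \<mu> u) t) = quantile \<mu> u"
    "0 < randomized_cdf \<mu> (quantile \<mu> u) t" "randomized_cdf \<mu> (quantile \<mu> u) t < 1"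
    by (auto simp: randomized_cdf_def x_def[symmetric] l_def d_def)
qed

lemma borel_measurable_randomized_cdf:
  assumes "real_distribution \<mu>"
  shows "(\<lambda>(x, t). randomized_cdf \<mu> x t) \<in> borel_measurable (borel \<Otimes>\<^sub>M borel)"
proof -
  interpret real_distribution \<mu> by fact
  have [measurable]: "(\<lambda>x. measure \<mu> {..<x}) \<in> borel_measurable borel"
    by (rule borel_measurable_mono) (auto intro!: monoI finite_measure_mono)
  have "(\<lambda>x. measure \<mu> {x}) = (\<lambda>x. cdf \<mu> x - measure \<mu> {..<x})"
    using cdf_eq_lessThan_plus_atom[OF assms] by auto
  moreover have [measurable]: "cdf \<mu> \<in> borel_measurable borel"
    by (rule borel_measurable_mono) (auto intro!: monoI cdf_nondecreasing)
  ultimately have [measurable]: "(\<lambda>x. measure \<mu> {x}) \<in> borel_measurable borel" by simp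
  show ?thesis unfolding randomized_cdf_def by measurable
qed

lemma nn_integral_unif_indicator_le:
  assumes "0 \<le> c" "c \<le> 1"
  shows "(\<integral>\<^sup>+ t. indicator {..c} t \<partial>unif) = ennreal c"
proof -
  have "(\<integral>\<^sup>+ t. indicator {..c} t \<partial>unif) = (\<integral>\<^sup>+ t. ennreal \<bar>indicator {t..} c - indicator {t..} 0\<bar> \<partial>unif)"
    by (intro nn_integral_cong) (auto split: split_indicator)
  also have "\<dots> = ennreal c" using assms by (subst nn_integral_unif_indicator_diff) auto
  finally show ?thesis .
qed

lemma emeasure_unif_quantile:
  assumes "real_distribution \<mu>" "B \<in> sets borel"
  shows "(\<integral>\<^sup>+ u. indicator B (quantile \<mu> u) \<partial>unif) = emeasure \<mu> B"
proof -
  note [measurable] = borel_measurable_quantile[OF assms(1)] assms(2)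
  have "(\<integral>\<^sup>+ u. indicator B (quantile \<mu> u) \<partial>unif) = (\<integral>\<^sup>+ x. indicator B x \<partial>distr unif borel (quantile \<mu>))"
    by (subst nn_integral_distr) auto
  then show ?thesis
    using assms by (simp add: distr_quantile real_distribution.events_eq_borel)
qed

text \<open>Let \<open>x\<close> be the quantile at level \<open>a\<close>. The transform is at most \<open>a\<close> where \<open>quantile \<mu> u < x\<close>
  and exceeds \<open>a\<close> where \<open>quantile \<mu> u > x\<close>; where equality holds it is at most \<open>a\<close> with
  conditional probability \<open>c\<close>, the proportion of the jump at \<open>x\<close> that lies below \<open>a\<close>. The
  probabilities add up to \<open>a\<close>.\<close>
lemma distr_randomized_cdf:
  assumes \<mu>: "real_distribution \<mu>"
  shows "distr (unif \<Otimes>\<^sub>M unif) borel (\<lambda>(u, t). randomized_cdf \<mu> (quantile \<mu> u) t) = distr unif borel (\<lambda>u. u)"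
    (is "?L = ?R")
proof -
  interpret M: real_distribution \<mu> by fact
  note [measurable] = borel_measurable_quantile[OF \<mu>]
  note [measurable] = borel_measurable_randomized_cdf[OF \<mu>]
  have m: "(\<lambda>(u, t). randomized_cdf \<mu> (quantile \<mu> u) t) \<in> borel_measurable (borel \<Otimes>\<^sub>M borel)"
    by measurable
  have m': "(\<lambda>(u, t). randomized_cdf \<mu> (quantile \<mu> u) t) \<in> borel_measurable (unif \<Otimes>\<^sub>M unif)"
    using measurable_compose[OF measurable_unif2_ident m] by simp
  interpret L: real_distribution ?L
    by (rule unif2.real_distribution_distr) (rule m')
  interpret R: real_distribution ?R
    by (rule unif.real_distribution_distr) simp
  have cdfR: "cdf ?R a = a" if "0 \<le> a" "a \<le> 1" for a
  proof -
    have "ennreal (cdf ?R a) = (\<integral>\<^sup>+ t. indicator {..a} t \<partial>?R)"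
      by (simp add: cdf_def R.emeasure_eq_measure)
    also have "\<dots> = (\<integral>\<^sup>+ t. indicator {..a} t \<partial>unif)" by (subst nn_integral_distr) auto
    also have "\<dots> = ennreal a" by (rule nn_integral_unif_indicator_le[OF that])
    finally show ?thesis using that R.cdf_nonneg by simp
  qed
  have cdfL: "cdf ?L a = a" if a: "0 < a" "a < 1" for a
  proof -
    define x where "x = quantile \<mu> a"
    define l where "l = measure \<mu> {..<x}"
    define d where "d = measure \<mu> {x}"
    have l: "l \<le> a" using measure_lessThan_le_quantile[OF \<mu> a] by (simp add: l_def x_def)
    have F: "cdf \<mu> x = l + d" unfolding l_def d_def by (rule cdf_eq_lessThan_plus_atom[OF \<mu>])
    have ld: "a \<le> l + d" using le_cdf_quantile[OF \<mu> a] by (simp add: F[symmetric] x_def[symmetric])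
    have l0: "0 \<le> l" "0 \<le> d" by (auto simp: l_def d_def)
    define c where "c = (if d = 0 then 0 else (a - l) / d)"
    have c: "0 \<le> c" "c \<le> 1" "l + c * d = a" using l ld l0 by (auto simp: c_def)
    have inner: "(\<integral>\<^sup>+ t. indicator {..a} (randomized_cdf \<mu> (quantile \<mu> u) t) \<partial>unif)
        = indicator {..<x} (quantile \<mu> u) + (if d = 0 then indicator {l..a} l else ennreal c) * indicator {x} (quantile \<mu> u)"
      if u: "0 < u" "u < 1" for u
    proof -
      consider "quantile \<mu> u < x" | "quantile \<mu> u > x" | "quantile \<mu> u = x" by linarith
      then show ?thesis
      proof cases
        case 1
        have "randomized_cdf \<mu> (quantile \<mu> u) t \<le> a" if "0 < t" "t < 1" for t
        proof -
          have "randomized_cdf \<mu> (quantile \<mu> u) t \<le> cdf \<mu> (quantile \<mu> u)"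
            using that by (simp add: randomized_cdf_def cdf_eq_lessThan_plus_atom[OF \<mu>] mult_left_le_one_le)
          also have "\<dots> \<le> a" using 1 quantile_le_iff[OF \<mu> a, of "quantile \<mu> u"] by (auto simp: x_def)
          finally show ?thesis .
        qed
        then have "(\<integral>\<^sup>+ t. indicator {..a} (randomized_cdf \<mu> (quantile \<mu> u) t) \<partial>unif) = (\<integral>\<^sup>+ t. 1 \<partial>unif)"
          by (intro nn_integral_cong) auto
        then show ?thesis using 1 unif.emeasure_space_1 by simp
      next
        case 2
        have "a < randomized_cdf \<mu> (quantile \<mu> u) t" if t: "0 < t" "t < 1" for t
        proof -
          have "a \<le> cdf \<mu> x" using ld F by simp
          also have "\<dots> \<le> measure \<mu> {..<quantile \<mu> u}"
            unfolding cdf_def using 2 by (intro M.finite_measure_mono) auto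
          finally have *: "a \<le> measure \<mu> {..<quantile \<mu> u}" .
          show ?thesis
          proof (cases "measure \<mu> {quantile \<mu> u} = 0")
            case False
            then show ?thesis using * t
              by (auto simp: randomized_cdf_def less_le intro!: add_le_less_mono[of a _ 0, simplified])
          next
            case True
            have "u \<le> cdf \<mu> (quantile \<mu> u)" by (rule le_cdf_quantile[OF \<mu> u])
            then have "u \<le> measure \<mu> {..<quantile \<mu> u}"
              using True by (simp add: cdf_eq_lessThan_plus_atom[OF \<mu>])
            moreover have "a < u"
              using mono_onD[OF mono_on_quantile[OF \<mu>], of u a] 2 u a by (auto simp: x_def not_le[symmetric])
            ultimately show ?thesis by (simp add: randomized_cdf_def True)
          qed
        qed
        then have "(\<integral>\<^sup>+ t. indicator {..a} (randomized_cdf \<mu> (quantile \<mu> u) t) \<partial>unif) = (\<integral>\<^sup>+ t. 0 \<partial>unif)"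
          by (intro nn_integral_cong) (auto simp: not_le)
        then show ?thesis using 2 by simp
      next
        case 3
        show ?thesis
        proof (cases "d = 0")
          case True
          have "(\<integral>\<^sup>+ t. indicator {..a} (randomized_cdf \<mu> (quantile \<mu> u) t) \<partial>unif) = (\<integral>\<^sup>+ t. 1 \<partial>unif)"
            using l by (intro nn_integral_cong) (auto simp: randomized_cdf_def 3 l_def[symmetric] d_def[symmetric] True)
          then show ?thesis using 3 True l unif.emeasure_space_1 by simp
        next
          case False
          then have "d > 0" using l0 by simp
          have "(\<integral>\<^sup>+ t. indicator {..a} (randomized_cdf \<mu> (quantile \<mu> u) t) \<partial>unif) = (\<integral>\<^sup>+ t. indicator {..c} t \<partial>unif)"
            using \<open>d > 0\<close> by (intro nn_integral_cong)
              (auto simp: randomized_cdf_def 3 l_def[symmetric] d_def[symmetric] c_def field_simps split: split_indicator)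
          then show ?thesis using c False 3 by (simp add: nn_integral_unif_indicator_le)
        qed
      qed
    qed
    have "ennreal (cdf ?L a) = (\<integral>\<^sup>+ t. indicator {..a} t \<partial>?L)"
      by (simp add: cdf_def L.emeasure_eq_measure)
    also have "\<dots> = (\<integral>\<^sup>+ z. indicator {..a} (randomized_cdf \<mu> (quantile \<mu> (fst z)) (snd z)) \<partial>(unif \<Otimes>\<^sub>M unif))"
      using m' by (subst nn_integral_distr) (auto simp: case_prod_beta')
    also have "\<dots> = (\<integral>\<^sup>+ u. \<integral>\<^sup>+ t. indicator {..a} (randomized_cdf \<mu> (quantile \<mu> u) t) \<partial>unif \<partial>unif)"
      using measurable_compose[OF m, of "indicator {..a}" borel]
      by (subst nn_integral_unif2) (auto simp: case_prod_beta')
    also have "\<dots> = (\<integral>\<^sup>+ u. indicator {..<x} (quantile \<mu> u)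
        + (if d = 0 then indicator {l..a} l else ennreal c) * indicator {x} (quantile \<mu> u) \<partial>unif)"
      by (intro nn_integral_cong inner) auto
    also have "\<dots> = ennreal l + (if d = 0 then indicator {l..a} l else ennreal c) * ennreal d"
      by (subst nn_integral_add) (auto simp: nn_integral_cmult emeasure_unif_quantile[OF \<mu>] M.emeasure_eq_measure l_def d_def)
    also have "\<dots> = ennreal l + ennreal (c * d)" using c l0 by (auto simp: ennreal_mult)
    also have "\<dots> = ennreal a" using c l0 by (simp flip: ennreal_plus)
    finally show ?thesis using a L.cdf_nonneg by simp
  qed
  show ?thesis
  proof (rule cdf_unique)
    show "cdf ?L = cdf ?R"
    proof
      fix a :: real
      consider "a \<le> 0" | "a \<ge> 1" | "0 < a" "a < 1" by linarith
      then show "cdf ?L a = cdf ?R a"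
      proof cases
        case 1
        have "cdf ?L a \<le> \<epsilon>" if "0 < \<epsilon>" "\<epsilon> < 1" for \<epsilon>
          using L.cdf_nondecreasing[of a \<epsilon>] cdfL[OF that] that 1 by simp
        then have "cdf ?L a \<le> 0" by (metis dense_ge_bounded zero_less_one)
        moreover have "cdf ?R a \<le> 0" using R.cdf_nondecreasing[of a 0] cdfR[of 0] 1 by simp
        ultimately show ?thesis using L.cdf_nonneg[of a] R.cdf_nonneg[of a] by simp
      next
        case 2
        have "\<epsilon> \<le> cdf ?L a" if "0 < \<epsilon>" "\<epsilon> < 1" for \<epsilon>
          using L.cdf_nondecreasing[of \<epsilon> a] cdfL[OF that] that 2 by simp
        then have "1 \<le> cdf ?L a" by (metis dense_le_bounded zero_less_one)
        moreover have "1 \<le> cdf ?R a" using R.cdf_nondecreasing[of 1 a] cdfR[of 1] 2 by simp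
        ultimately show ?thesis using L.cdf_bounded_prob[of a] R.cdf_bounded_prob[of a] by simp
      qed (simp add: cdfL cdfR)
    qed
  qed (rule L.real_distribution_axioms R.real_distribution_axioms)+
qed

lemma nn_integral_randomized_cdf:
  assumes \<mu>: "real_distribution \<mu>" and f [measurable]: "f \<in> borel_measurable borel"
  shows "(\<integral>\<^sup>+ u. \<integral>\<^sup>+ t. f (randomized_cdf \<mu> (quantile \<mu> u) t) \<partial>unif \<partial>unif) = (\<integral>\<^sup>+ u. f u \<partial>unif)"
proof -
  note [measurable] = borel_measurable_quantile[OF \<mu>]
  note [measurable] = borel_measurable_randomized_cdf[OF \<mu>]
  have m: "(\<lambda>(u, t). randomized_cdf \<mu> (quantile \<mu> u) t) \<in> borel_measurable (borel \<Otimes>\<^sub>M borel)"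
    by measurable
  have m': "(\<lambda>(u, t). randomized_cdf \<mu> (quantile \<mu> u) t) \<in> borel_measurable (unif \<Otimes>\<^sub>M unif)"
    using measurable_compose[OF measurable_unif2_ident m] by simp
  have "(\<integral>\<^sup>+ u. f u \<partial>unif) = (\<integral>\<^sup>+ u. f u \<partial>distr unif borel (\<lambda>u. u))"
    by (subst nn_integral_distr) auto
  also have "\<dots> = (\<integral>\<^sup>+ z. f (randomized_cdf \<mu> (quantile \<mu> (fst z)) (snd z)) \<partial>(unif \<Otimes>\<^sub>M unif))"
    unfolding distr_randomized_cdf[OF \<mu>, symmetric]
    using m' by (subst nn_integral_distr) (auto simp: case_prod_beta')
  also have "\<dots> = (\<integral>\<^sup>+ u. \<integral>\<^sup>+ t. f (randomized_cdf \<mu> (quantile \<mu> u) t) \<partial>unif \<partial>unif)"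
    using measurable_compose[OF m f] by (subst nn_integral_unif2) (auto simp: case_prod_beta')
  finally show ?thesis ..
qed

section \<open>Laws lifted to the unit square and their disintegrations\<close>

definition lift_cdf :: "(real \<Rightarrow> real \<Rightarrow> real) \<Rightarrow> real \<Rightarrow> real \<Rightarrow> real" where
  "lift_cdf Y y u = (\<integral>v. indicator {..y} (Y u v) \<partial>unif)"

text \<open>The joint law of a first coordinate with law \<open>\<mu>\<close>, driven by a uniform \<open>u\<close>, and a second
  coordinate that depends on the same \<open>u\<close> and on an independent uniform \<open>v\<close>.\<close>
definition lift_law :: "real measure \<Rightarrow> (real \<Rightarrow> real \<Rightarrow> real) \<Rightarrow> (real \<times> real) measure" where
  "lift_law \<mu> Y = distr (unif \<Otimes>\<^sub>M unif) (borel \<Otimes>\<^sub>M borel) (\<lambda>(u, v). (quantile \<mu> u, Y u v))"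

lemma real_distribution_kernel:
  "K \<in> borel \<rightarrow>\<^sub>M prob_algebra borel \<Longrightarrow> real_distribution (K x)"
  using measurable_space[of K borel "prob_algebra borel" x]
  by (auto simp: space_prob_algebra real_distribution_def real_distribution_axioms_def)

lemma nn_integral_disintegration:
  assumes K: "is_disintegration \<pi> K" and f: "f \<in> borel_measurable (borel \<Otimes>\<^sub>M borel)"
  shows "(\<integral>\<^sup>+ z. f z \<partial>\<pi>) = (\<integral>\<^sup>+ x. \<integral>\<^sup>+ y. f (x, y) \<partial>K x \<partial>distr \<pi> borel fst)"
proof -
  have [measurable]: "K \<in> borel \<rightarrow>\<^sub>M prob_algebra borel"
    and eq: "\<pi> = distr \<pi> borel fst \<bind> (\<lambda>x. distr (K x) (borel \<Otimes>\<^sub>M borel) (\<lambda>y. (x, y)))"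
    using K by (auto simp: is_disintegration_def)
  have k: "(\<lambda>x. distr (K x) (borel \<Otimes>\<^sub>M borel) (\<lambda>y. (x, y))) \<in> borel \<rightarrow>\<^sub>M prob_algebra (borel \<Otimes>\<^sub>M borel)"
    by measurable
  then have k': "(\<lambda>x. distr (K x) (borel \<Otimes>\<^sub>M borel) (\<lambda>y. (x, y)))
      \<in> distr \<pi> borel fst \<rightarrow>\<^sub>M subprob_algebra (borel \<Otimes>\<^sub>M borel)"
    using measurable_prob_algebraD[OF k] by simp
  have "(\<integral>\<^sup>+ z. f z \<partial>\<pi>)
      = (\<integral>\<^sup>+ z. f z \<partial>(distr \<pi> borel fst \<bind> (\<lambda>x. distr (K x) (borel \<Otimes>\<^sub>M borel) (\<lambda>y. (x, y)))))"
    using eq by simp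
  also have "\<dots> = (\<integral>\<^sup>+ x. \<integral>\<^sup>+ z. f z \<partial>distr (K x) (borel \<Otimes>\<^sub>M borel) (\<lambda>y. (x, y)) \<partial>distr \<pi> borel fst)"
    by (rule nn_integral_bind[OF f k'])
  also have "\<dots> = (\<integral>\<^sup>+ x. \<integral>\<^sup>+ y. f (x, y) \<partial>K x \<partial>distr \<pi> borel fst)"
  proof (intro nn_integral_cong)
    fix x
    interpret real_distribution "K x" by (rule real_distribution_kernel) measurable
    show "(\<integral>\<^sup>+ z. f z \<partial>distr (K x) (borel \<Otimes>\<^sub>M borel) (\<lambda>y. (x, y))) = (\<integral>\<^sup>+ y. f (x, y) \<partial>K x)"
    proof (rule nn_integral_distr)
      have "(\<lambda>y. (x, y)) \<in> borel \<rightarrow>\<^sub>M borel \<Otimes>\<^sub>M borel" by measurable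
      then show "(\<lambda>y. (x, y)) \<in> K x \<rightarrow>\<^sub>M borel \<Otimes>\<^sub>M borel" by (simp cong: measurable_cong_sets)
    qed (use f in simp)
  qed
  finally show ?thesis .
qed

context
  fixes \<mu> :: "real measure" and Y :: "real \<Rightarrow> real \<Rightarrow> real"
  assumes \<mu>: "real_distribution \<mu>"
    and Y [measurable]: "jointly_measurable Y"
begin

interpretation M: real_distribution \<mu> by (rule \<mu>)

lemma measurable_lift_map:
  "(\<lambda>(u, v). (quantile \<mu> u, Y u v)) \<in> unif \<Otimes>\<^sub>M unif \<rightarrow>\<^sub>M borel \<Otimes>\<^sub>M borel"
proof -
  note [measurable] = borel_measurable_quantile[OF \<mu>]
  have "(\<lambda>(u, v). (quantile \<mu> u, Y u v)) \<in> borel \<Otimes>\<^sub>M borel \<rightarrow>\<^sub>M borel \<Otimes>\<^sub>M borel"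
    unfolding case_prod_beta' by measurable
  from measurable_compose[OF measurable_unif2_ident this] show ?thesis by simp
qed

lemma measurable_comp_lift_map:
  assumes "f \<in> borel \<Otimes>\<^sub>M borel \<rightarrow>\<^sub>M N"
  shows "(\<lambda>z. f (quantile \<mu> (fst z), Y (fst z) (snd z))) \<in> borel \<Otimes>\<^sub>M borel \<rightarrow>\<^sub>M N"
proof -
  note [measurable] = borel_measurable_quantile[OF \<mu>]
  have "(\<lambda>z. (quantile \<mu> (fst z), Y (fst z) (snd z))) \<in> borel \<Otimes>\<^sub>M borel \<rightarrow>\<^sub>M borel \<Otimes>\<^sub>M borel"
    by measurable
  from measurable_compose[OF this assms] show ?thesis .
qed

lemma sets_lift_law [simp, measurable_cong]: "sets (lift_law \<mu> Y) = sets (borel \<Otimes>\<^sub>M borel)"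
  by (simp add: lift_law_def)

lemma nn_integral_lift_law:
  assumes f [measurable]: "f \<in> borel_measurable (borel \<Otimes>\<^sub>M borel)"
  shows "(\<integral>\<^sup>+ z. f z \<partial>lift_law \<mu> Y) = (\<integral>\<^sup>+ u. \<integral>\<^sup>+ v. f (quantile \<mu> u, Y u v) \<partial>unif \<partial>unif)"
proof -
  have "(\<integral>\<^sup>+ z. f z \<partial>lift_law \<mu> Y) = (\<integral>\<^sup>+ z. f (quantile \<mu> (fst z), Y (fst z) (snd z)) \<partial>(unif \<Otimes>\<^sub>M unif))"
    unfolding lift_law_def
    by (subst nn_integral_distr[OF measurable_lift_map]) (auto simp: case_prod_beta')
  also have "\<dots> = (\<integral>\<^sup>+ u. \<integral>\<^sup>+ v. f (quantile \<mu> u, Y u v) \<partial>unif \<partial>unif)"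
    by (simp add: nn_integral_unif2[OF measurable_comp_lift_map[OF f]])
  finally show ?thesis .
qed

lemma measurable_lift_law: "f \<in> borel \<Otimes>\<^sub>M borel \<rightarrow>\<^sub>M N \<Longrightarrow> f \<in> lift_law \<mu> Y \<rightarrow>\<^sub>M N"
  by (simp cong: measurable_cong_sets add: measurable_cong_sets[OF sets_lift_law refl])

lemma distr_fst_lift_law: "distr (lift_law \<mu> Y) borel fst = \<mu>"
proof (rule measure_eqI)
  fix A assume "A \<in> sets (distr (lift_law \<mu> Y) borel fst)"
  then have [measurable]: "A \<in> sets borel" by simp
  have "emeasure (distr (lift_law \<mu> Y) borel fst) A = (\<integral>\<^sup>+ z. indicator A (fst z) \<partial>lift_law \<mu> Y)"
    by (subst nn_integral_indicator[symmetric], simp, subst nn_integral_distr)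
      (auto intro!: measurable_lift_law)
  also have "\<dots> = (\<integral>\<^sup>+ u. indicator A (quantile \<mu> u) \<partial>unif)"
    by (subst nn_integral_lift_law) (auto simp: unif.emeasure_space_1[simplified])
  also have "\<dots> = emeasure \<mu> A" by (rule emeasure_unif_quantile[OF \<mu>]) measurable
  finally show "emeasure (distr (lift_law \<mu> Y) borel fst) A = emeasure \<mu> A" .
qed simp

text \<open>Given that the first coordinate is \<open>x\<close>, the driving variable \<open>u\<close> is uniform on the jump of
  the distribution function at \<open>x\<close>, that is, distributed as \<open>randomized_cdf \<mu> x t\<close> with \<open>t\<close>
  uniform.\<close>
lemma is_disintegration_lift_law:
  "is_disintegration (lift_law \<mu> Y)
    (\<lambda>x. distr (unif \<Otimes>\<^sub>M unif) borel (\<lambda>z. Y (randomized_cdf \<mu> x (fst z)) (snd z)))"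
  (is "is_disintegration _ ?K")
proof -
  note [measurable] = borel_measurable_quantile[OF \<mu>]
  note R [measurable] = borel_measurable_randomized_cdf[OF \<mu>]
  have m: "(\<lambda>w. Y (randomized_cdf \<mu> (fst w) (fst (snd w))) (snd (snd w)))
      \<in> borel_measurable (borel \<Otimes>\<^sub>M (borel \<Otimes>\<^sub>M borel))"
  proof -
    have "(\<lambda>w. randomized_cdf \<mu> (fst w) (fst (snd w))) \<in> borel_measurable (borel \<Otimes>\<^sub>M (borel \<Otimes>\<^sub>M borel))"
      using measurable_compose[OF _ R, of "\<lambda>w. (fst w, fst (snd w))"] by simp
    then have "(\<lambda>w. (randomized_cdf \<mu> (fst w) (fst (snd w)), snd (snd w)))
        \<in> borel \<Otimes>\<^sub>M (borel \<Otimes>\<^sub>M borel) \<rightarrow>\<^sub>M borel \<Otimes>\<^sub>M borel" by measurable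
    from measurable_compose[OF this Y] show ?thesis by simp
  qed
  have mx: "(\<lambda>z. Y (randomized_cdf \<mu> x (fst z)) (snd z)) \<in> borel_measurable (unif \<Otimes>\<^sub>M unif)" for x
    using measurable_compose[OF measurable_Pair[OF measurable_const[of x] measurable_unif2_ident] m] by simp
  have K: "?K \<in> borel \<rightarrow>\<^sub>M prob_algebra borel"
  proof (rule measurable_distr_prob_space2[where M = "unif \<Otimes>\<^sub>M unif"])
    show "(\<lambda>x. unif \<Otimes>\<^sub>M unif) \<in> borel \<rightarrow>\<^sub>M prob_algebra (unif \<Otimes>\<^sub>M unif)"
      by (rule measurable_const) (auto simp: space_prob_algebra unif2.prob_space_axioms)
    have "(\<lambda>w. (fst w, snd w)) \<in> borel \<Otimes>\<^sub>M (unif \<Otimes>\<^sub>M unif) \<rightarrow>\<^sub>M borel \<Otimes>\<^sub>M (borel \<Otimes>\<^sub>M borel)"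
      by (intro measurable_Pair measurable_fst measurable_compose[OF measurable_snd measurable_unif2_ident])
    from measurable_compose[OF this m]
    show "(\<lambda>(x, z). Y (randomized_cdf \<mu> x (fst z)) (snd z)) \<in> borel_measurable (borel \<Otimes>\<^sub>M (unif \<Otimes>\<^sub>M unif))"
      by (simp add: case_prod_beta')
  qed
  note [measurable] = K
  have k: "(\<lambda>x. distr (?K x) (borel \<Otimes>\<^sub>M borel) (\<lambda>y. (x, y))) \<in> borel \<rightarrow>\<^sub>M prob_algebra (borel \<Otimes>\<^sub>M borel)"
    by measurable
  let ?B = "\<mu> \<bind> (\<lambda>x. distr (?K x) (borel \<Otimes>\<^sub>M borel) (\<lambda>y. (x, y)))"
  have k': "(\<lambda>x. distr (?K x) (borel \<Otimes>\<^sub>M borel) (\<lambda>y. (x, y))) \<in> \<mu> \<rightarrow>\<^sub>M subprob_algebra (borel \<Otimes>\<^sub>M borel)"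
    using measurable_prob_algebraD[OF k] by (simp cong: measurable_cong_sets)
  have "lift_law \<mu> Y = ?B"
  proof (rule measure_eqI)
    show sets_eq: "sets (lift_law \<mu> Y) = sets ?B"
      using sets_bind[OF _ M.not_empty, of "\<lambda>x. distr (?K x) (borel \<Otimes>\<^sub>M borel) (\<lambda>y. (x, y))"] by simp
    fix A assume "A \<in> sets (lift_law \<mu> Y)"
    then have A [measurable]: "A \<in> sets (borel \<Otimes>\<^sub>M borel)" by simp
    have indA: "(\<lambda>x. indicator A (fst x, snd x) :: ennreal) \<in> borel_measurable (borel \<Otimes>\<^sub>M borel)" by simp
    let ?h = "\<lambda>w. \<integral>\<^sup>+ v. indicator A (quantile \<mu> w, Y w v) \<partial>unif"
    have h_pair: "(\<lambda>w. indicator A (quantile \<mu> (fst w), Y (fst w) (snd w)) :: ennreal)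
        \<in> borel_measurable (borel \<Otimes>\<^sub>M borel)" by (rule measurable_comp_lift_map) simp
    have h: "?h \<in> borel_measurable borel"
    proof (rule unif.borel_measurable_nn_integral)
      have "(\<lambda>w. (fst w, snd w)) \<in> borel \<Otimes>\<^sub>M unif \<rightarrow>\<^sub>M borel \<Otimes>\<^sub>M borel"
        by (intro measurable_Pair measurable_fst measurable_compose[OF measurable_snd measurable_unif_ident])
      from measurable_compose[OF this h_pair]
      show "(\<lambda>(w, v). indicator A (quantile \<mu> w, Y w v) :: ennreal) \<in> borel_measurable (borel \<Otimes>\<^sub>M unif)"
        by (simp add: case_prod_beta')
    qed
    have "emeasure ?B A = (\<integral>\<^sup>+ x. emeasure (distr (?K x) (borel \<Otimes>\<^sub>M borel) (\<lambda>y. (x, y))) A \<partial>\<mu>)"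
      by (rule emeasure_bind[OF M.not_empty k' A])
    also have "\<dots> = (\<integral>\<^sup>+ x. \<integral>\<^sup>+ z. indicator A (x, Y (randomized_cdf \<mu> x (fst z)) (snd z)) \<partial>(unif \<Otimes>\<^sub>M unif) \<partial>\<mu>)"
    proof (rule nn_integral_cong)
      fix x
      have [measurable]: "(\<lambda>z. Y (randomized_cdf \<mu> x (fst z)) (snd z)) \<in> borel_measurable (unif \<Otimes>\<^sub>M unif)" by (rule mx)
      show "emeasure (distr (?K x) (borel \<Otimes>\<^sub>M borel) (\<lambda>y. (x, y))) A
        = (\<integral>\<^sup>+ z. indicator A (x, Y (randomized_cdf \<mu> x (fst z)) (snd z)) \<partial>(unif \<Otimes>\<^sub>M unif))"
      proof -
        have pm: "(\<lambda>z. (x, Y (randomized_cdf \<mu> x (fst z)) (snd z))) \<in> unif \<Otimes>\<^sub>M unif \<rightarrow>\<^sub>M borel \<Otimes>\<^sub>M borel"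
          by measurable
        have "distr (?K x) (borel \<Otimes>\<^sub>M borel) (\<lambda>y. (x, y))
          = distr (unif \<Otimes>\<^sub>M unif) (borel \<Otimes>\<^sub>M borel) (\<lambda>z. (x, Y (randomized_cdf \<mu> x (fst z)) (snd z)))"
          by (subst distr_distr) (auto simp: o_def mx)
        then have "emeasure (distr (?K x) (borel \<Otimes>\<^sub>M borel) (\<lambda>y. (x, y))) A
          = (\<integral>\<^sup>+ z. indicator A z \<partial>distr (unif \<Otimes>\<^sub>M unif) (borel \<Otimes>\<^sub>M borel)
              (\<lambda>z. (x, Y (randomized_cdf \<mu> x (fst z)) (snd z))))" by simp
        also have "\<dots> = (\<integral>\<^sup>+ z. indicator A (x, Y (randomized_cdf \<mu> x (fst z)) (snd z)) \<partial>(unif \<Otimes>\<^sub>M unif))"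
          by (rule nn_integral_distr[OF pm]) simp
        finally show ?thesis .
      qed
    qed
    also have "\<dots> = (\<integral>\<^sup>+ x. \<integral>\<^sup>+ t. \<integral>\<^sup>+ v. indicator A (x, Y (randomized_cdf \<mu> x t) v) \<partial>unif \<partial>unif \<partial>\<mu>)"
    proof (rule nn_integral_cong)
      fix x
      have "(\<lambda>z. Y (randomized_cdf \<mu> x (fst z)) (snd z)) \<in> borel_measurable (borel \<Otimes>\<^sub>M borel)"
        using measurable_compose[OF measurable_Pair[OF measurable_const[of x] measurable_ident] m] by simp
      from measurable_compose[OF measurable_Pair[OF measurable_const this] indA, of x]
      show "(\<integral>\<^sup>+ z. indicator A (x, Y (randomized_cdf \<mu> x (fst z)) (snd z)) \<partial>(unif \<Otimes>\<^sub>M unif)) =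
        (\<integral>\<^sup>+ t. \<integral>\<^sup>+ v. indicator A (x, Y (randomized_cdf \<mu> x t) v) \<partial>unif \<partial>unif)"
        by (subst nn_integral_unif2) simp_all
    qed
    also have "\<dots> = (\<integral>\<^sup>+ x. \<integral>\<^sup>+ t. \<integral>\<^sup>+ v. indicator A (x, Y (randomized_cdf \<mu> x t) v) \<partial>unif \<partial>unif
        \<partial>distr unif borel (quantile \<mu>))"
      by (simp add: distr_quantile[OF \<mu>])
    also have "\<dots> = (\<integral>\<^sup>+ u. \<integral>\<^sup>+ t. \<integral>\<^sup>+ v. indicator A (quantile \<mu> u, Y (randomized_cdf \<mu> (quantile \<mu> u) t) v)
        \<partial>unif \<partial>unif \<partial>unif)"
    proof (rule nn_integral_distr)
      have "(\<lambda>w. (fst (fst w), (snd (fst w), snd w))) \<in> (borel \<Otimes>\<^sub>M unif) \<Otimes>\<^sub>M unif \<rightarrow>\<^sub>M borel \<Otimes>\<^sub>M (borel \<Otimes>\<^sub>M borel)"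
        by (intro measurable_Pair measurable_compose[OF measurable_fst measurable_fst]
          measurable_compose[OF measurable_compose[OF measurable_fst measurable_snd] measurable_unif_ident]
          measurable_compose[OF measurable_snd measurable_unif_ident])
      from measurable_compose[OF this m]
      have [measurable]: "(\<lambda>w. Y (randomized_cdf \<mu> (fst (fst w)) (snd (fst w))) (snd w))
        \<in> borel_measurable ((borel \<Otimes>\<^sub>M unif) \<Otimes>\<^sub>M unif)" by simp
      have "(\<lambda>w. indicator A (fst (fst w), Y (randomized_cdf \<mu> (fst (fst w)) (snd (fst w))) (snd w)) :: ennreal)
        \<in> borel_measurable ((borel \<Otimes>\<^sub>M unif) \<Otimes>\<^sub>M unif)" by measurable
      then show "(\<lambda>x. \<integral>\<^sup>+ t. \<integral>\<^sup>+ v. indicator A (x, Y (randomized_cdf \<mu> x t) v) \<partial>unif \<partial>unif)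
          \<in> borel_measurable (distr unif borel (quantile \<mu>))"
        unfolding measurable_distr_eq1 by (intro unif.borel_measurable_nn_integral) (simp add: case_prod_beta')
    qed (rule measurable_unif, measurable)
    also have "\<dots> = (\<integral>\<^sup>+ u. \<integral>\<^sup>+ t. ?h (randomized_cdf \<mu> (quantile \<mu> u) t) \<partial>unif \<partial>unif)"
      by (intro nn_integral_cong) (simp add: quantile_randomized_cdf[OF \<mu>])
    also have "\<dots> = (\<integral>\<^sup>+ u. ?h u \<partial>unif)"
      by (rule nn_integral_randomized_cdf[OF \<mu> h])
    also have "\<dots> = (\<integral>\<^sup>+ z. indicator A z \<partial>lift_law \<mu> Y)"
      by (subst nn_integral_lift_law) auto
    also have "\<dots> = emeasure (lift_law \<mu> Y) A" by simp
    finally show "emeasure (lift_law \<mu> Y) A = emeasure ?B A" ..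
  qed
  then show ?thesis
    using K unfolding is_disintegration_def distr_fst_lift_law by blast
qed

lemma is_disintegration_disintegration: "is_disintegration (lift_law \<mu> Y) (disintegration (lift_law \<mu> Y))"
  unfolding disintegration_def
  by (rule someI[where P = "is_disintegration (lift_law \<mu> Y)", OF is_disintegration_lift_law])

lemma nn_integral_kernel_quantile:
  assumes K: "is_disintegration (lift_law \<mu> Y) K" and f [measurable]: "f \<in> borel_measurable (borel \<Otimes>\<^sub>M borel)"
  shows "(\<integral>\<^sup>+ u. \<integral>\<^sup>+ y. f (quantile \<mu> u, y) \<partial>K (quantile \<mu> u) \<partial>unif)
    = (\<integral>\<^sup>+ u. \<integral>\<^sup>+ v. f (quantile \<mu> u, Y u v) \<partial>unif \<partial>unif)"
proof -
  have Km [measurable]: "K \<in> borel \<rightarrow>\<^sub>M prob_algebra borel"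
    using K by (auto simp: is_disintegration_def)
  have "(\<integral>\<^sup>+ u. \<integral>\<^sup>+ v. f (quantile \<mu> u, Y u v) \<partial>unif \<partial>unif) = (\<integral>\<^sup>+ z. f z \<partial>lift_law \<mu> Y)"
    by (simp add: nn_integral_lift_law)
  also have "\<dots> = (\<integral>\<^sup>+ x. \<integral>\<^sup>+ y. f (x, y) \<partial>K x \<partial>distr unif borel (quantile \<mu>))"
    by (subst nn_integral_disintegration[OF K f]) (simp add: distr_fst_lift_law distr_quantile[OF \<mu>])
  also have "\<dots> = (\<integral>\<^sup>+ u. \<integral>\<^sup>+ y. f (quantile \<mu> u, y) \<partial>K (quantile \<mu> u) \<partial>unif)"
    by (rule nn_integral_distr)
      (auto intro!: measurable_unif borel_measurable_quantile[OF \<mu>] nn_integral_measurable_subprob_algebra2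
        measurable_prob_algebraD[OF Km])
  finally show ?thesis ..
qed

end

section \<open>Kernels, distribution functions and conditional expectations\<close>

lemma borel_measurable_lift_section:
  assumes Y: "jointly_measurable Y"
  shows "(\<lambda>v. Y u v) \<in> borel_measurable (borel :: real measure)"
  using measurable_compose[OF measurable_Pair[OF measurable_const[of u] measurable_ident] Y] by simp

lemma lift_cdf_eq_nn_integral:
  assumes Y: "jointly_measurable Y"
  shows "ennreal (lift_cdf Y y u) = (\<integral>\<^sup>+ v. indicator {..y} (Y u v) \<partial>unif)"
proof -
  have [measurable]: "(\<lambda>v. Y u v) \<in> borel_measurable unif"
    by (rule measurable_unif[OF borel_measurable_lift_section[OF Y]])
  have "integrable unif (\<lambda>v. indicator {..y} (Y u v) :: real)"
    by (intro unif.integrable_const_bound[of _ 1]) (auto split: split_indicator)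
  then have "(\<integral>\<^sup>+ v. ennreal (indicator {..y} (Y u v)) \<partial>unif) = ennreal (lift_cdf Y y u)"
    unfolding lift_cdf_def by (rule nn_integral_eq_integral) auto
  then show ?thesis by (simp add: ennreal_indicator)
qed

lemma lift_cdf_bounds: "0 \<le> lift_cdf Y y u" "lift_cdf Y y u \<le> 1"
proof -
  show "0 \<le> lift_cdf Y y u"
    unfolding lift_cdf_def by (intro Bochner_Integration.integral_nonneg) auto
  show "lift_cdf Y y u \<le> 1"
    unfolding lift_cdf_def
    by (cases "integrable unif (\<lambda>v. indicator {..y} (Y u v) :: real)")
      (auto simp: not_integrable_integral_eq intro!: unif.integral_le_const split: split_indicator)
qed

lemma borel_measurable_lift_cdf:
  assumes Y: "jointly_measurable Y"
  shows "lift_cdf Y y \<in> borel_measurable borel"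
proof -
  have "(\<lambda>w. (fst w, snd w)) \<in> borel \<Otimes>\<^sub>M unif \<rightarrow>\<^sub>M borel \<Otimes>\<^sub>M borel"
    by (intro measurable_Pair measurable_fst measurable_compose[OF measurable_snd measurable_unif_ident])
  from measurable_compose[OF this Y]
  have [measurable]: "(\<lambda>w. Y (fst w) (snd w)) \<in> borel_measurable (borel \<Otimes>\<^sub>M unif)" by simp
  have "(\<lambda>(u, v). indicator {..y} (Y u v) :: real) \<in> borel_measurable (borel \<Otimes>\<^sub>M unif)"
    unfolding case_prod_beta' by measurable
  then show ?thesis
    unfolding lift_cdf_def[abs_def] by (rule unif.borel_measurable_lebesgue_integral)
qed

lemma integrable_lift_cdf:
  assumes Y: "jointly_measurable Y"
  shows "integrable unif (lift_cdf Y y)"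
  using measurable_unif[OF borel_measurable_lift_cdf[OF Y]]
  by (intro unif.integrable_const_bound[of _ 1]) (auto simp: lift_cdf_bounds)

lemma borel_measurable_cdf_kernel:
  fixes K :: "real \<Rightarrow> real measure"
  assumes K [measurable]: "K \<in> borel \<rightarrow>\<^sub>M prob_algebra borel"
  shows "(\<lambda>w. cdf (K (fst w)) (snd w)) \<in> borel_measurable (borel \<Otimes>\<^sub>M borel)"
  unfolding cdf_def
proof (rule measure_measurable_prob_algebra2[where N = borel])
  have "{w \<in> space ((borel \<Otimes>\<^sub>M borel) \<Otimes>\<^sub>M borel). snd w \<le> snd (fst w)}
      \<in> sets (((borel :: real measure) \<Otimes>\<^sub>M borel) \<Otimes>\<^sub>M (borel :: real measure))" by measurable
  also have "{w \<in> space ((borel \<Otimes>\<^sub>M borel) \<Otimes>\<^sub>M borel). snd w \<le> snd (fst w)}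
      = (SIGMA w : space ((borel :: real measure) \<Otimes>\<^sub>M (borel :: real measure)). {..snd w})"
    by (auto simp: space_pair_measure)
  finally show "(SIGMA w : space ((borel :: real measure) \<Otimes>\<^sub>M (borel :: real measure)). {..snd w})
    \<in> sets ((borel \<Otimes>\<^sub>M borel) \<Otimes>\<^sub>M borel)" .
qed measurable

lemma borel_measurable_quantile_kernel:
  fixes K :: "real \<Rightarrow> real measure"
  assumes K: "K \<in> borel \<rightarrow>\<^sub>M prob_algebra borel"
  shows "(\<lambda>w. quantile (K (fst w)) (snd w)) \<in> borel_measurable (borel \<Otimes>\<^sub>M unif)"
proof (rule borel_measurableI_le)
  fix y
  have [measurable]: "(\<lambda>x. cdf (K x) y) \<in> borel_measurable borel"
    using measurable_compose[OF measurable_Pair[OF measurable_ident measurable_const[of y]]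
      borel_measurable_cdf_kernel[OF K]] by simp
  have [measurable]: "(\<lambda>w. snd w) \<in> borel_measurable (borel \<Otimes>\<^sub>M unif)"
    by (rule measurable_compose[OF measurable_snd measurable_unif_ident])
  have "{w \<in> space (borel \<Otimes>\<^sub>M unif). quantile (K (fst w)) (snd w) \<le> y}
      = {w \<in> space (borel \<Otimes>\<^sub>M unif). snd w \<le> cdf (K (fst w)) y}"
    by (auto simp: space_pair_measure quantile_le_iff[OF real_distribution_kernel[OF K]])
  also have "\<dots> \<in> sets (borel \<Otimes>\<^sub>M unif)" by measurable
  finally show "{w \<in> space (borel \<Otimes>\<^sub>M unif). quantile (K (fst w)) (snd w) \<le> y} \<in> sets (borel \<Otimes>\<^sub>M unif)" .
qed

text \<open>The right-hand side is a function of the conditioning variable and, by the disintegration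
  property, has the right integrals. This determines every version of the disintegration at almost
  all quantiles.\<close>
lemma cexp_lift_cdf_AE:
  assumes \<mu>: "real_distribution \<mu>"
    and Y: "jointly_measurable Y"
    and K: "is_disintegration (lift_law \<mu> Y) K"
  shows "AE u in unif. cexp (quantile \<mu>) (lift_cdf Y y) u = cdf (K (quantile \<mu> u)) y"
proof (rule cexp_charact)
  note Q [measurable] = borel_measurable_quantile[OF \<mu>]
  show Q: "quantile \<mu> \<in> borel_measurable borel" by (rule Q)
  note [measurable] = measurable_unif[OF Q]
  have Km: "K \<in> borel \<rightarrow>\<^sub>M prob_algebra borel" using K by (simp add: is_disintegration_def)
  show m [measurable]: "(\<lambda>x. cdf (K x) y) \<in> borel_measurable borel"
    using measurable_compose[OF measurable_Pair[OF measurable_ident measurable_const[of y]]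
      borel_measurable_cdf_kernel[OF Km]] by simp
  note [measurable] = measurable_unif[OF borel_measurable_lift_cdf[OF Y]]
  have K01: "0 \<le> cdf (K x) y" "cdf (K x) y \<le> 1" for x
  proof -
    interpret real_distribution "K x" by (rule real_distribution_kernel[OF Km])
    show "0 \<le> cdf (K x) y" "cdf (K x) y \<le> 1" by (rule cdf_nonneg, rule cdf_bounded_prob)
  qed
  show "integrable unif (lift_cdf Y y)" by (rule integrable_lift_cdf[OF Y])
  show "integrable unif (\<lambda>u. cdf (K (quantile \<mu> u)) y)"
    using K01 by (intro unif.integrable_const_bound[of _ 1]) auto
  fix B :: "real set" assume B [measurable]: "B \<in> sets borel"
  let ?f = "\<lambda>z. indicator (B \<times> {..y}) z :: ennreal"
  have i1: "integrable unif (\<lambda>u. indicator B (quantile \<mu> u) * lift_cdf Y y u)"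
    using lift_cdf_bounds[of Y y]
    by (intro unif.integrable_const_bound[of _ 1]) (auto split: split_indicator)
  have i2: "integrable unif (\<lambda>u. indicator B (quantile \<mu> u) * cdf (K (quantile \<mu> u)) y)"
    using K01 by (intro unif.integrable_const_bound[of _ 1]) (auto split: split_indicator)
  have "ennreal (\<integral>u. indicator B (quantile \<mu> u) * lift_cdf Y y u \<partial>unif)
      = (\<integral>\<^sup>+ u. ennreal (indicator B (quantile \<mu> u) * lift_cdf Y y u) \<partial>unif)"
    using lift_cdf_bounds[of Y y] by (intro nn_integral_eq_integral[symmetric] i1 AE_I2) auto
  also have "\<dots> = (\<integral>\<^sup>+ u. \<integral>\<^sup>+ v. ?f (quantile \<mu> u, Y u v) \<partial>unif \<partial>unif)"
  proof (rule nn_integral_cong)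
    fix u
    have "(\<integral>\<^sup>+ v. ?f (quantile \<mu> u, Y u v) \<partial>unif)
        = (\<integral>\<^sup>+ v. indicator B (quantile \<mu> u) * indicator {..y} (Y u v) \<partial>unif)"
      by (simp add: indicator_times)
    also have "\<dots> = indicator B (quantile \<mu> u) * ennreal (lift_cdf Y y u)"
      using measurable_unif[OF borel_measurable_lift_section[OF Y], of u]
      by (simp add: nn_integral_cmult lift_cdf_eq_nn_integral[OF Y])
    finally show "ennreal (indicator B (quantile \<mu> u) * lift_cdf Y y u)
        = (\<integral>\<^sup>+ v. ?f (quantile \<mu> u, Y u v) \<partial>unif)"
      by (simp add: ennreal_mult' ennreal_indicator lift_cdf_bounds)
  qed
  also have "\<dots> = (\<integral>\<^sup>+ u. \<integral>\<^sup>+ y. ?f (quantile \<mu> u, y) \<partial>K (quantile \<mu> u) \<partial>unif)"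
    by (rule nn_integral_kernel_quantile[OF \<mu> Y K, symmetric]) measurable
  also have "\<dots> = (\<integral>\<^sup>+ u. ennreal (indicator B (quantile \<mu> u) * cdf (K (quantile \<mu> u)) y) \<partial>unif)"
  proof (rule nn_integral_cong)
    fix u
    interpret K: real_distribution "K (quantile \<mu> u)" by (rule real_distribution_kernel[OF Km])
    have "(\<integral>\<^sup>+ v. ?f (quantile \<mu> u, v) \<partial>K (quantile \<mu> u))
        = (\<integral>\<^sup>+ v. indicator B (quantile \<mu> u) * indicator {..y} v \<partial>K (quantile \<mu> u))"
      by (simp add: indicator_times)
    also have "\<dots> = indicator B (quantile \<mu> u) * ennreal (cdf (K (quantile \<mu> u)) y)"
      by (subst nn_integral_cmult) (auto simp: cdf_def K.emeasure_eq_measure)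
    finally show "(\<integral>\<^sup>+ v. ?f (quantile \<mu> u, v) \<partial>K (quantile \<mu> u))
        = ennreal (indicator B (quantile \<mu> u) * cdf (K (quantile \<mu> u)) y)"
      by (simp add: ennreal_mult' ennreal_indicator K01)
  qed
  also have "\<dots> = ennreal (\<integral>u. indicator B (quantile \<mu> u) * cdf (K (quantile \<mu> u)) y \<partial>unif)"
    using K01 by (intro nn_integral_eq_integral i2 AE_I2) auto
  finally show "(\<integral>u. indicator B (quantile \<mu> u) * lift_cdf Y y u \<partial>unif)
      = (\<integral>u. indicator B (quantile \<mu> u) * cdf (K (quantile \<mu> u)) y \<partial>unif)"
    using lift_cdf_bounds[of Y y] K01
    by (subst (asm) ennreal_inj) (auto intro!: Bochner_Integration.integral_nonneg)
qed

lemma epowr_epowr_inverse: "p > 0 \<Longrightarrow> epowr (epowr x (1 / p)) p = x"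
  by (cases x) (auto simp: epowr_def powr_powr)

lemma epowr_mono: "p \<ge> 0 \<Longrightarrow> x \<le> y \<Longrightarrow> epowr x p \<le> epowr y p"
  by (cases x; cases y) (auto simp: epowr_def top_unique intro!: ennreal_leI powr_mono2)

lemma tendsto_epowr_zero:
  assumes p: "p > 0" and c: "c \<longlonglongrightarrow> 0"
  shows "(\<lambda>n. epowr (c n) p) \<longlonglongrightarrow> 0"
proof -
  have "(\<lambda>n. enn2real (c n)) \<longlonglongrightarrow> 0" using tendsto_enn2real[of c 0] c by simp
  then have "(\<lambda>n. enn2real (c n) powr p) \<longlonglongrightarrow> 0"
    using p by (intro tendsto_zero_powrI[where b = p]) auto
  then have "(\<lambda>n. ennreal (enn2real (c n) powr p)) \<longlonglongrightarrow> 0" using tendsto_ennrealI by fastforce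
  moreover have "\<forall>\<^sub>F n in sequentially. c n < \<top>" using c by (auto simp: order_tendsto_iff)
  then have "\<forall>\<^sub>F n in sequentially. ennreal (enn2real (c n) powr p) = epowr (c n) p"
    by eventually_elim (auto simp: epowr_def)
  ultimately show ?thesis by (rule Lim_transform_eventually)
qed

lemma quantile_pair_in_couplings:
  assumes "real_distribution \<mu>" "real_distribution \<nu>"
  shows "distr unif (borel \<Otimes>\<^sub>M borel) (\<lambda>u. (quantile \<mu> u, quantile \<nu> u)) \<in> couplings \<mu> \<nu>"
proof -
  note [measurable] = measurable_unif[OF borel_measurable_quantile[OF assms(1)]]
    measurable_unif[OF borel_measurable_quantile[OF assms(2)]]
  show ?thesis
    unfolding couplings_def
    by (auto intro!: unif.prob_space_distr simp: distr_distr o_def distr_quantile assms)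
qed

lemma wasserstein_power_le_quantile:
  assumes "\<rho> > 0" "real_distribution \<mu>" "real_distribution \<nu>"
  shows "epowr (wasserstein \<rho> \<mu> \<nu>) \<rho> \<le> (\<integral>\<^sup>+ u. ennreal (\<bar>quantile \<mu> u - quantile \<nu> u\<bar> powr \<rho>) \<partial>unif)"
proof -
  note [measurable] = measurable_unif[OF borel_measurable_quantile[OF assms(2)]]
    measurable_unif[OF borel_measurable_quantile[OF assms(3)]]
  have "epowr (wasserstein \<rho> \<mu> \<nu>) \<rho> = (INF \<pi>\<in>couplings \<mu> \<nu>. \<integral>\<^sup>+ z. ennreal (\<bar>fst z - snd z\<bar> powr \<rho>) \<partial>\<pi>)"
    using assms(1) by (simp add: wasserstein_def epowr_epowr_inverse)
  also have "\<dots> \<le> (\<integral>\<^sup>+ z. ennreal (\<bar>fst z - snd z\<bar> powr \<rho>)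
      \<partial>distr unif (borel \<Otimes>\<^sub>M borel) (\<lambda>u. (quantile \<mu> u, quantile \<nu> u)))"
    by (rule INF_lower[OF quantile_pair_in_couplings]) fact+
  also have "\<dots> = (\<integral>\<^sup>+ u. ennreal (\<bar>quantile \<mu> u - quantile \<nu> u\<bar> powr \<rho>) \<partial>unif)"
    by (subst nn_integral_distr) auto
  finally show ?thesis .
qed

text \<open>Comonotone couplings are used both for the first marginals and between the kernels. The
  integrand in the adapted distance is not known to be measurable, so it is bounded by a
  measurable function before the change of variables.\<close>
lemma adapted_wasserstein_le_quantile:
  assumes \<rho>: "\<rho> > 0" and \<mu>: "real_distribution \<mu>" "real_distribution \<mu>'"
    and Y: "jointly_measurable Y"
      "jointly_measurable Y'"
  defines "K \<equiv> disintegration (lift_law \<mu> Y)" and "K' \<equiv> disintegration (lift_law \<mu>' Y')"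
  shows "adapted_wasserstein \<rho> (lift_law \<mu> Y) (lift_law \<mu>' Y') \<le>
    epowr ((\<integral>\<^sup>+ u. ennreal (\<bar>quantile \<mu> u - quantile \<mu>' u\<bar> powr \<rho>) \<partial>unif) +
      (\<integral>\<^sup>+ u. \<integral>\<^sup>+ v. ennreal (\<bar>quantile (K (quantile \<mu> u)) v - quantile (K' (quantile \<mu>' u)) v\<bar> powr \<rho>)
        \<partial>unif \<partial>unif)) (1 / \<rho>)"
proof -
  note [measurable] = measurable_unif[OF borel_measurable_quantile[OF \<mu>(1)]]
    measurable_unif[OF borel_measurable_quantile[OF \<mu>(2)]]
  have Km: "K \<in> borel \<rightarrow>\<^sub>M prob_algebra borel" "K' \<in> borel \<rightarrow>\<^sub>M prob_algebra borel"
    using is_disintegration_disintegration[OF \<mu>(1) Y(1)] is_disintegration_disintegration[OF \<mu>(2) Y(2)]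
    by (auto simp: is_disintegration_def K_def K'_def)
  define c where "c x x' = (\<integral>\<^sup>+ v. ennreal (\<bar>quantile (K x) v - quantile (K' x') v\<bar> powr \<rho>) \<partial>unif)" for x x'
  have c: "jointly_measurable c"
    unfolding c_def
  proof (rule unif.borel_measurable_nn_integral)
    have 1: "(\<lambda>w. (fst (fst w), snd w)) \<in> ((borel :: real measure) \<Otimes>\<^sub>M (borel :: real measure)) \<Otimes>\<^sub>M unif \<rightarrow>\<^sub>M borel \<Otimes>\<^sub>M unif"
      by measurable
    have 2: "(\<lambda>w. (snd (fst w), snd w)) \<in> ((borel :: real measure) \<Otimes>\<^sub>M (borel :: real measure)) \<Otimes>\<^sub>M unif \<rightarrow>\<^sub>M borel \<Otimes>\<^sub>M unif"
      by measurable
    have [measurable]: "(\<lambda>w. quantile (K (fst (fst w))) (snd w)) \<in> borel_measurable ((borel \<Otimes>\<^sub>M (borel :: real measure)) \<Otimes>\<^sub>M unif)"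
        "(\<lambda>w. quantile (K' (snd (fst w))) (snd w)) \<in> borel_measurable (((borel :: real measure) \<Otimes>\<^sub>M borel) \<Otimes>\<^sub>M unif)"
      using measurable_compose[OF 1 borel_measurable_quantile_kernel[OF Km(1)]]
        measurable_compose[OF 2 borel_measurable_quantile_kernel[OF Km(2)]] by simp_all
    show "(\<lambda>(z, v). ennreal (\<bar>quantile (K (fst z)) v - quantile (K' (snd z)) v\<bar> powr \<rho>))
        \<in> borel_measurable ((borel \<Otimes>\<^sub>M borel) \<Otimes>\<^sub>M unif)"
      unfolding case_prod_beta' by measurable
  qed
  let ?\<gamma> = "distr unif (borel \<Otimes>\<^sub>M borel) (\<lambda>u. (quantile \<mu> u, quantile \<mu>' u))"
  have "(INF \<gamma>\<in>couplings \<mu> \<mu>'. \<integral>\<^sup>+ z. (ennreal (\<bar>fst z - snd z\<bar> powr \<rho>)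
          + epowr (wasserstein \<rho> (K (fst z)) (K' (snd z))) \<rho>) \<partial>\<gamma>)
      \<le> (\<integral>\<^sup>+ z. (ennreal (\<bar>fst z - snd z\<bar> powr \<rho>) + epowr (wasserstein \<rho> (K (fst z)) (K' (snd z))) \<rho>) \<partial>?\<gamma>)"
    by (rule INF_lower[OF quantile_pair_in_couplings[OF \<mu>]])
  also have "\<dots> \<le> (\<integral>\<^sup>+ z. (ennreal (\<bar>fst z - snd z\<bar> powr \<rho>) + c (fst z) (snd z)) \<partial>?\<gamma>)"
    unfolding c_def using \<rho> Km
    by (intro nn_integral_mono add_left_mono wasserstein_power_le_quantile real_distribution_kernel) auto
  also have "\<dots> = (\<integral>\<^sup>+ u. (ennreal (\<bar>quantile \<mu> u - quantile \<mu>' u\<bar> powr \<rho>) + c (quantile \<mu> u) (quantile \<mu>' u)) \<partial>unif)"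
  proof -
    have "(\<lambda>z. ennreal (\<bar>fst z - snd z\<bar> powr \<rho>) + c (fst z) (snd z)) \<in> borel_measurable (borel \<Otimes>\<^sub>M borel)"
      by (intro borel_measurable_add c) measurable
    then show ?thesis by (subst nn_integral_distr) auto
  qed
  also have "\<dots> = (\<integral>\<^sup>+ u. ennreal (\<bar>quantile \<mu> u - quantile \<mu>' u\<bar> powr \<rho>) \<partial>unif)
      + (\<integral>\<^sup>+ u. c (quantile \<mu> u) (quantile \<mu>' u) \<partial>unif)"
    using measurable_compose[OF measurable_Pair c, of "quantile \<mu>" unif "quantile \<mu>'"]
    by (intro nn_integral_add) simp_all
  finally show ?thesis
    unfolding adapted_wasserstein_def distr_fst_lift_law[OF \<mu>(1) Y(1)] distr_fst_lift_law[OF \<mu>(2) Y(2)]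
      K_def[symmetric] K'_def[symmetric] c_def
    using \<rho> by (intro epowr_mono) auto
qed

section \<open>Adapted convergence of lifted laws\<close>

lemma cexp_const_AE:
  assumes "q \<in> borel_measurable borel"
  shows "AE u in unif. cexp q (\<lambda>_. c) u = c"
  by (rule cexp_of_function_AE[OF assms, where g = "\<lambda>_. c"]) simp_all

lemma sections_unif_measurable:
  assumes "(\<lambda>z. f (fst z) (snd z)) \<in> borel \<Otimes>\<^sub>M unif \<rightarrow>\<^sub>M N" "q \<in> borel \<rightarrow>\<^sub>M borel"
  shows "(\<lambda>z. f (q (fst z)) (snd z)) \<in> unif \<Otimes>\<^sub>M unif \<rightarrow>\<^sub>M N"
proof -
  have "(\<lambda>z. (q (fst z), snd z)) \<in> unif \<Otimes>\<^sub>M unif \<rightarrow>\<^sub>M borel \<Otimes>\<^sub>M unif"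
    using measurable_compose[OF measurable_fst measurable_unif[OF assms(2)]] by measurable
  from measurable_compose[OF this assms(1)] show ?thesis by simp
qed

lemma nn_integral_lift_indicator:
  assumes Y: "jointly_measurable Y"
    and Y': "jointly_measurable Y'"
  shows "(\<integral>\<^sup>+ y. \<integral>\<^sup>+ z. ennreal \<bar>indicator {..y} (Y (fst z) (snd z)) - indicator {..y} (Y' (fst z) (snd z))\<bar>
      \<partial>(unif \<Otimes>\<^sub>M unif) \<partial>lborel)
    = (\<integral>\<^sup>+ u. L1_dist unif (Y u) (Y' u) \<partial>unif)"
proof -
  have [measurable]: "(\<lambda>z. Y (fst z) (snd z)) \<in> borel_measurable (unif \<Otimes>\<^sub>M unif)"
    "(\<lambda>z. Y' (fst z) (snd z)) \<in> borel_measurable (unif \<Otimes>\<^sub>M unif)"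
    using measurable_compose[OF measurable_unif2_ident Y] measurable_compose[OF measurable_unif2_ident Y'] by auto
  interpret pair_sigma_finite "unif \<Otimes>\<^sub>M unif" lborel
    by (simp add: pair_sigma_finite_def unif2.sigma_finite_measure_axioms sigma_finite_lborel)
  have ind: "indicator {..y} x = (indicator {x..} y :: real)" for x y :: real
    by (auto split: split_indicator)
  have "(\<integral>\<^sup>+ y. \<integral>\<^sup>+ z. ennreal \<bar>indicator {..y} (Y (fst z) (snd z)) - indicator {..y} (Y' (fst z) (snd z))\<bar>
      \<partial>(unif \<Otimes>\<^sub>M unif) \<partial>lborel)
    = (\<integral>\<^sup>+ z. \<integral>\<^sup>+ y. ennreal \<bar>indicator {..y} (Y (fst z) (snd z)) - indicator {..y} (Y' (fst z) (snd z))\<bar>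
      \<partial>lborel \<partial>(unif \<Otimes>\<^sub>M unif))"
    by (rule Fubini') (simp add: indicator_def case_prod_beta')
  also have "\<dots> = (\<integral>\<^sup>+ z. ennreal \<bar>Y (fst z) (snd z) - Y' (fst z) (snd z)\<bar> \<partial>(unif \<Otimes>\<^sub>M unif))"
    unfolding ind by (intro nn_integral_cong abs_diff_eq_nn_integral_indicator[symmetric])
  also have "\<dots> = (\<integral>\<^sup>+ u. L1_dist unif (Y u) (Y' u) \<partial>unif)"
    using Y Y' by (subst nn_integral_unif2) auto
  finally show ?thesis .
qed

lemma lift_cdf_diff_L1_le:
  assumes Y: "jointly_measurable Y"
    and Y': "jointly_measurable Y'"
  shows "(L1_dist unif (lift_cdf Y y) (lift_cdf Y' y)) \<le>
    (\<integral>\<^sup>+ z. ennreal \<bar>indicator {..y} (Y (fst z) (snd z)) - indicator {..y} (Y' (fst z) (snd z))\<bar>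
      \<partial>(unif \<Otimes>\<^sub>M unif))"
proof -
  have int: "integrable unif (\<lambda>v. indicator {..y} (W u v) :: real)"
    if "jointly_measurable W" for W u
    using measurable_unif[OF borel_measurable_lift_section[OF that]]
    by (intro unif.integrable_const_bound[of _ 1]) (auto split: split_indicator)
  have "(L1_dist unif (lift_cdf Y y) (lift_cdf Y' y)) \<le>
     (\<integral>\<^sup>+ u. \<integral>\<^sup>+ v. ennreal \<bar>indicator {..y} (Y u v) - indicator {..y} (Y' u v)\<bar> \<partial>unif \<partial>unif)"
  proof (rule nn_integral_mono)
    fix u
    have "lift_cdf Y y u - lift_cdf Y' y u = (\<integral>v. indicator {..y} (Y u v) - indicator {..y} (Y' u v) \<partial>unif)"
      unfolding lift_cdf_def using int[OF Y] int[OF Y'] by simp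
    then show "ennreal \<bar>lift_cdf Y y u - lift_cdf Y' y u\<bar>
      \<le> (\<integral>\<^sup>+ v. ennreal \<bar>indicator {..y} (Y u v) - indicator {..y} (Y' u v)\<bar> \<partial>unif)"
      using integral_norm_bound_ennreal[OF Bochner_Integration.integrable_diff[OF int[OF Y] int[OF Y']], of u u]
      by simp
  qed
  also have "\<dots> = (\<integral>\<^sup>+ z. ennreal \<bar>indicator {..y} (Y (fst z) (snd z)) - indicator {..y} (Y' (fst z) (snd z))\<bar>
      \<partial>(unif \<Otimes>\<^sub>M unif))"
    using Y Y' by (subst nn_integral_unif2) auto
  finally show ?thesis .
qed

text \<open>
  Let \<open>Z (u, v)\<close> be the \<open>v\<close>-quantile of the kernel at \<open>quantile \<mu> u\<close>, and \<open>Zs n\<close> its analogue, so that the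
  distance of the kernels is controlled by \<open>Zs n - Z\<close>. In \<open>L\<^sup>1\<close> this difference is an integral over levels
  \<open>y\<close> of distances of conditional expectations of \<open>lift_cdf\<close>. Changing the lift from \<open>Ys n\<close> to \<open>Y\<close> costs
  \<open>I n y\<close>, by contraction, and the sum over all levels is the \<open>L\<^sup>1\<close> distance of the lifts. Changing the
  conditioning variable costs \<open>D n y\<close>, which tends to 0 for each \<open>y\<close>. It is dominated because constants
  are not affected by conditioning: comparison with the indicator of \<open>0 \<le> y\<close> gives the bound \<open>2 * W y\<close>,
  whose integral is twice the first absolute moment of \<open>Y\<close>. Convergence of the moments of order \<open>\<rho>\<close>
  improves \<open>L\<^sup>1\<close> to \<open>L\<^sup>\<rho>\<close>.
\<close>
theorem adapted_wasserstein_lift_law_tendsto_zero: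
  fixes Y :: "real \<Rightarrow> real \<Rightarrow> real" and Ys :: "nat \<Rightarrow> real \<Rightarrow> real \<Rightarrow> real"
  assumes \<rho>: "\<rho> \<ge> 1" and \<mu>: "real_distribution \<mu>" and \<mu>s: "\<And>n. real_distribution (\<mu>s n)"
    and Y: "jointly_measurable Y"
    and Ys: "\<And>n. jointly_measurable (Ys n)"
    and Q\<rho>: "(\<lambda>n. \<integral>\<^sup>+ u. ennreal (\<bar>quantile (\<mu>s n) u - quantile \<mu> u\<bar> powr \<rho>) \<partial>unif) \<longlonglongrightarrow> 0"
    and Q1: "(\<lambda>n. L1_dist unif (quantile (\<mu>s n)) (quantile \<mu>)) \<longlonglongrightarrow> 0"
    and Y1: "(\<lambda>n. \<integral>\<^sup>+ u. L1_dist unif (Ys n u) (Y u) \<partial>unif) \<longlonglongrightarrow> 0"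
    and Yfin: "(\<integral>\<^sup>+ u. \<integral>\<^sup>+ v. ennreal \<bar>Y u v\<bar> \<partial>unif \<partial>unif) < \<top>"
    and Y\<rho>: "(\<lambda>n. \<integral>\<^sup>+ u. \<integral>\<^sup>+ v. ennreal (\<bar>Ys n u v\<bar> powr \<rho>) \<partial>unif \<partial>unif)
        \<longlonglongrightarrow> (\<integral>\<^sup>+ u. \<integral>\<^sup>+ v. ennreal (\<bar>Y u v\<bar> powr \<rho>) \<partial>unif \<partial>unif)"
    and Y\<rho>fin: "(\<integral>\<^sup>+ u. \<integral>\<^sup>+ v. ennreal (\<bar>Y u v\<bar> powr \<rho>) \<partial>unif \<partial>unif) < \<top>"
    and jump: "\<And>x. measure unif {u \<in> {0<..<1}. quantile \<mu> u = x} > 0 \<Longrightarrow>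
      \<exists>xs. (\<lambda>n. emeasure unif {u \<in> {0<..<1}. quantile \<mu> u = x \<and> quantile (\<mu>s n) u \<noteq> xs n}) \<longlonglongrightarrow> 0"
  shows "(\<lambda>n. adapted_wasserstein \<rho> (lift_law (\<mu>s n) (Ys n)) (lift_law \<mu> Y)) \<longlonglongrightarrow> 0"
proof -
  note Q = borel_measurable_quantile[OF \<mu>] and Qs = borel_measurable_quantile[OF \<mu>s]
  define K where "K = disintegration (lift_law \<mu> Y)"
  define Ks where "Ks n = disintegration (lift_law (\<mu>s n) (Ys n))" for n
  \<comment> \<open>The limit lift disintegrated along the approximating first marginal. In contrast to the conditional
    expectations, which are defined up to a null set for each level, its distribution functions are
    jointly measurable in the level.\<close>
  define Km where "Km n = disintegration (lift_law (\<mu>s n) Y)" for n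
  have dK: "is_disintegration (lift_law \<mu> Y) K"
    unfolding K_def by (rule is_disintegration_disintegration[OF \<mu> Y])
  have dKs: "is_disintegration (lift_law (\<mu>s n) (Ys n)) (Ks n)" for n
    unfolding Ks_def by (rule is_disintegration_disintegration[OF \<mu>s Ys])
  have dKm: "is_disintegration (lift_law (\<mu>s n) Y) (Km n)" for n
    unfolding Km_def by (rule is_disintegration_disintegration[OF \<mu>s Y])
  have mK: "K \<in> borel \<rightarrow>\<^sub>M prob_algebra borel" and mKs: "Ks n \<in> borel \<rightarrow>\<^sub>M prob_algebra borel"
    and mKm: "Km n \<in> borel \<rightarrow>\<^sub>M prob_algebra borel" for n
    using dK dKs dKm by (auto simp: is_disintegration_def)
  have cdf_meas: "(\<lambda>(y, u). cdf (L (q u)) y) \<in> borel_measurable (lborel \<Otimes>\<^sub>M unif)"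
    if L: "L \<in> borel \<rightarrow>\<^sub>M prob_algebra borel" and q: "q \<in> borel_measurable borel"
    for L :: "real \<Rightarrow> real measure" and q
  proof -
    have "(\<lambda>w. (q (snd w), fst w)) \<in> lborel \<Otimes>\<^sub>M unif \<rightarrow>\<^sub>M borel \<Otimes>\<^sub>M borel"
      using measurable_compose[OF measurable_snd measurable_unif[OF q]] by measurable
    from measurable_compose[OF this borel_measurable_cdf_kernel[OF L]] show ?thesis
      by (simp add: case_prod_beta')
  qed
  have cdf_meas1: "(\<lambda>u. cdf (L (q u)) y) \<in> borel_measurable unif"
    if L: "L \<in> borel \<rightarrow>\<^sub>M prob_algebra borel" and q: "q \<in> borel_measurable borel"
    for L :: "real \<Rightarrow> real measure" and q y
    using measurable_compose[OF measurable_Pair[OF measurable_unif[OF q] measurable_const[of y]]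
        borel_measurable_cdf_kernel[OF L]] by simp
  define Z where "Z z = quantile (K (quantile \<mu> (fst z))) (snd z)" for z :: "real \<times> real"
  define Zs where "Zs n z = quantile (Ks n (quantile (\<mu>s n) (fst z))) (snd z)" for n and z :: "real \<times> real"
  have mZ [measurable]: "Z \<in> borel_measurable (unif \<Otimes>\<^sub>M unif)"
    unfolding Z_def[abs_def] by (rule sections_unif_measurable[OF borel_measurable_quantile_kernel[OF mK] Q])
  have mZs [measurable]: "Zs n \<in> borel_measurable (unif \<Otimes>\<^sub>M unif)" for n
    unfolding Zs_def[abs_def] by (rule sections_unif_measurable[OF borel_measurable_quantile_kernel[OF mKs] Qs])
  define I where "I n y = (\<integral>\<^sup>+ z. ennreal \<bar>indicator {..y} (Ys n (fst z) (snd z)) - indicator {..y} (Y (fst z) (snd z))\<bar>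
      \<partial>(unif \<Otimes>\<^sub>M unif))" for n y
  define W where "W y = (\<integral>\<^sup>+ z. ennreal \<bar>indicator {..y} (Y (fst z) (snd z)) - indicator {..y} 0\<bar>
      \<partial>(unif \<Otimes>\<^sub>M unif))" for y :: real
  define D where "D n y = (\<integral>\<^sup>+ u. ennreal \<bar>cdf (Km n (quantile (\<mu>s n) u)) y - cdf (K (quantile \<mu> u)) y\<bar> \<partial>unif)" for n y
  have [measurable]: "D n \<in> borel_measurable lborel" for n
    unfolding D_def[abs_def] using cdf_meas[OF mKm Qs] cdf_meas[OF mK Q]
    by (intro unif.borel_measurable_nn_integral) (simp add: case_prod_beta')
  have IW_meas: "(\<lambda>y. \<integral>\<^sup>+ z. ennreal \<bar>indicator {..y} (A (fst z) (snd z)) - indicator {..y} (B (fst z) (snd z))\<bar>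
      \<partial>(unif \<Otimes>\<^sub>M unif)) \<in> borel_measurable lborel"
    if "jointly_measurable A"
      "jointly_measurable B" for A B :: "real \<Rightarrow> real \<Rightarrow> real"
  proof -
    have [measurable]: "(\<lambda>z. A (fst z) (snd z)) \<in> borel_measurable (unif \<Otimes>\<^sub>M unif)"
      "(\<lambda>z. B (fst z) (snd z)) \<in> borel_measurable (unif \<Otimes>\<^sub>M unif)"
      using measurable_compose[OF measurable_unif2_ident that(1)] measurable_compose[OF measurable_unif2_ident that(2)] by auto
    show ?thesis
      by (intro unif2.borel_measurable_nn_integral) (simp add: indicator_def case_prod_beta')
  qed
  have [measurable]: "I n \<in> borel_measurable lborel" for n
    unfolding I_def[abs_def] by (rule IW_meas[OF Ys Y])
  have [measurable]: "W \<in> borel_measurable lborel"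
    unfolding W_def[abs_def] by (rule IW_meas[OF Y]) simp
  have mY0: "(\<lambda>z. (0::real)) \<in> borel_measurable (borel \<Otimes>\<^sub>M borel)" by simp
  have int_I: "(\<integral>\<^sup>+ y. I n y \<partial>lborel) = (\<integral>\<^sup>+ u. L1_dist unif (Ys n u) (Y u) \<partial>unif)" for n
    unfolding I_def by (rule nn_integral_lift_indicator[OF Ys Y])
  have int_W: "(\<integral>\<^sup>+ y. W y \<partial>lborel) < \<top>"
    using nn_integral_lift_indicator[OF Y, of "\<lambda>_ _. 0"] Yfin by (simp add: W_def)
  have D_le: "D n y \<le> W y + W y" for n y
  proof -
    let ?c = "\<lambda>u::real. indicator {..y} (0::real) :: real"
    have c_int: "integrable unif ?c" by (intro unif.integrable_const_bound[of _ 1]) (auto split: split_indicator)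
    have part: "(L1_dist unif (cexp q (lift_cdf Y y)) ?c) \<le> W y"
      if q: "q \<in> borel_measurable borel" for q
    proof -
      have "(L1_dist unif (cexp q (lift_cdf Y y)) ?c)
          = (L1_dist unif (cexp q (lift_cdf Y y)) (cexp q ?c))"
        by (rule nn_integral_cong_AE, use cexp_const_AE[OF q, of "indicator {..y} 0"] in eventually_elim) simp
      also have "\<dots> \<le> (L1_dist unif (lift_cdf Y y) ?c)"
        by (rule cexp_contraction[OF q integrable_lift_cdf[OF Y] c_int])
      also have "\<dots> = (L1_dist unif (lift_cdf Y y) (lift_cdf (\<lambda>_ _. 0) y))"
        using unif.prob_space by (simp add: lift_cdf_def)
      also have "\<dots> \<le> W y" unfolding W_def by (rule lift_cdf_diff_L1_le[OF Y]) simp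
      finally show ?thesis .
    qed
    have "D n y = (L1_dist unif (cexp (quantile (\<mu>s n)) (lift_cdf Y y)) (cexp (quantile \<mu>) (lift_cdf Y y)))"
      unfolding D_def
      by (rule nn_integral_cong_AE, use cexp_lift_cdf_AE[OF \<mu>s Y dKm, of n y] cexp_lift_cdf_AE[OF \<mu> Y dK, of y] in eventually_elim) simp
    also have "\<dots> \<le> (L1_dist unif (cexp (quantile (\<mu>s n)) (lift_cdf Y y)) ?c)
       + (L1_dist unif ?c (cexp (quantile \<mu>) (lift_cdf Y y)))"
      by (rule nn_integral_abs_triangle) auto
    also have "\<dots> \<le> W y + W y"
      using part[OF Q] part[OF Qs] by (intro add_mono) (auto simp: abs_minus_commute)
    finally show ?thesis .
  qed
  have D_lim: "(\<lambda>n. D n y) \<longlonglongrightarrow> 0" for y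
  proof -
    have "D n y = (L1_dist unif (cexp (quantile (\<mu>s n)) (lift_cdf Y y)) (cexp (quantile \<mu>) (lift_cdf Y y)))" for n
      unfolding D_def
      by (rule nn_integral_cong_AE, use cexp_lift_cdf_AE[OF \<mu>s Y dKm, of n y] cexp_lift_cdf_AE[OF \<mu> Y dK, of y] in eventually_elim) simp
    moreover have "cexp_conv (\<lambda>n. quantile (\<mu>s n)) (quantile \<mu>) (lift_cdf Y y)"
      by (rule cexp_conv_integrable[OF Q Qs Q1 jump mono_on_quantile[OF \<mu>] integrable_lift_cdf[OF Y]])
    ultimately show ?thesis by (simp add: cexp_conv_def)
  qed
  have int_D: "(\<lambda>n. \<integral>\<^sup>+ y. D n y \<partial>lborel) \<longlonglongrightarrow> 0"
  proof -
    have "(\<lambda>n. \<integral>\<^sup>+ y. D n y \<partial>lborel) \<longlonglongrightarrow> (\<integral>\<^sup>+ y. 0 \<partial>(lborel :: real measure))"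
      by (rule nn_integral_dominated_convergence[where u = D and u' = "\<lambda>_. 0" and w = "\<lambda>y. W y + W y"])
        (use int_W D_le D_lim in \<open>auto simp: nn_integral_add\<close>)
    then show ?thesis by simp
  qed
  have Z_diff: "(L1_dist (unif \<Otimes>\<^sub>M unif) (Zs n) Z)
      \<le> (\<integral>\<^sup>+ u. L1_dist unif (Ys n u) (Y u) \<partial>unif) + (\<integral>\<^sup>+ y. D n y \<partial>lborel)" for n
  proof -
    have "(L1_dist (unif \<Otimes>\<^sub>M unif) (Zs n) Z)
        = (\<integral>\<^sup>+ u. \<integral>\<^sup>+ v. ennreal \<bar>Zs n (u, v) - Z (u, v)\<bar> \<partial>unif \<partial>unif)"
      by (subst unif.nn_integral_fst[symmetric]) auto
    also have "\<dots> = (\<integral>\<^sup>+ u. L1_dist lborel (cdf (Ks n (quantile (\<mu>s n) u))) (cdf (K (quantile \<mu> u))) \<partial>unif)"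
      unfolding Z_def Zs_def fst_conv snd_conv
      by (intro nn_integral_cong nn_integral_cdf_diff_eq_quantile_diff[symmetric] real_distribution_kernel mK mKs)
    also have "\<dots> = (\<integral>\<^sup>+ y. \<integral>\<^sup>+ u. ennreal \<bar>cdf (Ks n (quantile (\<mu>s n) u)) y - cdf (K (quantile \<mu> u)) y\<bar> \<partial>unif \<partial>lborel)"
    proof (rule pair_sigma_finite.Fubini')
      show "pair_sigma_finite lborel unif"
        by (simp add: pair_sigma_finite_def unif.sigma_finite_measure_axioms sigma_finite_lborel)
      show "(\<lambda>(y, u). ennreal \<bar>cdf (Ks n (quantile (\<mu>s n) u)) y - cdf (K (quantile \<mu> u)) y\<bar>)
        \<in> borel_measurable (lborel \<Otimes>\<^sub>M unif)"
        using cdf_meas[OF mKs Qs] cdf_meas[OF mK Q] by (simp add: case_prod_beta')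
    qed
    also have "\<dots> \<le> (\<integral>\<^sup>+ y. I n y + D n y \<partial>lborel)"
    proof (rule nn_integral_mono)
      fix y
      have "(\<integral>\<^sup>+ u. ennreal \<bar>cdf (Ks n (quantile (\<mu>s n) u)) y - cdf (K (quantile \<mu> u)) y\<bar> \<partial>unif)
         \<le> (\<integral>\<^sup>+ u. ennreal \<bar>cdf (Ks n (quantile (\<mu>s n) u)) y - cdf (Km n (quantile (\<mu>s n) u)) y\<bar> \<partial>unif) + D n y"
        unfolding D_def by (rule nn_integral_abs_triangle) (intro cdf_meas1 mK mKs mKm Q Qs)+
      also have "(\<integral>\<^sup>+ u. ennreal \<bar>cdf (Ks n (quantile (\<mu>s n) u)) y - cdf (Km n (quantile (\<mu>s n) u)) y\<bar> \<partial>unif)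
         = (L1_dist unif (cexp (quantile (\<mu>s n)) (lift_cdf (Ys n) y)) (cexp (quantile (\<mu>s n)) (lift_cdf Y y)))"
        by (rule nn_integral_cong_AE, use cexp_lift_cdf_AE[OF \<mu>s Ys dKs, of n y] cexp_lift_cdf_AE[OF \<mu>s Y dKm, of n y] in eventually_elim) simp
      also have "\<dots> \<le> (L1_dist unif (lift_cdf (Ys n) y) (lift_cdf Y y))"
        by (rule cexp_contraction[OF Qs integrable_lift_cdf[OF Ys] integrable_lift_cdf[OF Y]])
      also have "\<dots> \<le> I n y" unfolding I_def by (rule lift_cdf_diff_L1_le[OF Ys Y])
      finally show "(\<integral>\<^sup>+ u. ennreal \<bar>cdf (Ks n (quantile (\<mu>s n) u)) y - cdf (K (quantile \<mu> u)) y\<bar> \<partial>unif) \<le> I n y + D n y"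
        by (simp add: add_right_mono)
    qed
    also have "\<dots> = (\<integral>\<^sup>+ u. L1_dist unif (Ys n u) (Y u) \<partial>unif) + (\<integral>\<^sup>+ y. D n y \<partial>lborel)"
      by (subst nn_integral_add) (auto simp: int_I)
    finally show ?thesis .
  qed
  have moment: "(\<integral>\<^sup>+ z. ennreal (\<bar>quantile (L (quantile m (fst z))) (snd z)\<bar> powr \<rho>) \<partial>(unif \<Otimes>\<^sub>M unif))
      = (\<integral>\<^sup>+ u. \<integral>\<^sup>+ v. ennreal (\<bar>V u v\<bar> powr \<rho>) \<partial>unif \<partial>unif)"
    if m: "real_distribution m" and V: "jointly_measurable V"
      and L: "is_disintegration (lift_law m V) L" for m L V
  proof -
    have mL: "L \<in> borel \<rightarrow>\<^sub>M prob_algebra borel" using L by (simp add: is_disintegration_def)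
    have [measurable]: "(\<lambda>z. quantile (L (quantile m (fst z))) (snd z)) \<in> borel_measurable (unif \<Otimes>\<^sub>M unif)"
      by (rule sections_unif_measurable[OF borel_measurable_quantile_kernel[OF mL] borel_measurable_quantile[OF m]])
    have "(\<integral>\<^sup>+ z. ennreal (\<bar>quantile (L (quantile m (fst z))) (snd z)\<bar> powr \<rho>) \<partial>(unif \<Otimes>\<^sub>M unif))
       = (\<integral>\<^sup>+ u. \<integral>\<^sup>+ v. ennreal (\<bar>quantile (L (quantile m u)) v\<bar> powr \<rho>) \<partial>unif \<partial>unif)"
      by (subst unif.nn_integral_fst[symmetric]) auto
    also have "\<dots> = (\<integral>\<^sup>+ u. \<integral>\<^sup>+ y. ennreal (\<bar>y\<bar> powr \<rho>) \<partial>L (quantile m u) \<partial>unif)"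
    proof (rule nn_integral_cong)
      fix u
      have r: "real_distribution (L (quantile m u))" by (rule real_distribution_kernel[OF mL])
      have "(\<integral>\<^sup>+ y. ennreal (\<bar>y\<bar> powr \<rho>) \<partial>L (quantile m u))
          = (\<integral>\<^sup>+ y. ennreal (\<bar>y\<bar> powr \<rho>) \<partial>distr unif borel (quantile (L (quantile m u))))"
        by (simp add: distr_quantile[OF r])
      also have "\<dots> = (\<integral>\<^sup>+ v. ennreal (\<bar>quantile (L (quantile m u)) v\<bar> powr \<rho>) \<partial>unif)"
        using measurable_unif[OF borel_measurable_quantile[OF r]] by (subst nn_integral_distr) auto
      finally show "(\<integral>\<^sup>+ v. ennreal (\<bar>quantile (L (quantile m u)) v\<bar> powr \<rho>) \<partial>unif)
        = (\<integral>\<^sup>+ y. ennreal (\<bar>y\<bar> powr \<rho>) \<partial>L (quantile m u))" ..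
    qed
    also have "\<dots> = (\<integral>\<^sup>+ u. \<integral>\<^sup>+ v. ennreal (\<bar>V u v\<bar> powr \<rho>) \<partial>unif \<partial>unif)"
    proof -
      have "(\<lambda>z. ennreal (\<bar>snd z\<bar> powr \<rho>)) \<in> borel_measurable (borel \<Otimes>\<^sub>M borel)" by measurable
      from nn_integral_kernel_quantile[OF m V L this] show ?thesis by (simp only: snd_conv)
    qed
    finally show ?thesis .
  qed
  have mom_Z: "(\<integral>\<^sup>+ z. ennreal (\<bar>Z z\<bar> powr \<rho>) \<partial>(unif \<Otimes>\<^sub>M unif)) = (\<integral>\<^sup>+ u. \<integral>\<^sup>+ v. ennreal (\<bar>Y u v\<bar> powr \<rho>) \<partial>unif \<partial>unif)"
    unfolding Z_def by (rule moment[OF \<mu> Y dK])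
  have mom_Zs: "(\<integral>\<^sup>+ z. ennreal (\<bar>Zs n z\<bar> powr \<rho>) \<partial>(unif \<Otimes>\<^sub>M unif)) = (\<integral>\<^sup>+ u. \<integral>\<^sup>+ v. ennreal (\<bar>Ys n u v\<bar> powr \<rho>) \<partial>unif \<partial>unif)" for n
    unfolding Zs_def by (rule moment[OF \<mu>s Ys dKs])
  have Z\<rho>: "(\<lambda>n. \<integral>\<^sup>+ z. ennreal (\<bar>Zs n z - Z z\<bar> powr \<rho>) \<partial>(unif \<Otimes>\<^sub>M unif)) \<longlonglongrightarrow> 0"
  proof (rule unif2.Lp_convergence_if_norm_convergence[OF \<rho> mZs mZ])
    show "(\<lambda>n. \<integral>\<^sup>+ z. ennreal (min 1 \<bar>Zs n z - Z z\<bar>) \<partial>(unif \<Otimes>\<^sub>M unif)) \<longlonglongrightarrow> 0"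
    proof (rule tendsto_zero_le)
      show "(\<lambda>n. (\<integral>\<^sup>+ u. L1_dist unif (Ys n u) (Y u) \<partial>unif) + (\<integral>\<^sup>+ y. D n y \<partial>lborel)) \<longlonglongrightarrow> 0"
        using tendsto_add[OF Y1 int_D] by simp
      have "(\<integral>\<^sup>+ z. ennreal (min 1 \<bar>Zs n z - Z z\<bar>) \<partial>(unif \<Otimes>\<^sub>M unif))
        \<le> (L1_dist (unif \<Otimes>\<^sub>M unif) (Zs n) Z)" for n
        by (intro nn_integral_mono ennreal_leI) auto
      then show "(\<integral>\<^sup>+ z. ennreal (min 1 \<bar>Zs n z - Z z\<bar>) \<partial>(unif \<Otimes>\<^sub>M unif))
        \<le> (\<integral>\<^sup>+ u. L1_dist unif (Ys n u) (Y u) \<partial>unif) + (\<integral>\<^sup>+ y. D n y \<partial>lborel)" for n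
        using Z_diff[of n] by (rule order_trans)
    qed
  qed (use Y\<rho> Y\<rho>fin in \<open>simp_all add: mom_Z mom_Zs\<close>)
  have eq: "(\<integral>\<^sup>+ z. ennreal (\<bar>Zs n z - Z z\<bar> powr \<rho>) \<partial>(unif \<Otimes>\<^sub>M unif)) = (\<integral>\<^sup>+ u. \<integral>\<^sup>+ v.
      ennreal (\<bar>quantile (Ks n (quantile (\<mu>s n) u)) v - quantile (K (quantile \<mu> u)) v\<bar> powr \<rho>) \<partial>unif \<partial>unif)" for n
  proof -
    have "(\<integral>\<^sup>+ z. ennreal (\<bar>Zs n z - Z z\<bar> powr \<rho>) \<partial>(unif \<Otimes>\<^sub>M unif))
        = (\<integral>\<^sup>+ u. \<integral>\<^sup>+ v. ennreal (\<bar>Zs n (u, v) - Z (u, v)\<bar> powr \<rho>) \<partial>unif \<partial>unif)"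
      by (subst unif.nn_integral_fst[symmetric]) auto
    then show ?thesis by (simp add: Zs_def Z_def)
  qed
  show ?thesis
  proof (rule tendsto_zero_le)
    show "(\<lambda>n. epowr ((\<integral>\<^sup>+ u. ennreal (\<bar>quantile (\<mu>s n) u - quantile \<mu> u\<bar> powr \<rho>) \<partial>unif)
        + (\<integral>\<^sup>+ z. ennreal (\<bar>Zs n z - Z z\<bar> powr \<rho>) \<partial>(unif \<Otimes>\<^sub>M unif))) (1 / \<rho>)) \<longlonglongrightarrow> 0"
      using \<rho> tendsto_add[OF Q\<rho> Z\<rho>] by (intro tendsto_epowr_zero) auto
    show "adapted_wasserstein \<rho> (lift_law (\<mu>s n) (Ys n)) (lift_law \<mu> Y)
      \<le> epowr ((\<integral>\<^sup>+ u. ennreal (\<bar>quantile (\<mu>s n) u - quantile \<mu> u\<bar> powr \<rho>) \<partial>unif)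
        + (\<integral>\<^sup>+ z. ennreal (\<bar>Zs n z - Z z\<bar> powr \<rho>) \<partial>(unif \<Otimes>\<^sub>M unif))) (1 / \<rho>)" for n
      using adapted_wasserstein_le_quantile[OF _ \<mu>s \<mu> Ys Y, of \<rho> n n] \<rho> unfolding eq Ks_def K_def by simp
  qed
qed

section \<open>Primitives of densities on the unit interval\<close>

lemma integrable_indicator_mult:
  assumes "integrable unif g"
  shows "integrable unif (\<lambda>v. indicator {..u::real} v * g v :: real)"
proof (rule Bochner_Integration.integrable_bound[OF assms])
  have "(\<lambda>v. indicator {..u} v :: real) \<in> borel_measurable unif" by (rule measurable_unif) simp
  then show "(\<lambda>v. indicator {..u} v * g v :: real) \<in> borel_measurable unif" using assms by auto
qed (auto split: split_indicator)

definition prim :: "(real \<Rightarrow> real) \<Rightarrow> real \<Rightarrow> real" where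
  "prim g u = (LINT v:{0<..<u}|lborel. g v)"

text \<open>The last assumption holds for the positive part of a difference of left-continuous monotone
  functions. It makes the primitive strictly increasing to the left of every point of positive
  density, so that the generalised inverse recovers each such point and not only almost all of
  them.\<close>
locale unif_density =
  fixes g :: "real \<Rightarrow> real"
  assumes g_measurable [measurable]: "g \<in> borel_measurable borel"
    and g_nonneg: "0 \<le> g u"
    and g_integrable: "integrable unif g"
    and g_left_open: "\<And>u. 0 < u \<Longrightarrow> u < 1 \<Longrightarrow> 0 < g u \<Longrightarrow>
      \<exists>s. 0 < s \<and> s < u \<and> (\<forall>t. s < t \<and> t \<le> u \<longrightarrow> 0 < g t)"
begin

text \<open>This measure has no atoms and its distribution function is the primitive, which thereby
  inherits monotonicity and continuity.\<close>
definition M :: "real measure" where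
  "M = distr (density unif (\<lambda>u. ennreal (g u))) borel (\<lambda>u. u)"

lemma g_measurable_unif [measurable]: "g \<in> borel_measurable unif"
  by (rule measurable_unif) measurable

lemma nn_integral_M:
  assumes [measurable]: "f \<in> borel_measurable borel"
  shows "(\<integral>\<^sup>+ u. f u \<partial>M) = (\<integral>\<^sup>+ u. ennreal (g u) * f u \<partial>unif)"
proof -
  have [measurable]: "f \<in> borel_measurable unif" by (rule measurable_unif) measurable
  have "(\<lambda>u. u) \<in> density unif (\<lambda>u. ennreal (g u)) \<rightarrow>\<^sub>M borel"
    using measurable_unif_ident by simp
  then have "(\<integral>\<^sup>+ u. f u \<partial>M) = (\<integral>\<^sup>+ u. f u \<partial>density unif (\<lambda>u. ennreal (g u)))"
    unfolding M_def by (subst nn_integral_distr) auto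
  also have "\<dots> = (\<integral>\<^sup>+ u. ennreal (g u) * f u \<partial>unif)"
    by (rule nn_integral_density) auto
  finally show ?thesis .
qed

lemma emeasure_M: "A \<in> sets borel \<Longrightarrow> emeasure M A = (\<integral>\<^sup>+ u. ennreal (g u) * indicator A u \<partial>unif)"
  using nn_integral_M[of "indicator A"] by (simp add: M_def)

lemma finite_borel_measure_M: "finite_borel_measure M"
proof (intro finite_borel_measure.intro finite_measureI finite_borel_measure_axioms.intro)
  have "emeasure M (space M) = (\<integral>\<^sup>+ u. ennreal (g u) \<partial>unif)"
    using emeasure_M[of UNIV] by (simp add: M_def)
  also have "\<dots> < \<top>"
    using g_integrable g_nonneg by (simp add: integrable_iff_bounded)
  finally show "emeasure M (space M) \<noteq> \<infinity>" by auto
  show "sets M = sets borel" by (simp add: M_def)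
qed

sublocale M: finite_borel_measure M
  by (rule finite_borel_measure_M)

lemma measure_M_singleton: "measure M {x} = 0"
proof -
  have "emeasure M {x} = (\<integral>\<^sup>+ u. ennreal (g u) * indicator {x} u \<partial>unif)"
    by (rule emeasure_M) simp
  also have "\<dots> = (\<integral>\<^sup>+ u. 0 \<partial>unif)"
  proof (rule nn_integral_cong_AE)
    show "AE u in unif. ennreal (g u) * indicator {x} u = 0"
      by (rule AE_unif_countable[of "{x}"]) auto
  qed
  finally show ?thesis by (simp add: measure_def)
qed

lemma cdf_M_eq_prim:
  assumes "0 \<le> u" "u \<le> 1"
  shows "cdf M u = prim g u"
proof -
  have "measure M ({..<u} \<union> {u}) = measure M {..<u} + measure M {u}"
    by (intro M.finite_measure_Union) auto
  moreover have "{..<u} \<union> {u} = {..u}" by auto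
  ultimately have 1: "cdf M u = measure M {..<u}" by (simp add: cdf_def measure_M_singleton)
  have "prim g u = (\<integral>v. indicator {0<..<u} v * g v \<partial>lborel)"
    by (simp add: prim_def set_lebesgue_integral_def)
  also have "\<dots> = enn2real (\<integral>\<^sup>+ v. ennreal (indicator {0<..<u} v * g v) \<partial>lborel)"
    using g_nonneg by (intro integral_eq_nn_integral AE_I2) auto
  also have "(\<integral>\<^sup>+ v. ennreal (indicator {0<..<u} v * g v) \<partial>lborel)
      = (\<integral>\<^sup>+ v. ennreal (g v) * indicator {..<u} v * indicator {0<..<1} v \<partial>lborel)"
    using assms by (intro nn_integral_cong) (auto split: split_indicator)
  also have "\<dots> = emeasure M {..<u}" by (simp add: nn_integral_unif emeasure_M)
  finally show ?thesis using 1 by (simp add: measure_def)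
qed

lemma prim_0 [simp]: "prim g 0 = 0" by (simp add: prim_def set_lebesgue_integral_def)

lemma prim_mono: "0 \<le> u \<Longrightarrow> u \<le> v \<Longrightarrow> v \<le> 1 \<Longrightarrow> prim g u \<le> prim g v"
  using M.cdf_nondecreasing[of u v] by (simp add: cdf_M_eq_prim)

lemma prim_nonneg: "0 \<le> u \<Longrightarrow> u \<le> 1 \<Longrightarrow> 0 \<le> prim g u"
  using prim_mono[of 0 u] by simp

lemma continuous_on_prim: "continuous_on {0..1} (prim g)"
proof (rule continuous_on_eq)
  show "continuous_on {0..1} (cdf M)"
    using M.isCont_cdf measure_M_singleton by (intro continuous_at_imp_continuous_on) auto
qed (auto simp: cdf_M_eq_prim)

lemma prim_eq_integral: "0 \<le> u \<Longrightarrow> u \<le> 1 \<Longrightarrow> prim g u = (\<integral>v. indicator {..u} v * g v \<partial>unif)"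
proof -
  assume u: "0 \<le> u" "u \<le> 1"
  have "prim g u = enn2real (emeasure M {..u})" using cdf_M_eq_prim[OF u] by (simp add: cdf_def measure_def)
  also have "emeasure M {..u} = (\<integral>\<^sup>+ v. ennreal (indicator {..u} v * g v) \<partial>unif)"
    by (subst emeasure_M) (auto intro!: nn_integral_cong split: split_indicator)
  also have "enn2real \<dots> = (\<integral>v. indicator {..u} v * g v \<partial>unif)"
    using g_nonneg by (intro integral_eq_nn_integral[symmetric] AE_I2) auto
  finally show ?thesis .
qed

lemma prim_less:
  assumes u: "0 < u" "u < 1" "0 < g u" and s: "0 \<le> s" "s < u"
  shows "prim g s < prim g u"
proof -
  obtain r where r: "0 < r" "r < u" "\<And>t. r < t \<Longrightarrow> t \<le> u \<Longrightarrow> 0 < g t"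
    using g_left_open[OF u] by blast
  define m where "m = max r s"
  have m: "0 < m" "m < u" "s \<le> m" using r s by (auto simp: m_def)
  have "prim g u - prim g m = measure M {m<..u}"
    using M.cdf_diff_eq[of m u] m u by (simp add: cdf_M_eq_prim)
  moreover have "measure M {m<..u} \<noteq> 0"
  proof
    assume "measure M {m<..u} = 0"
    then have "emeasure M {m<..u} = 0" by (simp add: M.emeasure_eq_measure)
    then have "(\<integral>\<^sup>+ v. ennreal (g v) * indicator {m<..u} v \<partial>unif) = 0" by (simp add: emeasure_M)
    then have "AE v in unif. ennreal (g v) * indicator {m<..u} v = 0"
      by (subst (asm) nn_integral_0_iff_AE) auto
    then have "AE v in unif. v \<notin> {m<..u}"
    proof eventually_elim
      case (elim v)
      then show ?case using r(3)[of v] by (auto simp: m_def split: split_indicator_asm)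
    qed
    then have "AE v in lborel. v \<in> {0<..<1} \<longrightarrow> v \<notin> {m<..u}"
      unfolding unif_def by (subst (asm) AE_restrict_space_iff) auto
    then have "AE v in lborel. v \<notin> {m<..u}"
      by eventually_elim (use m u in auto)
    then have "emeasure lborel {m<..u} = 0" by (subst (asm) AE_iff_measurable[of "{m<..u}"]) auto
    then show False using m by simp
  qed
  ultimately have "prim g m < prim g u"
    using measure_nonneg[of M "{m<..u}"] by linarith
  moreover have "prim g s \<le> prim g m" using m s u by (intro prim_mono) auto
  ultimately show ?thesis by simp
qed

lemma prim_less_imp_pos:
  assumes "0 \<le> s" "s \<le> v" "v \<le> 1" "prim g s < prim g v"
  shows "\<exists>t. s < t \<and> t \<le> v \<and> 0 < g t"
proof (rule ccontr)
  assume no: "\<not> ?thesis"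
  have g0: "g t = 0" if "s < t" "t \<le> v" for t
    using no that g_nonneg[of t] by (auto simp: less_le)
  have "s < v" using assms by (auto simp: less_le)
  then have "prim g v - prim g s = measure M {s<..v}"
    using M.cdf_diff_eq[of s v] assms by (simp add: cdf_M_eq_prim)
  moreover have "(\<integral>\<^sup>+ u. ennreal (g u) * indicator {s<..v} u \<partial>unif) = (\<integral>\<^sup>+ u. 0 \<partial>unif)"
    by (rule nn_integral_cong) (simp add: g0 split: split_indicator)
  then have "emeasure M {s<..v} = 0" by (simp add: emeasure_M)
  ultimately show False using assms(4) by (simp add: measure_def)
qed

lemma left_inverse01_lower:
  assumes "w \<le> prim g r" "0 \<le> r" "r \<le> 1"
  shows "left_inverse01 (prim g) w \<le> r"
  unfolding left_inverse01_def using assms by (intro cInf_lower bdd_belowI[of _ 0]) auto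

lemma left_inverse01_prim:
  assumes "0 < u" "u < 1" "0 < g u"
  shows "left_inverse01 (prim g) (prim g u) = u"
  unfolding left_inverse01_def
proof (rule cInf_eq_minimum)
  show "u \<in> {r \<in> {0..1}. prim g u \<le> prim g r}" using assms by auto
  show "u \<le> r" if "r \<in> {r \<in> {0..1}. prim g u \<le> prim g r}" for r
    using prim_less[OF assms, of r] that by (auto simp: not_less[symmetric])
qed

lemma left_inverse01_level:
  assumes w: "0 < w" "w < prim g 1"
  defines "b \<equiv> left_inverse01 (prim g) w"
  shows "0 < b" "b < 1" "prim g b = w" "\<And>s. 0 \<le> s \<Longrightarrow> s < b \<Longrightarrow> prim g s < w"
proof -
  obtain x where x: "0 \<le> x" "x \<le> 1" "prim g x = w"
    using IVT'[of "prim g" 0 w 1] w continuous_on_prim by auto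
  let ?S = "{r \<in> {0..1}. w \<le> prim g r}"
  have b_le: "b \<le> r" if "r \<in> ?S" for r
    unfolding b_def using that by (intro left_inverse01_lower) auto
  have "closed ?S"
    using continuous_closed_preimage[OF continuous_on_prim, of "{w..}"] by (simp add: vimage_def Int_def)
  then have bS: "b \<in> ?S"
    unfolding b_def left_inverse01_def using x by (intro closed_contains_Inf bdd_belowI[of _ 0]) auto
  show less: "prim g s < w" if "0 \<le> s" "s < b" for s
    using b_le[of s] that bS by (auto simp: not_less[symmetric])
  show "prim g b = w"
  proof (rule antisym)
    have "b \<le> x" using x by (intro b_le) auto
    then show "prim g b \<le> w" using prim_mono[of b x] bS x by auto
  qed (use bS in auto)
  then show "0 < b" "b < 1" using bS w by (auto simp: less_le)
qed

text \<open>To the left of the limit the primitive is below \<open>w\<close>, and to the right of it the primitive is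
  above \<open>w\<close>, since there is no flat piece at that level. Both strict inequalities persist along
  the sequence.\<close>
lemma left_inverse01_tendsto:
  fixes Gs :: "nat \<Rightarrow> real \<Rightarrow> real" and ws :: "nat \<Rightarrow> real"
  assumes w: "0 < w" "w < prim g 1" and ws: "ws \<longlonglongrightarrow> w"
    and notflat: "\<And>v. left_inverse01 (prim g) w < v \<Longrightarrow> v \<le> 1 \<Longrightarrow> w < prim g v"
    and Gs: "\<And>u. 0 \<le> u \<Longrightarrow> u \<le> 1 \<Longrightarrow> (\<lambda>n. Gs n u) \<longlonglongrightarrow> prim g u"
    and mono: "\<And>n u v. 0 \<le> u \<Longrightarrow> u \<le> v \<Longrightarrow> v \<le> 1 \<Longrightarrow> Gs n u \<le> Gs n v"
  shows "(\<lambda>n. left_inverse01 (Gs n) (ws n)) \<longlonglongrightarrow> left_inverse01 (prim g) w"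
proof -
  define b where "b = left_inverse01 (prim g) w"
  note b = left_inverse01_level[OF w, folded b_def]
  have up: "\<forall>\<^sub>F n in sequentially. left_inverse01 (Gs n) (ws n) \<le> v" if v: "b < v" "v \<le> 1" for v
  proof -
    have "(\<lambda>n. Gs n v - ws n) \<longlonglongrightarrow> prim g v - w" using v b by (intro tendsto_diff Gs ws) auto
    moreover have "0 < prim g v - w" using notflat[of v] v by (simp add: b_def)
    ultimately have "\<forall>\<^sub>F n in sequentially. 0 < Gs n v - ws n" by (rule order_tendstoD(1))
    then show ?thesis
    proof eventually_elim
      case (elim n)
      then show ?case unfolding left_inverse01_def using v b
        by (intro cInf_lower bdd_belowI[of _ 0]) auto
    qed
  qed
  have lo: "\<forall>\<^sub>F n in sequentially. s \<le> left_inverse01 (Gs n) (ws n)" if s: "0 \<le> s" "s < b" for s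
  proof -
    have "(\<lambda>n. ws n - Gs n s) \<longlonglongrightarrow> w - prim g s" using s b by (intro tendsto_diff Gs ws) auto
    moreover have "0 < w - prim g s" using b(4)[OF s] by simp
    ultimately have 1: "\<forall>\<^sub>F n in sequentially. 0 < ws n - Gs n s" by (rule order_tendstoD(1))
    have "(\<lambda>n. Gs n 1 - ws n) \<longlonglongrightarrow> prim g 1 - w" by (intro tendsto_diff Gs ws) auto
    moreover have "0 < prim g 1 - w" using w by simp
    ultimately have 2: "\<forall>\<^sub>F n in sequentially. 0 < Gs n 1 - ws n" by (rule order_tendstoD(1))
    from 1 2 show ?thesis
    proof eventually_elim
      case (elim n)
      show ?case unfolding left_inverse01_def
      proof (rule cInf_greatest)
        show "{r \<in> {0..1}. ws n \<le> Gs n r} \<noteq> {}" using elim by (auto intro!: exI[of _ 1])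
        show "s \<le> r" if "r \<in> {r \<in> {0..1}. ws n \<le> Gs n r}" for r
          using mono[of r s n] that elim s b by (auto simp: not_le[symmetric] intro: ccontr)
      qed
    qed
  qed
  show ?thesis unfolding b_def[symmetric]
  proof (rule order_tendstoI)
    fix a assume a: "a < b"
    have "\<forall>\<^sub>F n in sequentially. max 0 ((max 0 a + b) / 2) \<le> left_inverse01 (Gs n) (ws n)"
      using a b by (intro lo) auto
    then show "\<forall>\<^sub>F n in sequentially. a < left_inverse01 (Gs n) (ws n)"
      by eventually_elim (use a b in auto)
  next
    fix a assume a: "b < a"
    have "\<forall>\<^sub>F n in sequentially. left_inverse01 (Gs n) (ws n) \<le> (min 1 a + b) / 2"
      using a b by (intro up) auto
    then show "\<forall>\<^sub>F n in sequentially. left_inverse01 (Gs n) (ws n) < a"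
      by eventually_elim (use a b in auto)
  qed
qed

text \<open>A flat piece contains a rational point, so that only countably many levels are flat.\<close>
lemma not_flat_level:
  assumes w: "0 < w" "w < prim g 1" and notin: "w \<notin> prim g ` \<rat>"
    and v: "left_inverse01 (prim g) w < v" "v \<le> 1"
  shows "w < prim g v"
proof (rule ccontr)
  assume "\<not> w < prim g v"
  note b = left_inverse01_level[OF w]
  obtain r where r: "r \<in> \<rat>" "left_inverse01 (prim g) w < r" "r < v"
    using Rats_dense_in_real[OF v(1)] by blast
  have "prim g r \<le> prim g v" "prim g (left_inverse01 (prim g) w) \<le> prim g r"
    using r v b(1,2) by (auto intro!: prim_mono)
  then have "prim g r = w" using b(3) \<open>\<not> w < prim g v\<close> by linarith
  then show False using r(1) notin by auto
qed

lemma inj_on_prim: "inj_on (prim g) {u \<in> {0<..<1}. 0 < g u}"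
proof (rule inj_onI)
  fix u v assume "u \<in> {u \<in> {0<..<1}. 0 < g u}" "v \<in> {u \<in> {0<..<1}. 0 < g u}" "prim g u = prim g v"
  then show "u = v" using prim_less[of u v] prim_less[of v u] by (cases u v rule: linorder_cases) auto
qed

lemma countable_prim_levels:
  assumes "countable S"
  shows "countable {u \<in> {0<..<1}. 0 < g u \<and> prim g u \<in> S}"
proof (rule countable_image_inj_on)
  show "countable (prim g ` {u \<in> {0<..<1}. 0 < g u \<and> prim g u \<in> S})"
    using assms by (rule countable_subset[rotated]) auto
  show "inj_on (prim g) {u \<in> {0<..<1}. 0 < g u \<and> prim g u \<in> S}"
    by (rule inj_on_subset[OF inj_on_prim]) auto
qed

lemma borel_measurable_prim: "prim g \<in> borel_measurable borel"
  unfolding prim_def[abs_def] set_lebesgue_integral_def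
proof (rule lborel.borel_measurable_lebesgue_integral)
  have "(\<lambda>(u, v). indicator {0<..<u} v *\<^sub>R g v) = (\<lambda>z. if 0 < snd z \<and> snd z < fst z then g (snd z) else 0)"
    by (auto split: split_indicator)
  also have "\<dots> \<in> borel_measurable (borel \<Otimes>\<^sub>M lborel)"
  proof -
    have [measurable]: "(\<lambda>z. g (snd z)) \<in> borel_measurable (borel \<Otimes>\<^sub>M lborel)"
      by (rule measurable_compose[OF measurable_snd]) simp
    have "(\<lambda>z. snd z) \<in> (borel :: real measure) \<Otimes>\<^sub>M lborel \<rightarrow>\<^sub>M (borel :: real measure)"
      by (rule measurable_compose[OF measurable_snd]) simp
    then show ?thesis by measurable
  qed
  finally show "(\<lambda>(u, v). indicator {0<..<u} v *\<^sub>R g v) \<in> borel_measurable (borel \<Otimes>\<^sub>M lborel)" .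
qed

lemma borel_measurable_left_inverse01: "left_inverse01 (prim g) \<in> borel_measurable borel"
proof (rule borel_measurable_piecewise_mono[of "{{..prim g 1}, {prim g 1<..}}"])
  fix c assume "c \<in> {{..prim g 1}, {prim g 1<..}}"
  then show "mono_on c (left_inverse01 (prim g))"
  proof (elim insertE emptyE)
    assume c: "c = {..prim g 1}"
    show ?thesis unfolding c
    proof (rule mono_onI)
      fix r s assume "r \<in> {..prim g 1}" "s \<in> {..prim g 1}" "r \<le> s"
      then show "left_inverse01 (prim g) r \<le> left_inverse01 (prim g) s"
        unfolding left_inverse01_def
        by (intro cInf_superset_mono) (auto intro!: exI[of _ 1] bdd_belowI[of _ 0])
    qed
  next
    assume c: "c = {prim g 1<..}"
    have "{r \<in> {0..1}. w \<le> prim g r} = {}" if "w > prim g 1" for w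
      using that prim_mono[of _ 1] by (auto simp: not_le[symmetric] dest: order_trans)
    then have "left_inverse01 (prim g) w = Inf {}" if "w > prim g 1" for w
      using that by (simp only: left_inverse01_def)
    then show ?thesis unfolding c by (intro mono_onI) simp
  qed
next
  show "\<Union> {{..prim g 1}, {prim g 1<..}} = UNIV" by (auto simp: not_le)
qed auto

text \<open>After normalisation, the measure with density \<open>g\<close> is a probability measure \<open>N\<close> without
  atoms, and \<open>cdf N (quantile N v) = v\<close>. The substitution is the representation of \<open>N\<close> as the law
  of \<open>quantile N v\<close> for uniform \<open>v\<close>.\<close>
lemma nn_integral_prim_substitution:
  assumes H: "H \<in> borel_measurable borel"
  shows "(\<integral>\<^sup>+ u. ennreal (g u) * H (prim g u) \<partial>unif)
    = ennreal (prim g 1) * (\<integral>\<^sup>+ v. H (prim g 1 * v) \<partial>unif)"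
proof -
  define c where "c = prim g 1"
  have c0: "0 \<le> c" unfolding c_def by (rule prim_nonneg) auto
  have total: "emeasure M UNIV = ennreal c"
  proof -
    have "emeasure M UNIV = emeasure M {..1}"
      by (simp add: emeasure_M) (intro nn_integral_cong, auto)
    also have "\<dots> = ennreal c" using cdf_M_eq_prim[of 1] by (simp add: cdf_def c_def M.emeasure_eq_measure)
    finally show ?thesis .
  qed
  show ?thesis
  proof (cases "c = 0")
    case True
    then have "(\<integral>\<^sup>+ u. ennreal (g u) \<partial>unif) = 0" using total emeasure_M[of UNIV] by simp
    then have "AE u in unif. ennreal (g u) = 0" by (subst (asm) nn_integral_0_iff_AE) auto
    then have "AE u in unif. ennreal (g u) * H (prim g u) = 0"
      by eventually_elim simp
    then have "(\<integral>\<^sup>+ u. ennreal (g u) * H (prim g u) \<partial>unif) = (\<integral>\<^sup>+ u. 0 \<partial>unif)"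
      by (rule nn_integral_cong_AE)
    then show ?thesis using True by (simp add: c_def)
  next
    case False
    then have c: "c > 0" using c0 by simp
    define N where "N = scale_measure (ennreal (1 / c)) M"
    have sN: "sets N = sets borel" by (simp add: N_def M.M_is_borel)
    have N: "real_distribution N"
    proof (intro real_distribution.intro prob_spaceI real_distribution_axioms.intro)
      show "emeasure N (space N) = 1"
        using c by (simp add: N_def space_scale_measure M.borel_UNIV total ennreal_mult'[symmetric])
    qed (rule sN)
    have measN: "measure N A = measure M A / c" for A
      using c by (simp add: N_def measure_scale_measure)
    have cdfN: "cdf N (quantile N v) = v" if v: "0 < v" "v < 1" for v
    proof (rule antisym)
      show "v \<le> cdf N (quantile N v)" by (rule le_cdf_quantile[OF N v])
      have "cdf N (quantile N v) = measure N {..<quantile N v}"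
        by (simp add: cdf_eq_lessThan_plus_atom[OF N] measN measure_M_singleton)
      then show "cdf N (quantile N v) \<le> v" using measure_lessThan_le_quantile[OF N v] by simp
    qed
    have Hm: "(\<lambda>u. H (cdf M u)) \<in> borel_measurable borel"
      using measurable_compose[OF borel_measurable_mono[of "cdf M"] H] M.cdf_nondecreasing by (auto simp: mono_def)
    have "(\<integral>\<^sup>+ u. ennreal (g u) * H (prim g u) \<partial>unif) = (\<integral>\<^sup>+ u. ennreal (g u) * H (cdf M u) \<partial>unif)"
      by (intro nn_integral_cong) (simp add: cdf_M_eq_prim)
    also have "\<dots> = (\<integral>\<^sup>+ u. H (cdf M u) \<partial>M)" by (rule nn_integral_M[OF Hm, symmetric])
    also have "\<dots> = ennreal c * (ennreal (1 / c) * (\<integral>\<^sup>+ u. H (cdf M u) \<partial>M))"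
      using c by (simp add: mult.assoc[symmetric] ennreal_mult'[symmetric])
    also have "ennreal (1 / c) * (\<integral>\<^sup>+ u. H (cdf M u) \<partial>M) = (\<integral>\<^sup>+ u. H (cdf M u) \<partial>N)"
      unfolding N_def using Hm by (subst nn_integral_scale_measure) (auto simp: measurable_cong_sets[OF M.M_is_borel refl])
    also have "\<dots> = (\<integral>\<^sup>+ u. H (cdf M u) \<partial>distr unif borel (quantile N))" by (simp add: distr_quantile[OF N])
    also have "\<dots> = (\<integral>\<^sup>+ v. H (cdf M (quantile N v)) \<partial>unif)"
      using Hm by (intro nn_integral_distr measurable_unif borel_measurable_quantile[OF N]) auto
    also have "\<dots> = (\<integral>\<^sup>+ v. H (c * v) \<partial>unif)"
    proof (rule nn_integral_cong)
      fix v assume "v \<in> space unif"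
      then have "cdf N (quantile N v) = v" by (intro cdfN) auto
      then have "cdf M (quantile N v) = c * v" using c by (simp add: cdf_def measN field_simps)
      then show "H (cdf M (quantile N v)) = H (c * v)" by simp
    qed
    finally show ?thesis by (simp add: c_def)
  qed
qed

end

section \<open>The inverse transform martingale coupling as a lifted law\<close>

definition pos_gap :: "real measure \<Rightarrow> real measure \<Rightarrow> real \<Rightarrow> real" where
  "pos_gap \<mu> \<nu> v = max 0 (quantile \<mu> v - quantile \<nu> v)"

definition neg_gap :: "real measure \<Rightarrow> real measure \<Rightarrow> real \<Rightarrow> real" where
  "neg_gap \<mu> \<nu> v = max 0 (- (quantile \<mu> v - quantile \<nu> v))"

lemma Psi_plus_eq_prim: "Psi_plus \<mu> \<nu> = prim (pos_gap \<mu> \<nu>)"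
  by (rule ext) (simp add: Psi_plus_def prim_def pos_gap_def)

lemma Psi_minus_eq_prim: "Psi_minus \<mu> \<nu> = prim (neg_gap \<mu> \<nu>)"
  by (rule ext) (simp add: Psi_minus_def prim_def neg_gap_def)

text \<open>A random variable of \<open>v\<close> with law \<open>IT_kernel \<mu> \<nu> u\<close>.\<close>
definition IT_lift :: "real measure \<Rightarrow> real measure \<Rightarrow> real \<Rightarrow> real \<Rightarrow> real" where
  "IT_lift \<mu> \<nu> u v = (if v < IT_p \<mu> \<nu> u then quantile \<nu> (IT_phi \<mu> \<nu> u) else quantile \<nu> u)"

lemma nn_integral_unif_two_values:
  assumes "0 \<le> p" "p \<le> 1"
  shows "(\<integral>\<^sup>+ v. (if v < p then a else b) \<partial>unif) = ennreal p * a + ennreal (1 - p) * b"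
proof -
  have 1: "(\<integral>\<^sup>+ v. indicator {..p} v \<partial>unif) = ennreal p" by (rule nn_integral_unif_indicator_le[OF assms])
  have 2: "(\<integral>\<^sup>+ v. indicator {p<..} v \<partial>unif) = ennreal (1 - p)"
  proof -
    have "(\<integral>\<^sup>+ v. indicator {p<..} v \<partial>unif) = (\<integral>\<^sup>+ v. ennreal \<bar>indicator {v..} 1 - indicator {v..} p\<bar> \<partial>unif)"
      by (intro nn_integral_cong) (auto split: split_indicator)
    also have "\<dots> = ennreal (1 - p)" using assms by (subst nn_integral_unif_indicator_diff) auto
    finally show ?thesis .
  qed
  have "(\<integral>\<^sup>+ v. (if v < p then a else b) \<partial>unif) = (\<integral>\<^sup>+ v. indicator {..p} v * a + indicator {p<..} v * b \<partial>unif)"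
  proof (rule nn_integral_cong_AE, rule AE_unif_countable[of "{p}"])
    fix v assume "v \<notin> {p}"
    then show "(if v < p then a else b) = indicator {..p} v * a + indicator {p<..} v * b"
      by (cases "v < p") auto
  qed simp
  also have "\<dots> = (\<integral>\<^sup>+ v. indicator {..p} v * a \<partial>unif) + (\<integral>\<^sup>+ v. indicator {p<..} v * b \<partial>unif)"
    by (rule nn_integral_add) (auto intro!: measurable_unif)
  also have "\<dots> = ennreal p * a + ennreal (1 - p) * b"
  proof -
    have m: "(\<lambda>v. indicator {..p} v :: ennreal) \<in> borel_measurable unif"
      "(\<lambda>v. indicator {p<..} v :: ennreal) \<in> borel_measurable unif"
      by (auto intro!: measurable_unif)
    show ?thesis by (simp only: nn_integral_multc[OF m(1)] nn_integral_multc[OF m(2)] 1 2)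
  qed
  finally show ?thesis .
qed

text \<open>Comparing \<open>p\<close> with a uniform variable truncates \<open>p\<close> to the unit interval in the same way as
  \<open>bernoulli_pmf\<close> does.\<close>
lemma two_point_eq_distr:
  "two_point p a b = distr unif borel (\<lambda>v. if v < p then a else b)"
proof (rule measure_eqI)
  define p' where "p' = min 1 (max 0 p)"
  have p': "0 \<le> p'" "p' \<le> 1" by (auto simp: p'_def)
  have "bernoulli_pmf p = bernoulli_pmf p'"
    by (rule pmf_eqI) (simp add: bernoulli_pmf.rep_eq p'_def)
  then have tp: "two_point p a b = distr (measure_pmf (bernoulli_pmf p')) borel (\<lambda>c. if c then a else b)"
    by (simp add: two_point_def)
  fix A assume "A \<in> sets (two_point p a b)"
  then have [measurable]: "A \<in> sets borel" by (simp add: two_point_def)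
  have [measurable]: "(\<lambda>v. if v < p then a else b) \<in> borel_measurable unif"
    by (rule measurable_unif) measurable
  have "emeasure (two_point p a b) A = (\<integral>\<^sup>+ c. indicator A (if c then a else b) \<partial>measure_pmf (bernoulli_pmf p'))"
    unfolding tp by (subst nn_integral_indicator[symmetric], simp, subst nn_integral_distr) auto
  also have "\<dots> = ennreal p' * indicator A a + ennreal (1 - p') * indicator A b"
    using p' by (simp add: mult.commute)
  also have "\<dots> = (\<integral>\<^sup>+ v. (if v < p' then indicator A a else indicator A b) \<partial>unif)"
    by (rule nn_integral_unif_two_values[OF p', symmetric])
  also have "\<dots> = (\<integral>\<^sup>+ v. indicator A (if v < p then a else b) \<partial>unif)"
    by (intro nn_integral_cong) (auto simp: p'_def)
  also have "\<dots> = emeasure (distr unif borel (\<lambda>v. if v < p then a else b)) A"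
    by (subst nn_integral_indicator[symmetric], simp, subst nn_integral_distr) auto
  finally show "emeasure (two_point p a b) A = emeasure (distr unif borel (\<lambda>v. if v < p then a else b)) A" .
qed (simp add: two_point_def)

locale quantile_pair =
  fixes \<mu> \<nu> :: "real measure"
  assumes \<mu>: "real_distribution \<mu>" and \<nu>: "real_distribution \<nu>"
    and int_\<mu>: "integrable unif (quantile \<mu>)" and int_\<nu>: "integrable unif (quantile \<nu>)"
begin

abbreviation "Q \<equiv> quantile \<mu>"
abbreviation "R \<equiv> quantile \<nu>"
abbreviation "gp \<equiv> pos_gap \<mu> \<nu>"
abbreviation "gn \<equiv> neg_gap \<mu> \<nu>"
abbreviation "\<phi> \<equiv> IT_phi \<mu> \<nu>"
abbreviation "p \<equiv> IT_p \<mu> \<nu>"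

lemma Q_measurable [measurable]: "Q \<in> borel_measurable borel"
  by (rule borel_measurable_quantile[OF \<mu>])

lemma R_measurable [measurable]: "R \<in> borel_measurable borel"
  by (rule borel_measurable_quantile[OF \<nu>])

lemma Q_mono: "0 < s \<Longrightarrow> s \<le> t \<Longrightarrow> t < 1 \<Longrightarrow> Q s \<le> Q t"
  using mono_onD[OF mono_on_quantile[OF \<mu>], of s t] by simp

lemma R_mono: "0 < s \<Longrightarrow> s \<le> t \<Longrightarrow> t < 1 \<Longrightarrow> R s \<le> R t"
  using mono_onD[OF mono_on_quantile[OF \<nu>], of s t] by simp

lemma unif_density_pos_gap: "unif_density gp"
proof
  show "gp \<in> borel_measurable borel" unfolding pos_gap_def[abs_def] by measurable
  show "0 \<le> gp u" for u by (simp add: pos_gap_def)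
  show "integrable unif gp" unfolding pos_gap_def[abs_def] using int_\<mu> int_\<nu> by auto
  fix u :: real assume u: "0 < u" "u < 1" "0 < gp u"
  then have "R u < Q u" by (auto simp: pos_gap_def less_max_iff_disj)
  then obtain s where s: "0 < s" "s < u" "\<And>t. s < t \<Longrightarrow> t \<le> u \<Longrightarrow> R u < Q t"
    using quantile_left_continuous[OF \<mu> u(1,2)] by blast
  have "0 < gp t" if "s < t" "t \<le> u" for t
  proof -
    have "R t < Q t" using s(3)[OF that] R_mono[of t u] that s u by linarith
    then show ?thesis by (simp add: pos_gap_def)
  qed
  then show "\<exists>s. 0 < s \<and> s < u \<and> (\<forall>t. s < t \<and> t \<le> u \<longrightarrow> 0 < gp t)" using s by blast
qed

lemma unif_density_neg_gap: "unif_density gn"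
proof -
  have "gn = pos_gap \<nu> \<mu>" by (rule ext) (simp add: neg_gap_def pos_gap_def)
  then show ?thesis
    using quantile_pair.unif_density_pos_gap[OF quantile_pair.intro[OF \<nu> \<mu> int_\<nu> int_\<mu>]] by simp
qed

sublocale P: unif_density "pos_gap \<mu> \<nu>" by (rule unif_density_pos_gap)
sublocale N: unif_density "neg_gap \<mu> \<nu>" by (rule unif_density_neg_gap)

lemma gp_pos_iff: "0 < gp u \<longleftrightarrow> R u < Q u" by (auto simp: pos_gap_def less_max_iff_disj)
lemma gn_pos_iff: "0 < gn u \<longleftrightarrow> Q u < R u" by (auto simp: neg_gap_def less_max_iff_disj)

lemma prim_gap_diff:
  assumes "0 \<le> u" "u \<le> 1"
  shows "prim gp u - prim gn u = (\<integral>v. indicator {..u} v * (Q v - R v) \<partial>unif)"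
proof -
  have "prim gp u - prim gn u = (\<integral>v. indicator {..u} v * gp v - indicator {..u} v * gn v \<partial>unif)"
    using integrable_indicator_mult[OF P.g_integrable] integrable_indicator_mult[OF N.g_integrable]
    by (simp add: P.prim_eq_integral N.prim_eq_integral assms)
  also have "\<dots> = (\<integral>v. indicator {..u} v * (Q v - R v) \<partial>unif)"
    by (intro Bochner_Integration.integral_cong) (auto simp: pos_gap_def neg_gap_def split: split_indicator)
  finally show ?thesis .
qed

end

text \<open>These two properties of the primitives are all that the construction needs from the convex
  order. In contrast to the convex order they pass directly to limits in \<open>L\<^sup>1\<close> of quantile
  functions.\<close>
locale IT_pair = quantile_pair +
  assumes dominated: "\<And>u. 0 \<le> u \<Longrightarrow> u \<le> 1 \<Longrightarrow> prim (neg_gap \<mu> \<nu>) u \<le> prim (pos_gap \<mu> \<nu>) u"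
    and balanced: "prim (neg_gap \<mu> \<nu>) 1 = prim (pos_gap \<mu> \<nu>) 1"
begin

definition c :: real where "c = prim gp 1"

lemma c_eq: "prim gp 1 = c" "prim gn 1 = c"
  by (simp_all add: c_def balanced)

text \<open>To the left of \<open>u\<close> the primitive of \<open>gn\<close> is below that of \<open>gp\<close>, which has not yet reached
  its value at \<open>u\<close>; so \<open>u \<le> \<phi> u\<close>. Equality is impossible, as \<open>gn\<close> vanishes just to the left of
  \<open>u\<close>. Thus \<open>gn\<close> is positive somewhere between \<open>u\<close> and \<open>\<phi> u\<close>, and there \<open>R\<close> exceeds \<open>Q\<close>.\<close>
lemma phi_above:
  assumes u: "0 < u" "u < 1" "R u < Q u" and c: "prim gp u < c"
  shows "\<phi> u = left_inverse01 (prim gn) (prim gp u)" "0 < prim gp u" "0 < \<phi> u" "\<phi> u < 1"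
    "prim gn (\<phi> u) = prim gp u" "Q u < R (\<phi> u)"
proof -
  have gu: "0 < gp u" using u by (simp add: gp_pos_iff)
  define w where "w = prim gp u"
  define v where "v = left_inverse01 (prim gn) w"
  show phi: "\<phi> u = left_inverse01 (prim gn) (prim gp u)"
    using u by (simp add: IT_phi_def Psi_plus_eq_prim Psi_minus_eq_prim)
  show w0: "0 < prim gp u" using P.prim_less[OF u(1,2) gu, of 0] u by simp
  have w: "0 < w" "w < prim gn 1" using w0 c by (auto simp: w_def c_eq)
  note v = N.left_inverse01_level[OF w, folded v_def]
  have phiv: "\<phi> u = v" by (simp add: phi v_def w_def)
  show "0 < \<phi> u" "\<phi> u < 1" "prim gn (\<phi> u) = prim gp u" using v by (simp_all add: phiv w_def)
  have "u \<le> v"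
  proof (rule ccontr)
    assume "\<not> u \<le> v"
    then have "prim gp v < prim gp u" using v by (intro P.prim_less u gu) auto
    then show False using dominated[of v] v by (simp add: w_def)
  qed
  moreover have "u \<noteq> v"
  proof
    assume "u = v"
    obtain s where s: "0 < s" "s < u" "\<And>t. s < t \<Longrightarrow> t \<le> u \<Longrightarrow> 0 < gp t"
      using P.g_left_open[OF u(1,2) gu] by blast
    have "prim gn s < prim gn u" using v(3) v(4)[of s] s \<open>u = v\<close> by simp
    then obtain t where "s < t" "t \<le> u" "0 < gn t"
      using N.prim_less_imp_pos[of s u] s u by auto
    then show False using s(3)[of t] by (simp add: gn_pos_iff gp_pos_iff)
  qed
  ultimately have uv: "u < v" by simp
  have "prim gn u < prim gn v" using v(3) v(4)[of u] uv u by simp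
  then obtain t where t: "u < t" "t \<le> v" "0 < gn t"
    using N.prim_less_imp_pos[of u v] uv u v by auto
  then have "Q u \<le> Q t" "Q t < R t" "R t \<le> R v"
    using Q_mono[of u t] R_mono[of t v] u v by (auto simp: gn_pos_iff)
  then show "Q u < R (\<phi> u)" by (simp add: phiv)
qed

text \<open>Here \<open>\<phi> u \<le> u\<close>, because the primitive of \<open>gp\<close> has reached the level of \<open>u\<close> at \<open>u\<close> already.
  Just to the left of \<open>\<phi> u\<close> this primitive still increases, so \<open>gn\<close> is not positive at \<open>\<phi> u\<close>.\<close>
lemma phi_below:
  assumes u: "0 < u" "u < 1" "Q u < R u" and c: "prim gn u < c"
  shows "\<phi> u = left_inverse01 (prim gp) (prim gn u)" "0 < prim gn u" "0 < \<phi> u" "\<phi> u < 1"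
    "prim gp (\<phi> u) = prim gn u" "R (\<phi> u) \<le> Q u"
proof -
  have gu: "0 < gn u" using u by (simp add: gn_pos_iff)
  define w where "w = prim gn u"
  define v where "v = left_inverse01 (prim gp) w"
  show phi: "\<phi> u = left_inverse01 (prim gp) (prim gn u)"
    using u by (simp add: IT_phi_def Psi_plus_eq_prim Psi_minus_eq_prim)
  show w0: "0 < prim gn u" using N.prim_less[OF u(1,2) gu, of 0] u by simp
  have w: "0 < w" "w < prim gp 1" using w0 c by (auto simp: w_def c_eq)
  note v = P.left_inverse01_level[OF w, folded v_def]
  have phiv: "\<phi> u = v" by (simp add: phi v_def w_def)
  show "0 < \<phi> u" "\<phi> u < 1" "prim gp (\<phi> u) = prim gn u" using v by (simp_all add: phiv w_def)
  have "v \<le> u" unfolding v_def using dominated[of u] u by (intro P.left_inverse01_lower) (auto simp: w_def)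
  have "R v \<le> Q v"
  proof (rule ccontr)
    assume "\<not> R v \<le> Q v"
    then have "0 < gn v" by (simp add: gn_pos_iff)
    then obtain s where s: "0 < s" "s < v" "\<And>t. s < t \<Longrightarrow> t \<le> v \<Longrightarrow> 0 < gn t"
      using N.g_left_open[OF v(1,2)] by blast
    have "prim gp s < prim gp v" using v(3) v(4)[of s] s by simp
    then obtain t where "s < t" "t \<le> v" "0 < gp t"
      using P.prim_less_imp_pos[of s v] s v by auto
    then show False using s(3)[of t] by (simp add: gn_pos_iff gp_pos_iff)
  qed
  also have "Q v \<le> Q u" using \<open>v \<le> u\<close> u v by (intro Q_mono) auto
  finally show "R (\<phi> u) \<le> Q u" by (simp add: phiv)
qed

text \<open>The points whose level is the total mass \<open>c\<close>. Their partner could be the right end of the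
  unit interval, where the quantile function has no meaning. By injectivity of the primitives
  there are at most two of them.\<close>
definition top_level :: "real set" where
  "top_level = {u \<in> {0<..<1}. 0 < gp u \<and> prim gp u \<in> {c}} \<union> {u \<in> {0<..<1}. 0 < gn u \<and> prim gn u \<in> {c}}"

lemma countable_top_level: "countable top_level"
  unfolding top_level_def by (intro countable_Un P.countable_prim_levels N.countable_prim_levels) auto

lemma below_top:
  assumes "0 < u" "u < 1" "u \<notin> top_level"
  shows "R u < Q u \<Longrightarrow> prim gp u < c" "Q u < R u \<Longrightarrow> prim gn u < c"
proof -
  have le: "prim gp u \<le> c" "prim gn u \<le> c"
    using P.prim_mono[of u 1] N.prim_mono[of u 1] assms by (simp_all add: c_eq)
  show "prim gp u < c" if "R u < Q u"
  proof -
    have "prim gp u \<noteq> c" using assms that gp_pos_iff[of u] by (auto simp: top_level_def)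
    then show ?thesis using le by simp
  qed
  show "prim gn u < c" if "Q u < R u"
  proof -
    have "prim gn u \<noteq> c" using assms that gn_pos_iff[of u] by (auto simp: top_level_def)
    then show ?thesis using le by simp
  qed
qed

lemma IT_p_bounds:
  assumes u: "0 < u" "u < 1" "u \<notin> top_level"
  shows "0 \<le> p u" "p u \<le> 1" "p u * (R (\<phi> u) - R u) = Q u - R u"
proof -
  have "0 \<le> p u \<and> p u \<le> 1 \<and> p u * (R (\<phi> u) - R u) = Q u - R u"
  proof (cases "Q u" "R u" rule: linorder_cases)
    case less
    then show ?thesis using phi_below(6)[OF u(1,2) less below_top(2)[OF u less]]
      by (auto simp: IT_p_def divide_simps)
  next
    case greater
    then show ?thesis using phi_above(6)[OF u(1,2) greater below_top(1)[OF u greater]]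
      by (auto simp: IT_p_def divide_simps)
  qed (simp add: IT_p_def)
  then show "0 \<le> p u" "p u \<le> 1" "p u * (R (\<phi> u) - R u) = Q u - R u" by auto
qed

lemma IT_phi_measurable [measurable]: "\<phi> \<in> borel_measurable borel"
proof -
  note [measurable] = P.borel_measurable_prim N.borel_measurable_prim
    P.borel_measurable_left_inverse01 N.borel_measurable_left_inverse01
  show ?thesis
    unfolding IT_phi_def[abs_def] Psi_plus_eq_prim Psi_minus_eq_prim by measurable
qed

lemma IT_p_measurable [measurable]: "p \<in> borel_measurable borel"
  unfolding IT_p_def[abs_def] by measurable

lemma IT_lift_measurable [measurable]:
  "jointly_measurable (IT_lift \<mu> \<nu>)"
  unfolding IT_lift_def by measurable

lemma nn_integral_IT_lift_section:
  assumes u: "0 < u" "u < 1" "u \<notin> top_level"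
  shows "(\<integral>\<^sup>+ v. f (IT_lift \<mu> \<nu> u v) \<partial>unif) = ennreal (p u) * f (R (\<phi> u)) + ennreal (1 - p u) * f (R u)"
  unfolding IT_lift_def using nn_integral_unif_two_values[of "p u" "f (R (\<phi> u))" "f (R u)"] IT_p_bounds[OF u]
  by (simp add: if_distrib)

text \<open>
  The kernel moves the mass \<open>p u\<close> from \<open>R u\<close> to \<open>R (\<phi> u)\<close>, and the claim is that these moves cancel. Let \<open>a\<close>
  and \<open>b\<close> be the inverses of the primitives of \<open>gp\<close> and \<open>gn\<close>. Up to null sets, the points with \<open>gp u > 0\<close> are the \<open>a w\<close>,
  with partner \<open>b w\<close>, and those with \<open>gn u > 0\<close> are the \<open>b w\<close>, with partner \<open>a w\<close>, where \<open>0 < w < c\<close>. In terms of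
  the level \<open>w\<close> the mass that is moved has the density \<open>1 / (R (b w) - R (a w))\<close> in both directions.
\<close>
theorem nn_integral_IT_lift:
  assumes f [measurable]: "f \<in> borel_measurable borel"
  shows "(\<integral>\<^sup>+ u. \<integral>\<^sup>+ v. f (IT_lift \<mu> \<nu> u v) \<partial>unif \<partial>unif) = (\<integral>\<^sup>+ y. f y \<partial>\<nu>)"
proof -
  define a where "a = left_inverse01 (prim gp)"
  define b where "b = left_inverse01 (prim gn)"
  have ma [measurable]: "a \<in> borel_measurable borel" and mb [measurable]: "b \<in> borel_measurable borel"
    unfolding a_def b_def by (rule P.borel_measurable_left_inverse01 N.borel_measurable_left_inverse01)+
  define H where "H g w = ennreal (1 / (R (b w) - R (a w))) * f (R (g w))" for g w
  have H: "H g \<in> borel_measurable borel" if [measurable]: "g \<in> borel_measurable borel" for g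
    unfolding H_def[abs_def] by measurable
  note [measurable] = P.borel_measurable_prim N.borel_measurable_prim
  have key: "ennreal (p u) * f (R (\<phi> u)) = ennreal (gp u) * H b (prim gp u) + ennreal (gn u) * H a (prim gn u)"
    "ennreal (p u) * f (R u) = ennreal (gp u) * H a (prim gp u) + ennreal (gn u) * H b (prim gn u)"
    if u: "0 < u" "u < 1" "u \<notin> top_level" for u
  proof -
    have "ennreal (p u) * f (R (\<phi> u)) = ennreal (gp u) * H b (prim gp u) + ennreal (gn u) * H a (prim gn u)
      \<and> ennreal (p u) * f (R u) = ennreal (gp u) * H a (prim gp u) + ennreal (gn u) * H b (prim gn u)"
    proof (cases "Q u" "R u" rule: linorder_cases)
      case less
      note ph = phi_below[OF u(1,2) less below_top(2)[OF u less]]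
      have gn: "gn u = R u - Q u" "gp u = 0" using less by (auto simp: neg_gap_def pos_gap_def)
      have bu: "b (prim gn u) = u" unfolding b_def using less u by (intro N.left_inverse01_prim) (auto simp: gn_pos_iff)
      have au: "a (prim gn u) = \<phi> u" by (simp add: a_def ph(1))
      have pu: "p u = gn u * (1 / (R u - R (\<phi> u)))"
        using less ph(6) by (simp add: IT_p_def gn divide_simps) (simp add: algebra_simps)
      have "ennreal (p u) = ennreal (gn u) * ennreal (1 / (R u - R (\<phi> u)))"
        unfolding pu using less ph(6) by (intro ennreal_mult) (auto simp: gn)
      then show ?thesis by (simp add: H_def au bu gn(2) mult.assoc)
    next
      case greater
      note ph = phi_above[OF u(1,2) greater below_top(1)[OF u greater]]
      have gn: "gp u = Q u - R u" "gn u = 0" using greater by (auto simp: neg_gap_def pos_gap_def)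
      have au: "a (prim gp u) = u" unfolding a_def using greater u by (intro P.left_inverse01_prim) (auto simp: gp_pos_iff)
      have bu: "b (prim gp u) = \<phi> u" by (simp add: b_def ph(1))
      have pu: "p u = gp u * (1 / (R (\<phi> u) - R u))"
        using greater ph(6) by (simp add: IT_p_def gn)
      have "ennreal (p u) = ennreal (gp u) * ennreal (1 / (R (\<phi> u) - R u))"
        unfolding pu using greater ph(6) by (intro ennreal_mult) (auto simp: gn)
      then show ?thesis by (simp add: H_def au bu gn(2) mult.assoc)
    next
      case equal
      then show ?thesis by (simp add: IT_p_def neg_gap_def pos_gap_def)
    qed
    then show "ennreal (p u) * f (R (\<phi> u)) = ennreal (gp u) * H b (prim gp u) + ennreal (gn u) * H a (prim gn u)"
      "ennreal (p u) * f (R u) = ennreal (gp u) * H a (prim gp u) + ennreal (gn u) * H b (prim gn u)" by auto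
  qed
  have sub: "(\<integral>\<^sup>+ u. ennreal (gp u) * H g (prim gp u) + ennreal (gn u) * H h (prim gn u) \<partial>unif)
      = ennreal c * (\<integral>\<^sup>+ v. H g (c * v) \<partial>unif) + ennreal c * (\<integral>\<^sup>+ v. H h (c * v) \<partial>unif)"
    if [measurable]: "g \<in> borel_measurable borel" "h \<in> borel_measurable borel" for g h
  proof -
    note [measurable] = H[OF that(1)] H[OF that(2)]
    have "(\<lambda>u. ennreal (gp u) * H g (prim gp u)) \<in> borel_measurable borel"
      "(\<lambda>u. ennreal (gn u) * H h (prim gn u)) \<in> borel_measurable borel"
      by measurable
    from this[THEN measurable_unif] show ?thesis
      using P.nn_integral_prim_substitution[OF H[OF that(1)]] N.nn_integral_prim_substitution[OF H[OF that(2)]]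
      by (simp add: nn_integral_add c_eq)
  qed
  have swap: "(\<integral>\<^sup>+ u. ennreal (p u) * f (R (\<phi> u)) \<partial>unif) = (\<integral>\<^sup>+ u. ennreal (p u) * f (R u) \<partial>unif)"
  proof -
    have "(\<integral>\<^sup>+ u. ennreal (p u) * f (R (\<phi> u)) \<partial>unif)
      = (\<integral>\<^sup>+ u. ennreal (gp u) * H b (prim gp u) + ennreal (gn u) * H a (prim gn u) \<partial>unif)"
      by (rule nn_integral_cong_AE, rule AE_unif_countable[OF countable_top_level], rule key(1))
    also have "\<dots> = (\<integral>\<^sup>+ u. ennreal (gp u) * H a (prim gp u) + ennreal (gn u) * H b (prim gn u) \<partial>unif)"
      unfolding sub[OF ma mb] sub[OF mb ma] by (rule add.commute)
    also have "\<dots> = (\<integral>\<^sup>+ u. ennreal (p u) * f (R u) \<partial>unif)"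
      by (rule nn_integral_cong_AE[symmetric], rule AE_unif_countable[OF countable_top_level], rule key(2))
    finally show ?thesis .
  qed
  have m: "(\<lambda>u. ennreal (p u) * f (R (\<phi> u))) \<in> borel_measurable unif"
    "(\<lambda>u. ennreal (p u) * f (R u)) \<in> borel_measurable unif"
    "(\<lambda>u. ennreal (1 - p u) * f (R u)) \<in> borel_measurable unif"
    by (rule measurable_unif, measurable)+
  have "(\<integral>\<^sup>+ u. \<integral>\<^sup>+ v. f (IT_lift \<mu> \<nu> u v) \<partial>unif \<partial>unif)
      = (\<integral>\<^sup>+ u. ennreal (p u) * f (R (\<phi> u)) + ennreal (1 - p u) * f (R u) \<partial>unif)"
    by (rule nn_integral_cong_AE, rule AE_unif_countable[OF countable_top_level], rule nn_integral_IT_lift_section)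
  also have "\<dots> = (\<integral>\<^sup>+ u. ennreal (p u) * f (R u) + ennreal (1 - p u) * f (R u) \<partial>unif)"
    by (simp add: nn_integral_add m swap)
  also have "\<dots> = (\<integral>\<^sup>+ u. f (R u) \<partial>unif)"
  proof (rule nn_integral_cong_AE, rule AE_unif_countable[OF countable_top_level])
    fix u :: real assume u: "0 < u" "u < 1" "u \<notin> top_level"
    have "ennreal (p u) * f (R u) + ennreal (1 - p u) * f (R u) = (ennreal (p u) + ennreal (1 - p u)) * f (R u)"
      by (simp add: distrib_right)
    also have "ennreal (p u) + ennreal (1 - p u) = 1"
      using IT_p_bounds(1,2)[OF u] by (simp flip: ennreal_plus)
    finally show "ennreal (p u) * f (R u) + ennreal (1 - p u) * f (R u) = f (R u)" by simp
  qed
  also have "\<dots> = (\<integral>\<^sup>+ y. f y \<partial>distr unif borel R)"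
    by (subst nn_integral_distr) (auto intro!: measurable_unif)
  also have "\<dots> = (\<integral>\<^sup>+ y. f y \<partial>\<nu>)" by (simp add: distr_quantile[OF \<nu>])
  finally show ?thesis .
qed

theorem IT_coupling_eq_lift_law: "IT_coupling \<mu> \<nu> = lift_law \<mu> (IT_lift \<mu> \<nu>)"
proof -
  note Ym = borel_measurable_lift_section[OF IT_lift_measurable]
  have Yu: "(\<lambda>v. IT_lift \<mu> \<nu> u v) \<in> borel_measurable unif" for u
    by (rule measurable_unif[OF Ym])
  have kern: "distr (IT_kernel \<mu> \<nu> u) (borel \<Otimes>\<^sub>M borel) (\<lambda>y. (Q u, y))
      = distr unif (borel \<Otimes>\<^sub>M borel) (\<lambda>v. (Q u, IT_lift \<mu> \<nu> u v))" for u
  proof -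
    have "IT_kernel \<mu> \<nu> u = distr unif borel (IT_lift \<mu> \<nu> u)"
      by (simp add: IT_kernel_def two_point_eq_distr IT_lift_def[abs_def])
    then show ?thesis using Yu[of u] by (simp add: distr_distr o_def)
  qed
  let ?k = "\<lambda>u. distr unif (borel \<Otimes>\<^sub>M borel) (\<lambda>v. (Q u, IT_lift \<mu> \<nu> u v))"
  have k: "?k \<in> unif \<rightarrow>\<^sub>M prob_algebra (borel \<Otimes>\<^sub>M borel)"
  proof (rule measurable_distr_prob_space2[where M = unif])
    show "(\<lambda>u. unif) \<in> unif \<rightarrow>\<^sub>M prob_algebra unif"
      by (rule measurable_const) (simp add: space_prob_algebra prob_space_unif)
    show "(\<lambda>(u, v). (Q u, IT_lift \<mu> \<nu> u v)) \<in> unif \<Otimes>\<^sub>M unif \<rightarrow>\<^sub>M borel \<Otimes>\<^sub>M borel"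
      by (rule measurable_lift_map[OF \<mu> IT_lift_measurable])
  qed
  have eq: "IT_coupling \<mu> \<nu> = unif \<bind> ?k"
    unfolding IT_coupling_def kern unif_def ..
  show ?thesis
  proof (rule measure_eqI)
    have ne: "space unif \<noteq> {}" by (rule unif.not_empty)
    have "sets (unif \<bind> ?k) = sets (borel \<Otimes>\<^sub>M borel)"
      by (rule sets_bind[OF _ ne]) simp
    then show s: "sets (IT_coupling \<mu> \<nu>) = sets (lift_law \<mu> (IT_lift \<mu> \<nu>))" 
      by (simp add: eq lift_law_def)
    fix A assume "A \<in> sets (IT_coupling \<mu> \<nu>)"
    then have A: "A \<in> sets (borel \<Otimes>\<^sub>M borel)" using s by (simp add: lift_law_def)
    have "emeasure (IT_coupling \<mu> \<nu>) A = (\<integral>\<^sup>+ u. emeasure (?k u) A \<partial>unif)"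
      unfolding eq by (rule emeasure_bind[OF ne measurable_prob_algebraD[OF k] A])
    also have "\<dots> = (\<integral>\<^sup>+ u. \<integral>\<^sup>+ v. indicator A (Q u, IT_lift \<mu> \<nu> u v) \<partial>unif \<partial>unif)"
    proof (rule nn_integral_cong)
      fix u
      have "(\<lambda>v. (Q u, IT_lift \<mu> \<nu> u v)) \<in> unif \<rightarrow>\<^sub>M borel \<Otimes>\<^sub>M borel"
        using Yu[of u] by simp
      then show "emeasure (?k u) A = (\<integral>\<^sup>+ v. indicator A (Q u, IT_lift \<mu> \<nu> u v) \<partial>unif)"
        using A by (subst nn_integral_indicator[symmetric], simp, subst nn_integral_distr) auto
    qed
    also have "\<dots> = (\<integral>\<^sup>+ z. indicator A z \<partial>lift_law \<mu> (IT_lift \<mu> \<nu>))"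
      using A by (subst nn_integral_lift_law[OF \<mu> IT_lift_measurable]) auto
    also have "\<dots> = emeasure (lift_law \<mu> (IT_lift \<mu> \<nu>)) A"
      using A by (simp add: lift_law_def)
    finally show "emeasure (IT_coupling \<mu> \<nu>) A = emeasure (lift_law \<mu> (IT_lift \<mu> \<nu>)) A" .
  qed
qed

end

section \<open>Wasserstein convergence and quantile functions\<close>

lemma tendsto_INF_zero_imp_selection:
  fixes f :: "nat \<Rightarrow> 'a \<Rightarrow> ennreal"
  assumes lim: "(\<lambda>n. INF x\<in>C n. f n x) \<longlonglongrightarrow> 0" and ne: "\<And>n. C n \<noteq> {}"
  shows "\<exists>x. (\<forall>n. x n \<in> C n) \<and> (\<lambda>n. f n (x n)) \<longlonglongrightarrow> 0"
proof -
  have "\<exists>x\<in>C n. f n x \<le> (INF x\<in>C n. f n x) + ennreal (1 / real (Suc n))" for n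
  proof (cases "(INF x\<in>C n. f n x) = \<top>")
    case True
    then show ?thesis using ne[of n] by auto
  next
    case False
    have "(INF x\<in>C n. f n x) + 0 < (INF x\<in>C n. f n x) + ennreal (1 / real (Suc n))"
      using False by (subst ennreal_add_left_cancel_less) (auto simp: ennreal_zero_less_divide)
    then show ?thesis by (auto simp: INF_less_iff intro: less_imp_le)
  qed
  then obtain x where x: "\<And>n. x n \<in> C n"
    "\<And>n. f n (x n) \<le> (INF x\<in>C n. f n x) + ennreal (1 / real (Suc n))" by metis
  have "(\<lambda>n. ennreal (1 / real (Suc n))) \<longlonglongrightarrow> ennreal 0"
    by (intro tendsto_ennrealI lim_1_over_n[THEN LIMSEQ_Suc])
  then have "(\<lambda>n. (INF x\<in>C n. f n x) + ennreal (1 / real (Suc n))) \<longlonglongrightarrow> 0"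
    using tendsto_add[OF lim] by fastforce
  then have "(\<lambda>n. f n (x n)) \<longlonglongrightarrow> 0" by (rule tendsto_zero_le) (rule x(2))
  with x(1) show ?thesis by blast
qed

lemma wasserstein_tendsto_zero_couplings:
  assumes "\<rho> > 0" "\<And>n. real_distribution (\<mu>s n)" "real_distribution \<mu>"
    and "(\<lambda>n. wasserstein \<rho> (\<mu>s n) \<mu>) \<longlonglongrightarrow> 0"
  shows "\<exists>\<pi>. (\<forall>n. \<pi> n \<in> couplings (\<mu>s n) \<mu>) \<and>
    (\<lambda>n. \<integral>\<^sup>+ z. ennreal (\<bar>fst z - snd z\<bar> powr \<rho>) \<partial>\<pi> n) \<longlonglongrightarrow> 0"
proof (rule tendsto_INF_zero_imp_selection)
  have "(\<lambda>n. epowr (wasserstein \<rho> (\<mu>s n) \<mu>) \<rho>) \<longlonglongrightarrow> 0"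
    using assms by (intro tendsto_epowr_zero)
  then show "(\<lambda>n. INF \<pi>\<in>couplings (\<mu>s n) \<mu>. \<integral>\<^sup>+ z. ennreal (\<bar>fst z - snd z\<bar> powr \<rho>) \<partial>\<pi>) \<longlonglongrightarrow> 0"
    using assms(1) by (simp add: wasserstein_def epowr_epowr_inverse)
  show "couplings (\<mu>s n) \<mu> \<noteq> {}" for n
    using quantile_pair_in_couplings[OF assms(2,3)] by blast
qed

lemma couplings_marginals:
  assumes "\<pi> \<in> couplings \<mu> \<nu>"
  shows "prob_space \<pi>" "sets \<pi> = sets (borel \<Otimes>\<^sub>M borel)"
    and "f \<in> borel_measurable borel \<Longrightarrow> (\<integral>\<^sup>+ z. f (fst z) \<partial>\<pi>) = (\<integral>\<^sup>+ x. f x \<partial>\<mu>)"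
    and "f \<in> borel_measurable borel \<Longrightarrow> (\<integral>\<^sup>+ z. f (snd z) \<partial>\<pi>) = (\<integral>\<^sup>+ y. f y \<partial>\<nu>)"
proof -
  show ps: "prob_space \<pi>" and s: "sets \<pi> = sets (borel \<Otimes>\<^sub>M borel)"
    using assms by (auto simp: couplings_def)
  have m: "fst \<in> \<pi> \<rightarrow>\<^sub>M borel" "snd \<in> \<pi> \<rightarrow>\<^sub>M borel"
    by (simp_all add: measurable_cong_sets[OF s refl])
  have d: "distr \<pi> borel fst = \<mu>" "distr \<pi> borel snd = \<nu>" using assms by (auto simp: couplings_def)
  show "(\<integral>\<^sup>+ z. f (fst z) \<partial>\<pi>) = (\<integral>\<^sup>+ x. f x \<partial>\<mu>)" if "f \<in> borel_measurable borel"
    unfolding d(1)[symmetric] using that m by (subst nn_integral_distr) auto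
  show "(\<integral>\<^sup>+ z. f (snd z) \<partial>\<pi>) = (\<integral>\<^sup>+ y. f y \<partial>\<nu>)" if "f \<in> borel_measurable borel"
    unfolding d(2)[symmetric] using that m by (subst nn_integral_distr) auto
qed

text \<open>The left-hand side is the \<open>L\<^sup>1\<close> distance of the distribution functions, and their difference
  at \<open>y\<close> is at most the probability that \<open>y\<close> separates the two coordinates.\<close>
lemma quantile_L1_le_coupling_cost:
  assumes \<mu>: "real_distribution \<mu>" and \<nu>: "real_distribution \<nu>" and \<pi>: "\<pi> \<in> couplings \<mu> \<nu>"
  shows "(L1_dist unif (quantile \<mu>) (quantile \<nu>)) \<le> (\<integral>\<^sup>+ z. ennreal \<bar>fst z - snd z\<bar> \<partial>\<pi>)"
proof -
  interpret P: prob_space \<pi> by (rule couplings_marginals(1)[OF \<pi>])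
  note s [measurable_cong] = couplings_marginals(2)[OF \<pi>]
  interpret pair_sigma_finite \<pi> lborel
    by (simp add: pair_sigma_finite_def P.sigma_finite_measure_axioms sigma_finite_lborel)
  have [measurable]: "fst \<in> \<pi> \<rightarrow>\<^sub>M borel" "snd \<in> \<pi> \<rightarrow>\<^sub>M borel"
    by (simp_all add: measurable_cong_sets[OF s refl])
  have int: "integrable \<pi> (\<lambda>z. indicator {..y} (fst z) :: real)" "integrable \<pi> (\<lambda>z. indicator {..y} (snd z) :: real)" for y
    by (auto intro!: P.integrable_const_bound[of _ 1])
  have cdf_eq: "cdf m y = (\<integral>z. indicator {..y} (f z) \<partial>\<pi>)"
    if m: "real_distribution m" and int: "integrable \<pi> (\<lambda>z. indicator {..y} (f z) :: real)"
      and law: "(\<integral>\<^sup>+ z. indicator {..y} (f z) \<partial>\<pi>) = (\<integral>\<^sup>+ x. indicator {..y} x \<partial>m)" for m f y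
  proof -
    interpret m: real_distribution m by (rule m)
    have "ennreal (cdf m y) = (\<integral>\<^sup>+ z. indicator {..y} (f z) \<partial>\<pi>)"
      unfolding law by (simp add: cdf_def m.emeasure_eq_measure)
    also have "\<dots> = ennreal (\<integral>z. indicator {..y} (f z) \<partial>\<pi>)"
      using nn_integral_eq_integral[OF int] by (simp add: ennreal_indicator)
    finally show ?thesis using m.cdf_nonneg[of y]
      by (subst (asm) ennreal_inj) (auto intro!: Bochner_Integration.integral_nonneg)
  qed
  have F: "cdf \<mu> y = (\<integral>z. indicator {..y} (fst z) \<partial>\<pi>)" for y
    by (rule cdf_eq[OF \<mu> int(1)], rule couplings_marginals(3)[OF \<pi>]) simp
  have G: "cdf \<nu> y = (\<integral>z. indicator {..y} (snd z) \<partial>\<pi>)" for y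
    by (rule cdf_eq[OF \<nu> int(2)], rule couplings_marginals(4)[OF \<pi>]) simp
  have ind: "indicator {..y} x = (indicator {x..} y :: real)" for x y :: real
    by (auto split: split_indicator)
  have "(L1_dist unif (quantile \<mu>) (quantile \<nu>)) = (L1_dist lborel (cdf \<mu>) (cdf \<nu>))"
    by (rule nn_integral_cdf_diff_eq_quantile_diff[OF \<mu> \<nu>, symmetric])
  also have "\<dots> \<le> (\<integral>\<^sup>+ y. \<integral>\<^sup>+ z. ennreal \<bar>indicator {..y} (fst z) - indicator {..y} (snd z)\<bar> \<partial>\<pi> \<partial>lborel)"
  proof (rule nn_integral_mono)
    fix y :: real
    have "cdf \<mu> y - cdf \<nu> y = (\<integral>z. indicator {..y} (fst z) - indicator {..y} (snd z) \<partial>\<pi>)"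
      unfolding F G using int by simp
    then show "ennreal \<bar>cdf \<mu> y - cdf \<nu> y\<bar> \<le> (\<integral>\<^sup>+ z. ennreal \<bar>indicator {..y} (fst z) - indicator {..y} (snd z)\<bar> \<partial>\<pi>)"
      using integral_norm_bound_ennreal[OF Bochner_Integration.integrable_diff[OF int[of y]]] by simp
  qed
  also have "\<dots> = (\<integral>\<^sup>+ z. \<integral>\<^sup>+ y. ennreal \<bar>indicator {..y} (fst z) - indicator {..y} (snd z)\<bar> \<partial>lborel \<partial>\<pi>)"
    by (rule Fubini') (simp add: indicator_def case_prod_beta')
  also have "\<dots> = (\<integral>\<^sup>+ z. ennreal \<bar>fst z - snd z\<bar> \<partial>\<pi>)"
    unfolding ind by (intro nn_integral_cong abs_diff_eq_nn_integral_indicator[symmetric])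
  finally show ?thesis .
qed

lemma abs_le_eps_plus_powr:
  fixes d e \<rho> :: real
  assumes "0 < e" "1 \<le> \<rho>"
  shows "\<bar>d\<bar> \<le> e + e powr (1 - \<rho>) * \<bar>d\<bar> powr \<rho>"
proof (cases "\<bar>d\<bar> \<le> e")
  case False
  then have d: "\<bar>d\<bar> > e" by simp
  have "\<bar>d\<bar> = \<bar>d\<bar> powr (1 - \<rho>) * \<bar>d\<bar> powr \<rho>"
    using d assms by (simp flip: powr_add)
  also have "\<bar>d\<bar> powr (1 - \<rho>) \<le> e powr (1 - \<rho>)"
    using d assms by (intro powr_mono2') auto
  finally show ?thesis using assms by (simp add: mult_right_mono)
qed (simp add: add_increasing2)

lemma coupling_L1_tendsto_zero:
  assumes \<rho>: "\<rho> \<ge> 1" and \<pi>: "\<And>n. \<pi> n \<in> couplings (\<mu>s n) \<mu>"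
    and cost: "(\<lambda>n. \<integral>\<^sup>+ z. ennreal (\<bar>fst z - snd z\<bar> powr \<rho>) \<partial>\<pi> n) \<longlonglongrightarrow> 0"
  shows "(\<lambda>n. \<integral>\<^sup>+ z. ennreal \<bar>fst z - snd z\<bar> \<partial>\<pi> n) \<longlonglongrightarrow> 0"
proof (rule tendsto_zero_approx)
  define e where "e k = 1 / real (Suc k)" for k
  have e: "e k > 0" for k by (simp add: e_def)
  have "e \<longlonglongrightarrow> 0" unfolding e_def by (rule lim_1_over_n[THEN LIMSEQ_Suc])
  from tendsto_ennrealI[OF this] show "(\<lambda>k. ennreal (e k)) \<longlonglongrightarrow> 0" by simp
  show "(\<lambda>n. ennreal (e k powr (1 - \<rho>)) * (\<integral>\<^sup>+ z. ennreal (\<bar>fst z - snd z\<bar> powr \<rho>) \<partial>\<pi> n)) \<longlonglongrightarrow> 0" for k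
    using ennreal_tendsto_cmult[OF _ cost, of "ennreal (e k powr (1 - \<rho>))"] by simp
  fix k n
  interpret P: prob_space "\<pi> n" by (rule couplings_marginals(1)[OF \<pi>])
  note s [measurable_cong] = couplings_marginals(2)[OF \<pi>[of n]]
  have [measurable]: "fst \<in> \<pi> n \<rightarrow>\<^sub>M borel" "snd \<in> \<pi> n \<rightarrow>\<^sub>M borel"
    by (simp_all add: measurable_cong_sets[OF s refl])
  have "(\<integral>\<^sup>+ z. ennreal \<bar>fst z - snd z\<bar> \<partial>\<pi> n)
      \<le> (\<integral>\<^sup>+ z. ennreal (e k) + ennreal (e k powr (1 - \<rho>)) * ennreal (\<bar>fst z - snd z\<bar> powr \<rho>) \<partial>\<pi> n)"
  proof (rule nn_integral_mono)
    fix z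
    have "ennreal \<bar>fst z - snd z\<bar> \<le> ennreal (e k + e k powr (1 - \<rho>) * \<bar>fst z - snd z\<bar> powr \<rho>)"
      by (intro ennreal_leI abs_le_eps_plus_powr e \<rho>)
    also have "\<dots> = ennreal (e k) + ennreal (e k powr (1 - \<rho>)) * ennreal (\<bar>fst z - snd z\<bar> powr \<rho>)"
      using e[of k] by (subst ennreal_plus) (auto simp: ennreal_mult)
    finally show "ennreal \<bar>fst z - snd z\<bar> \<le> ennreal (e k) + ennreal (e k powr (1 - \<rho>)) * ennreal (\<bar>fst z - snd z\<bar> powr \<rho>)" .
  qed
  also have "\<dots> = ennreal (e k) + ennreal (e k powr (1 - \<rho>)) * (\<integral>\<^sup>+ z. ennreal (\<bar>fst z - snd z\<bar> powr \<rho>) \<partial>\<pi> n)"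
    by (subst nn_integral_add) (auto simp: nn_integral_cmult P.emeasure_space_1)
  finally show "(\<integral>\<^sup>+ z. ennreal \<bar>fst z - snd z\<bar> \<partial>\<pi> n)
     \<le> ennreal (e k) + ennreal (e k powr (1 - \<rho>)) * (\<integral>\<^sup>+ z. ennreal (\<bar>fst z - snd z\<bar> powr \<rho>) \<partial>\<pi> n)" .
qed

lemma coupling_moments_tendsto:
  assumes \<rho>: "\<rho> \<ge> 1" and \<pi>: "\<And>n. \<pi> n \<in> couplings (\<mu>s n) \<mu>"
    and cost: "(\<lambda>n. \<integral>\<^sup>+ z. ennreal (\<bar>fst z - snd z\<bar> powr \<rho>) \<partial>\<pi> n) \<longlonglongrightarrow> 0"
    and fin: "\<And>n. (\<integral>\<^sup>+ x. ennreal (\<bar>x\<bar> powr \<rho>) \<partial>\<mu>s n) < \<top>" "(\<integral>\<^sup>+ x. ennreal (\<bar>x\<bar> powr \<rho>) \<partial>\<mu>) < \<top>"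
  shows "(\<lambda>n. \<integral>\<^sup>+ x. ennreal (\<bar>x\<bar> powr \<rho>) \<partial>\<mu>s n) \<longlonglongrightarrow> (\<integral>\<^sup>+ x. ennreal (\<bar>x\<bar> powr \<rho>) \<partial>\<mu>)"
proof -
  define ms where "ms n = enn2real (\<integral>\<^sup>+ x. ennreal (\<bar>x\<bar> powr \<rho>) \<partial>\<mu>s n)" for n
  define m where "m = enn2real (\<integral>\<^sup>+ x. ennreal (\<bar>x\<bar> powr \<rho>) \<partial>\<mu>)"
  define cs where "cs n = enn2real (\<integral>\<^sup>+ z. ennreal (\<bar>fst z - snd z\<bar> powr \<rho>) \<partial>\<pi> n)" for n
  have ms: "(\<integral>\<^sup>+ x. ennreal (\<bar>x\<bar> powr \<rho>) \<partial>\<mu>s n) = ennreal (ms n)" "0 \<le> ms n" for n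
    unfolding ms_def using fin(1) by auto
  have m: "(\<integral>\<^sup>+ x. ennreal (\<bar>x\<bar> powr \<rho>) \<partial>\<mu>) = ennreal m" "0 \<le> m"
    unfolding m_def using fin(2) by auto
  have meas: "fst \<in> \<pi> n \<rightarrow>\<^sub>M borel" "snd \<in> \<pi> n \<rightarrow>\<^sub>M borel" for n
    by (simp_all add: measurable_cong_sets[OF couplings_marginals(2)[OF \<pi>] refl])
  have marg: "(\<integral>\<^sup>+ z. ennreal (\<bar>fst z\<bar> powr \<rho>) \<partial>\<pi> n) = ennreal (ms n)"
    "(\<integral>\<^sup>+ z. ennreal (\<bar>snd z\<bar> powr \<rho>) \<partial>\<pi> n) = ennreal m" for n
    using couplings_marginals(3)[OF \<pi>, of "\<lambda>x. ennreal (\<bar>x\<bar> powr \<rho>)"]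
      couplings_marginals(4)[OF \<pi>, of "\<lambda>x. ennreal (\<bar>x\<bar> powr \<rho>)"] by (auto simp: ms m)
  have cs: "(\<integral>\<^sup>+ z. ennreal (\<bar>fst z - snd z\<bar> powr \<rho>) \<partial>\<pi> n) = ennreal (cs n)" "0 \<le> cs n" for n
  proof -
    note [measurable] = meas[of n]
    have "(\<integral>\<^sup>+ z. ennreal (\<bar>fst z - snd z\<bar> powr \<rho>) \<partial>\<pi> n) \<le>
        (\<integral>\<^sup>+ z. ennreal (2 powr \<rho>) * (ennreal (\<bar>fst z\<bar> powr \<rho>) + ennreal (\<bar>snd z\<bar> powr \<rho>)) \<partial>\<pi> n)"
    proof (rule nn_integral_mono)
      fix z
      have "ennreal (\<bar>fst z - snd z\<bar> powr \<rho>) \<le> ennreal (2 powr \<rho> * (\<bar>fst z\<bar> powr \<rho> + \<bar>snd z\<bar> powr \<rho>))"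
        by (intro ennreal_leI abs_diff_powr_le \<rho>)
      then show "ennreal (\<bar>fst z - snd z\<bar> powr \<rho>) \<le>
          ennreal (2 powr \<rho>) * (ennreal (\<bar>fst z\<bar> powr \<rho>) + ennreal (\<bar>snd z\<bar> powr \<rho>))"
        by (simp add: ennreal_mult')
    qed
    also have "\<dots> = ennreal (2 powr \<rho>) * (ennreal (ms n) + ennreal m)"
      by (subst nn_integral_cmult) (auto simp: nn_integral_add marg)
    also have "\<dots> < \<top>" by (simp add: ennreal_mult_less_top)
    finally show "(\<integral>\<^sup>+ z. ennreal (\<bar>fst z - snd z\<bar> powr \<rho>) \<partial>\<pi> n) = ennreal (cs n)" "0 \<le> cs n"
      unfolding cs_def by auto
  qed
  have cs0: "cs \<longlonglongrightarrow> 0"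
  proof -
    have "(\<lambda>n. ennreal (cs n)) \<longlonglongrightarrow> ennreal 0" using cost unfolding cs by simp
    then show ?thesis using cs(2) by (subst (asm) tendsto_ennreal_iff) auto
  qed
  have step: "a \<le> (1 - t) powr (1 - \<rho>) * b + t powr (1 - \<rho>) * cs n"
    if t: "0 < t" "t < 1" and ab: "0 \<le> a" "0 \<le> b"
      and A: "(\<integral>\<^sup>+ z. ennreal (\<bar>f z\<bar> powr \<rho>) \<partial>\<pi> n) = ennreal a"
      and B: "(\<integral>\<^sup>+ z. ennreal (\<bar>h z\<bar> powr \<rho>) \<partial>\<pi> n) = ennreal b"
      and f: "f \<in> borel_measurable (\<pi> n)" and h: "h \<in> borel_measurable (\<pi> n)"
      and fh: "\<And>z. \<bar>f z - h z\<bar> = \<bar>fst z - snd z\<bar>" for n t a b f h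
  proof -
    note [measurable] = meas[of n] f h
    have "ennreal a \<le> (\<integral>\<^sup>+ z. ennreal ((1 - t) powr (1 - \<rho>)) * ennreal (\<bar>h z\<bar> powr \<rho>)
        + ennreal (t powr (1 - \<rho>)) * ennreal (\<bar>fst z - snd z\<bar> powr \<rho>) \<partial>\<pi> n)"
      unfolding A[symmetric]
    proof (rule nn_integral_mono)
      fix z
      have "\<bar>f z\<bar> powr \<rho> \<le> (\<bar>h z\<bar> + \<bar>fst z - snd z\<bar>) powr \<rho>"
        using fh[of z] \<rho> by (intro powr_mono2) auto
      also have "\<dots> \<le> (1 - t) powr (1 - \<rho>) * \<bar>h z\<bar> powr \<rho> + t powr (1 - \<rho>) * \<bar>fst z - snd z\<bar> powr \<rho>"
        using t \<rho> by (intro powr_add_le_weighted) auto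
      finally have "ennreal (\<bar>f z\<bar> powr \<rho>)
        \<le> ennreal ((1 - t) powr (1 - \<rho>) * \<bar>h z\<bar> powr \<rho> + t powr (1 - \<rho>) * \<bar>fst z - snd z\<bar> powr \<rho>)"
        by (rule ennreal_leI)
      then show "ennreal (\<bar>f z\<bar> powr \<rho>) \<le> ennreal ((1 - t) powr (1 - \<rho>)) * ennreal (\<bar>h z\<bar> powr \<rho>)
        + ennreal (t powr (1 - \<rho>)) * ennreal (\<bar>fst z - snd z\<bar> powr \<rho>)"
        by (simp add: ennreal_mult')
    qed
    also have "\<dots> = ennreal ((1 - t) powr (1 - \<rho>)) * ennreal b + ennreal (t powr (1 - \<rho>)) * ennreal (cs n)"
      by (subst nn_integral_add) (auto simp: nn_integral_cmult B cs)
    also have "\<dots> = ennreal ((1 - t) powr (1 - \<rho>) * b + t powr (1 - \<rho>) * cs n)"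
      using ab cs(2)[of n] by (simp add: ennreal_mult')
    finally have "ennreal a \<le> ennreal ((1 - t) powr (1 - \<rho>) * b + t powr (1 - \<rho>) * cs n)" .
    then show ?thesis
      by (rule ennreal_le_iff[THEN iffD1, rotated]) (use ab cs(2)[of n] in simp)
  qed
  have "ms \<longlonglongrightarrow> m"
  proof (rule tendsto_if_weighted_bounds[where A = "\<lambda>t. (1 - t) powr (1 - \<rho>)" and B = "\<lambda>t. t powr (1 - \<rho>)", OF _ _ _ cs0])
    show "ms n \<le> (1 - t) powr (1 - \<rho>) * m + t powr (1 - \<rho>) * cs n" if "0 < t" "t < 1" for n t
      by (rule step[OF that ms(2) m(2) marg(1) marg(2) meas]) simp
    show "m \<le> (1 - t) powr (1 - \<rho>) * ms n + t powr (1 - \<rho>) * cs n" if "0 < t" "t < 1" for n t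
      by (rule step[OF that m(2) ms(2) marg(2) marg(1) meas(2) meas(1)]) (simp add: abs_minus_commute)
    have "((\<lambda>t::real. (1 - t) powr (1 - \<rho>)) \<longlongrightarrow> (1 - 0) powr (1 - \<rho>)) (at_right 0)"
      by (intro tendsto_intros) auto
    then show "((\<lambda>t. (1 - t) powr (1 - \<rho>)) \<longlongrightarrow> 1) (at_right 0)" by simp
  qed
  then show ?thesis unfolding ms m by (rule tendsto_ennrealI)
qed

lemma nn_integral_quantile:
  assumes "real_distribution \<mu>" "f \<in> borel_measurable borel"
  shows "(\<integral>\<^sup>+ u. f (quantile \<mu> u) \<partial>unif) = (\<integral>\<^sup>+ x. f x \<partial>\<mu>)"
proof -
  have "(\<integral>\<^sup>+ x. f x \<partial>distr unif borel (quantile \<mu>)) = (\<integral>\<^sup>+ u. f (quantile \<mu> u) \<partial>unif)"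
    using assms by (intro nn_integral_distr measurable_unif borel_measurable_quantile) auto
  then show ?thesis by (simp add: distr_quantile[OF assms(1)])
qed

lemma prob_momentD:
  assumes "\<mu> \<in> prob_moment \<rho>"
  shows "real_distribution \<mu>" "(\<integral>\<^sup>+ x. ennreal (\<bar>x\<bar> powr \<rho>) \<partial>\<mu>) < \<top>"
  using assms by (auto simp: prob_moment_def integrable_iff_bounded)

lemma prob_moment_mono:
  assumes "\<mu> \<in> prob_moment \<rho>" "1 \<le> \<rho>"
  shows "\<mu> \<in> prob_moment 1"
proof -
  interpret real_distribution \<mu> by (rule prob_momentD(1)[OF assms(1)])
  have "integrable \<mu> (\<lambda>x. \<bar>x\<bar> powr 1)"
  proof (rule Bochner_Integration.integrable_bound)
    show "integrable \<mu> (\<lambda>x. 1 + \<bar>x\<bar> powr \<rho>)" using assms by (auto simp: prob_moment_def)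
    have "norm (\<bar>x\<bar> powr 1) \<le> norm (1 + \<bar>x\<bar> powr \<rho>)" for x
      using abs_le_eps_plus_powr[of 1 \<rho> x] assms(2) by simp
    then show "AE x in \<mu>. norm (\<bar>x\<bar> powr 1) \<le> norm (1 + \<bar>x\<bar> powr \<rho>)" by simp
  qed simp
  then show ?thesis using real_distribution_axioms by (simp add: prob_moment_def)
qed

lemma integrable_quantile:
  assumes "\<mu> \<in> prob_moment 1"
  shows "integrable unif (quantile \<mu>)"
proof -
  have "(\<integral>\<^sup>+ u. ennreal (\<bar>quantile \<mu> u\<bar>) \<partial>unif) = (\<integral>\<^sup>+ x. ennreal \<bar>x\<bar> \<partial>\<mu>)"
    by (rule nn_integral_quantile[OF prob_momentD(1)[OF assms]]) simp
  then show ?thesis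
    using prob_momentD[OF assms] measurable_unif[OF borel_measurable_quantile[of \<mu>]]
    by (simp add: integrable_iff_bounded)
qed

lemma wasserstein_tendsto_zero_quantile:
  assumes \<rho>: "\<rho> \<ge> 1" and \<mu>s: "\<And>n. \<mu>s n \<in> prob_moment \<rho>" and \<mu>: "\<mu> \<in> prob_moment \<rho>"
    and W: "(\<lambda>n. wasserstein \<rho> (\<mu>s n) \<mu>) \<longlonglongrightarrow> 0"
  shows "(\<lambda>n. L1_dist unif (quantile (\<mu>s n)) (quantile \<mu>)) \<longlonglongrightarrow> 0"
    and "(\<lambda>n. \<integral>\<^sup>+ u. ennreal (\<bar>quantile (\<mu>s n) u - quantile \<mu> u\<bar> powr \<rho>) \<partial>unif) \<longlonglongrightarrow> 0"
    and "(\<lambda>n. \<integral>\<^sup>+ x. ennreal (\<bar>x\<bar> powr \<rho>) \<partial>\<mu>s n) \<longlonglongrightarrow> (\<integral>\<^sup>+ x. ennreal (\<bar>x\<bar> powr \<rho>) \<partial>\<mu>)"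
    and "(\<lambda>n. \<integral>\<^sup>+ x. ennreal \<bar>x\<bar> \<partial>\<mu>s n) \<longlonglongrightarrow> (\<integral>\<^sup>+ x. ennreal \<bar>x\<bar> \<partial>\<mu>)"
proof -
  note d\<mu>s = prob_momentD[OF \<mu>s] and d\<mu> = prob_momentD[OF \<mu>]
  have \<rho>0: "0 < \<rho>" using \<rho> by simp
  obtain \<pi> where \<pi>: "\<And>n. \<pi> n \<in> couplings (\<mu>s n) \<mu>"
    and cost: "(\<lambda>n. \<integral>\<^sup>+ z. ennreal (\<bar>fst z - snd z\<bar> powr \<rho>) \<partial>\<pi> n) \<longlonglongrightarrow> 0"
    using wasserstein_tendsto_zero_couplings[OF \<rho>0 d\<mu>s(1) d\<mu>(1) W] by auto
  note L1 = coupling_L1_tendsto_zero[OF \<rho> \<pi> cost]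
  show Q1: "(\<lambda>n. L1_dist unif (quantile (\<mu>s n)) (quantile \<mu>)) \<longlonglongrightarrow> 0"
    by (rule tendsto_zero_le[OF L1]) (rule quantile_L1_le_coupling_cost[OF d\<mu>s(1) d\<mu>(1) \<pi>])
  show mom: "(\<lambda>n. \<integral>\<^sup>+ x. ennreal (\<bar>x\<bar> powr \<rho>) \<partial>\<mu>s n) \<longlonglongrightarrow> (\<integral>\<^sup>+ x. ennreal (\<bar>x\<bar> powr \<rho>) \<partial>\<mu>)"
    by (rule coupling_moments_tendsto[OF \<rho> \<pi> cost d\<mu>s(2) d\<mu>(2)])
  have "(\<lambda>n. \<integral>\<^sup>+ x. ennreal (\<bar>x\<bar> powr 1) \<partial>\<mu>s n) \<longlonglongrightarrow> (\<integral>\<^sup>+ x. ennreal (\<bar>x\<bar> powr 1) \<partial>\<mu>)"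
    using L1 \<pi> prob_momentD(2)[OF prob_moment_mono[OF \<mu>s \<rho>]] prob_momentD(2)[OF prob_moment_mono[OF \<mu> \<rho>]]
    by (intro coupling_moments_tendsto[of 1 \<pi>]) auto
  then show "(\<lambda>n. \<integral>\<^sup>+ x. ennreal \<bar>x\<bar> \<partial>\<mu>s n) \<longlonglongrightarrow> (\<integral>\<^sup>+ x. ennreal \<bar>x\<bar> \<partial>\<mu>)" by simp
  show "(\<lambda>n. \<integral>\<^sup>+ u. ennreal (\<bar>quantile (\<mu>s n) u - quantile \<mu> u\<bar> powr \<rho>) \<partial>unif) \<longlonglongrightarrow> 0"
  proof (rule unif.Lp_convergence_if_norm_convergence[OF \<rho>])
    show "quantile (\<mu>s n) \<in> borel_measurable unif" "quantile \<mu> \<in> borel_measurable unif" for n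
      by (auto intro!: measurable_unif borel_measurable_quantile d\<mu>s d\<mu>)
    show "(\<lambda>n. \<integral>\<^sup>+ u. ennreal (min 1 \<bar>quantile (\<mu>s n) u - quantile \<mu> u\<bar>) \<partial>unif) \<longlonglongrightarrow> 0"
      by (rule tendsto_zero_le[OF Q1]) (intro nn_integral_mono ennreal_leI, simp)
    have eq: "(\<integral>\<^sup>+ u. ennreal (\<bar>quantile m u\<bar> powr \<rho>) \<partial>unif) = (\<integral>\<^sup>+ x. ennreal (\<bar>x\<bar> powr \<rho>) \<partial>m)"
      if "real_distribution m" for m
      by (rule nn_integral_quantile[OF that]) simp
    show "(\<lambda>n. \<integral>\<^sup>+ u. ennreal (\<bar>quantile (\<mu>s n) u\<bar> powr \<rho>) \<partial>unif) \<longlonglongrightarrow> (\<integral>\<^sup>+ u. ennreal (\<bar>quantile \<mu> u\<bar> powr \<rho>) \<partial>unif)"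
      using mom by (simp add: eq d\<mu>s d\<mu>)
    show "(\<integral>\<^sup>+ u. ennreal (\<bar>quantile \<mu> u\<bar> powr \<rho>) \<partial>unif) < \<top>"
      using d\<mu> by (simp add: eq)
  qed
qed

lemma cdf_left_eq_measure:
  assumes "real_distribution \<mu>"
  shows "cdf_left \<mu> x = measure \<mu> {..<x}"
proof -
  interpret real_distribution \<mu> by fact
  show ?thesis unfolding cdf_left_def by (rule tendsto_Lim[OF _ cdf_at_left]) simp
qed

lemma quantile_eq_on_jump:
  assumes "real_distribution \<mu>" "0 < u" "u < 1" "measure \<mu> {..<x} < u" "u \<le> cdf \<mu> x"
  shows "quantile \<mu> u = x"
proof (rule antisym)
  interpret real_distribution \<mu> by fact
  show "quantile \<mu> u \<le> x" using assms by (simp add: quantile_le_iff)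
  show "x \<le> quantile \<mu> u"
  proof (rule ccontr)
    assume *: "\<not> x \<le> quantile \<mu> u"
    have "u \<le> cdf \<mu> (quantile \<mu> u)" by (rule le_cdf_quantile[OF assms(1-3)])
    also have "\<dots> \<le> measure \<mu> {..<x}" unfolding cdf_def using * by (intro finite_measure_mono) auto
    finally show False using assms by simp
  qed
qed

lemma measure_unif_quantile_eq:
  assumes "real_distribution \<mu>"
  shows "measure unif {u \<in> {0<..<1}. quantile \<mu> u = x} = measure \<mu> {x}"
proof -
  note [measurable] = measurable_unif[OF borel_measurable_quantile[OF assms]]
  have "Measurable.pred unif (\<lambda>u. quantile \<mu> u = x)" by measurable
  then have J: "{u \<in> {0<..<1}. quantile \<mu> u = x} \<in> sets unif" by (simp add: pred_def)
  have "emeasure unif {u \<in> {0<..<1}. quantile \<mu> u = x} = (\<integral>\<^sup>+ u. indicator {u \<in> {0<..<1}. quantile \<mu> u = x} u \<partial>unif)"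
    by (rule nn_integral_indicator[symmetric, OF J])
  also have "\<dots> = (\<integral>\<^sup>+ u. indicator {x} (quantile \<mu> u) \<partial>unif)"
    by (rule nn_integral_cong) (simp split: split_indicator)
  also have "\<dots> = emeasure \<mu> {x}" by (rule emeasure_unif_quantile[OF assms]) simp
  finally show ?thesis by (simp add: measure_def)
qed

text \<open>Up to endpoints the event \<open>quantile \<mu> u = x\<close> is the interval between the one-sided values of
  the distribution function at \<open>x\<close>, and similarly for \<open>\<mu>s n\<close> and \<open>xs n\<close>. The hypothesis on the
  jumps says that the length of the overlap of the two intervals tends to the length of the
  first.\<close>
lemma jump_overlap_imp_atom_inclusion:
  assumes \<mu>: "real_distribution \<mu>" and \<mu>s: "\<And>n. real_distribution (\<mu>s n)" and pos: "measure \<mu> {x} > 0"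
    and lim: "(\<lambda>n. min (cdf (\<mu>s n) (xs n)) (cdf \<mu> x) - max (cdf_left (\<mu>s n) (xs n)) (cdf_left \<mu> x))
          \<longlonglongrightarrow> measure \<mu> {x}"
  shows "(\<lambda>n. emeasure unif {u \<in> {0<..<1}. quantile \<mu> u = x \<and> quantile (\<mu>s n) u \<noteq> xs n}) \<longlonglongrightarrow> 0"
proof -
  define l where "l = measure \<mu> {..<x}"
  define r where "r = cdf \<mu> x"
  \<comment> \<open>The overlap of the two jumps is the interval from \<open>a n\<close> to \<open>b n\<close>.\<close>
  define a where "a n = max (measure (\<mu>s n) {..<xs n}) l" for n
  define b where "b n = min (cdf (\<mu>s n) (xs n)) r" for n
  have rl: "r = l + measure \<mu> {x}" unfolding r_def l_def by (rule cdf_eq_lessThan_plus_atom[OF \<mu>])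
  have lim': "(\<lambda>n. b n - a n) \<longlonglongrightarrow> r - l"
    using lim by (simp add: a_def b_def l_def[symmetric] r_def[symmetric] cdf_left_eq_measure[OF \<mu>]
        cdf_left_eq_measure[OF \<mu>s] rl)
  have "(\<lambda>n. (r - l) - (b n - a n)) \<longlonglongrightarrow> (r - l) - (r - l)" by (intro tendsto_intros lim')
  then have lim0: "(\<lambda>n. ennreal ((r - l) - (b n - a n))) \<longlonglongrightarrow> 0" using tendsto_ennrealI by fastforce
  have "\<forall>\<^sub>F n in sequentially. 0 < b n - a n"
    by (rule order_tendstoD(1)[OF lim']) (use pos rl in simp)
  then have le: "\<forall>\<^sub>F n in sequentially. emeasure unif {u \<in> {0<..<1}. quantile \<mu> u = x \<and> quantile (\<mu>s n) u \<noteq> xs n}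
      \<le> ennreal ((r - l) - (b n - a n))"
  proof eventually_elim
    case (elim n)
    have ab: "l \<le> a n" "b n \<le> r" by (auto simp: a_def b_def)
    have sub: "{u \<in> {0<..<1}. quantile \<mu> u = x \<and> quantile (\<mu>s n) u \<noteq> xs n}
        \<subseteq> ({l..a n} \<union> {b n<..r}) \<inter> {0<..<1}"
    proof
      fix u assume "u \<in> {u \<in> {0<..<1}. quantile \<mu> u = x \<and> quantile (\<mu>s n) u \<noteq> xs n}"
      then have u: "0 < u" "u < 1" "quantile \<mu> u = x" "quantile (\<mu>s n) u \<noteq> xs n" by auto
      have "l \<le> u" "u \<le> r"
        using measure_lessThan_le_quantile[OF \<mu> u(1,2)] le_cdf_quantile[OF \<mu> u(1,2)] by (auto simp: u(3) l_def r_def)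
      moreover have "\<not> (a n < u \<and> u \<le> b n)"
        using quantile_eq_on_jump[OF \<mu>s u(1,2), of n "xs n"] u(4) by (auto simp: a_def b_def)
      ultimately show "u \<in> ({l..a n} \<union> {b n<..r}) \<inter> {0<..<1}" using u by auto
    qed
    have "emeasure unif {u \<in> {0<..<1}. quantile \<mu> u = x \<and> quantile (\<mu>s n) u \<noteq> xs n}
        \<le> emeasure unif (({l..a n} \<union> {b n<..r}) \<inter> {0<..<1})"
      by (rule emeasure_mono[OF sub]) (simp add: sets_unif sets_restrict_space_iff)
    also have "\<dots> = emeasure lborel (({l..a n} \<union> {b n<..r}) \<inter> {0<..<1})" by (rule emeasure_unif) auto
    also have "\<dots> \<le> emeasure lborel ({l..a n} \<union> {b n<..r})" by (intro emeasure_mono) auto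
    also have "\<dots> \<le> emeasure lborel {l..a n} + emeasure lborel {b n<..r}" by (intro emeasure_subadditive) auto
    also have "\<dots> = ennreal ((r - l) - (b n - a n))"
      using ab by (simp flip: ennreal_plus)
    finally show ?case .
  qed
  show ?thesis
    by (rule tendsto_sandwich[OF _ le tendsto_const lim0]) simp
qed

section \<open>Convex order and the stability of monotone functions\<close>

lemma ext_integral_eq_integral:
  assumes "integrable M f"
  shows "ext_integral M f = ereal (integral\<^sup>L M f)"
proof -
  have i: "integrable M (\<lambda>x. max 0 (f x))" "integrable M (\<lambda>x. max 0 (- f x))" using assms by auto
  have "ext_integral M f = ereal (\<integral>x. max 0 (f x) \<partial>M) - ereal (\<integral>x. max 0 (- f x) \<partial>M)"
  proof -
    have "(\<integral>\<^sup>+ x. ennreal (max 0 (f x)) \<partial>M) = ennreal (\<integral>x. max 0 (f x) \<partial>M)"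
      "(\<integral>\<^sup>+ x. ennreal (max 0 (- f x)) \<partial>M) = ennreal (\<integral>x. max 0 (- f x) \<partial>M)"
      by (rule nn_integral_eq_integral[OF i(1)], simp, rule nn_integral_eq_integral[OF i(2)], simp)
    moreover have "0 \<le> (\<integral>x. max 0 (f x) \<partial>M)" "0 \<le> (\<integral>x. max 0 (- f x) \<partial>M)"
      by (auto intro!: Bochner_Integration.integral_nonneg)
    ultimately show ?thesis by (simp only: ext_integral_def enn2ereal_ennreal)
  qed
  also have "\<dots> = ereal ((\<integral>x. max 0 (f x) \<partial>M) - (\<integral>x. max 0 (- f x) \<partial>M))" by simp
  also have "(\<integral>x. max 0 (f x) \<partial>M) - (\<integral>x. max 0 (- f x) \<partial>M) = (\<integral>x. max 0 (f x) - max 0 (- f x) \<partial>M)"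
    using i by simp
  also have "\<dots> = integral\<^sup>L M f" by (intro Bochner_Integration.integral_cong) auto
  finally show ?thesis .
qed

context quantile_pair
begin

lemma convex_le_integral_quantile:
  assumes "convex_le \<mu> \<nu>" "convex_on UNIV f" and f: "f \<in> borel_measurable borel"
    and "integrable unif (\<lambda>u. f (Q u))" "integrable unif (\<lambda>u. f (R u))"
  shows "(\<integral>u. f (Q u) \<partial>unif) \<le> (\<integral>u. f (R u) \<partial>unif)"
proof -
  have m: "Q \<in> borel_measurable unif" "R \<in> borel_measurable unif"
    by (rule measurable_unif, measurable)+
  have "integrable (distr unif borel Q) f" "integrable (distr unif borel R) f"
    using assms by (auto simp: integrable_distr_eq[OF m(1) f] integrable_distr_eq[OF m(2) f])
  then have "integrable \<mu> f" "integrable \<nu> f" by (simp_all add: distr_quantile \<mu> \<nu>)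
  moreover have "ext_integral \<mu> f \<le> ext_integral \<nu> f" using assms by (simp add: convex_le_def)
  ultimately have "integral\<^sup>L \<mu> f \<le> integral\<^sup>L \<nu> f" by (simp add: ext_integral_eq_integral)
  then have "integral\<^sup>L (distr unif borel Q) f \<le> integral\<^sup>L (distr unif borel R) f"
    by (simp add: distr_quantile \<mu> \<nu>)
  then show ?thesis by (simp add: integral_distr[OF m(1) f] integral_distr[OF m(2) f])
qed

text \<open>The functions \<open>x\<close> and \<open>- x\<close> show that the means agree. For \<open>K = R u\<close> the positive part of \<open>K
  - x\<close> is the remaining test function: its integral under \<open>\<nu>\<close> is that of \<open>K - R v\<close> over \<open>v \<le> u\<close>,
  and its integral under \<open>\<mu>\<close> is at least that of \<open>K - Q v\<close> over \<open>v \<le> u\<close>.\<close>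
theorem convex_le_imp_IT_pair:
  assumes cx: "convex_le \<mu> \<nu>"
  shows "IT_pair \<mu> \<nu>"
proof
  have mean: "(\<integral>u. Q u \<partial>unif) = (\<integral>u. R u \<partial>unif)"
  proof (rule antisym)
    show "(\<integral>u. Q u \<partial>unif) \<le> (\<integral>u. R u \<partial>unif)"
      using convex_le_integral_quantile[OF cx, of "\<lambda>x. x"] int_\<mu> int_\<nu> by (simp add: convex_on_def)
    have "(\<integral>u. - Q u \<partial>unif) \<le> (\<integral>u. - R u \<partial>unif)"
      using int_\<mu> int_\<nu> by (intro convex_le_integral_quantile[OF cx, of "\<lambda>x. - x"]) (auto simp: convex_on_def)
    then show "(\<integral>u. R u \<partial>unif) \<le> (\<integral>u. Q u \<partial>unif)" by simp
  qed
  have "prim gp 1 - prim gn 1 = (\<integral>v. indicator {..1} v * (Q v - R v) \<partial>unif)"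
    by (rule prim_gap_diff) auto
  also have "\<dots> = (\<integral>v. Q v - R v \<partial>unif)" by (intro Bochner_Integration.integral_cong) auto
  also have "\<dots> = 0" using mean int_\<mu> int_\<nu> by simp
  finally show bal: "prim gn 1 = prim gp 1" by simp
  fix u :: real assume u: "0 \<le> u" "u \<le> 1"
  consider "u = 0" | "u = 1" | "0 < u" "u < 1" using u by linarith
  then show "prim gn u \<le> prim gp u"
  proof cases
    case 3
    define K where "K = R u"
    have iK: "integrable unif (\<lambda>v. K - Q v)" "integrable unif (\<lambda>v. K - R v)" using int_\<mu> int_\<nu> by auto
    have "convex_on UNIV (\<lambda>x. max 0 (K - x))"
    proof (intro convex_onI)
      fix t x y :: real assume t: "0 < t" "t < 1"
      have "(1 - t) * (K - x) \<le> (1 - t) * max 0 (K - x)" "t * (K - y) \<le> t * max 0 (K - y)"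
        "0 \<le> (1 - t) * max 0 (K - x)" "0 \<le> t * max 0 (K - y)"
        using t by (auto intro!: mult_left_mono mult_nonneg_nonneg)
      moreover have "K - ((1 - t) *\<^sub>R x + t *\<^sub>R y) = (1 - t) * (K - x) + t * (K - y)"
        by (simp add: algebra_simps)
      ultimately show "max 0 (K - ((1 - t) *\<^sub>R x + t *\<^sub>R y)) \<le> (1 - t) * max 0 (K - x) + t * max 0 (K - y)"
        by (intro max.boundedI) linarith+
    qed simp
    then have le: "(\<integral>v. max 0 (K - Q v) \<partial>unif) \<le> (\<integral>v. max 0 (K - R v) \<partial>unif)"
      using iK by (intro convex_le_integral_quantile[OF cx]) auto
    have "(\<integral>v. indicator {..u} v * (K - Q v) \<partial>unif) \<le> (\<integral>v. max 0 (K - Q v) \<partial>unif)"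
      using iK by (intro integral_mono integrable_indicator_mult) (auto split: split_indicator)
    also note le
    also have "(\<integral>v. max 0 (K - R v) \<partial>unif) = (\<integral>v. indicator {..u} v * (K - R v) \<partial>unif)"
      using R_mono[of _ u] R_mono[of u] 3
      by (intro Bochner_Integration.integral_cong) (auto simp: K_def max_def split: split_indicator intro: antisym)
    finally have "0 \<le> (\<integral>v. indicator {..u} v * (K - R v) \<partial>unif) - (\<integral>v. indicator {..u} v * (K - Q v) \<partial>unif)" by simp
    also have "\<dots> = (\<integral>v. indicator {..u} v * (K - R v) - indicator {..u} v * (K - Q v) \<partial>unif)"
      using iK by (simp add: integrable_indicator_mult)
    also have "\<dots> = (\<integral>v. indicator {..u} v * (Q v - R v) \<partial>unif)"
      by (intro Bochner_Integration.integral_cong) (auto simp: algebra_simps)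
    also have "\<dots> = prim gp u - prim gn u" by (rule prim_gap_diff[symmetric]) (use u in auto)
    finally show ?thesis by simp
  qed (use bal in \<open>simp_all add: prim_def set_lebesgue_integral_def\<close>)
qed

end

lemma tendsto_if_ennreal_abs_diff_tendsto_zero:
  fixes x :: real
  assumes "(\<lambda>n. ennreal \<bar>xs n - x\<bar>) \<longlonglongrightarrow> 0"
  shows "xs \<longlonglongrightarrow> x"
proof -
  have "(\<lambda>n. ennreal \<bar>xs n - x\<bar>) \<longlonglongrightarrow> ennreal 0" using assms by simp
  then have "(\<lambda>n. \<bar>xs n - x\<bar>) \<longlonglongrightarrow> 0" by (subst (asm) tendsto_ennreal_iff) auto
  then have "(\<lambda>n. xs n - x) \<longlonglongrightarrow> 0" by (rule tendsto_rabs_zero_cancel)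
  then show ?thesis by (rule LIM_zero_cancel)
qed

lemma prim_tendsto:
  assumes g: "unif_density g" and gs: "\<And>n. unif_density (gs n)"
    and L1: "(\<lambda>n. L1_dist unif (gs n) g) \<longlonglongrightarrow> 0" and u: "0 \<le> u" "u \<le> 1"
  shows "(\<lambda>n. prim (gs n) u) \<longlonglongrightarrow> prim g u"
proof (rule tendsto_if_ennreal_abs_diff_tendsto_zero, rule tendsto_zero_le[OF L1])
  fix n
  interpret g: unif_density g by (rule g)
  interpret gs: unif_density "gs n" by (rule gs)
  note i = integrable_indicator_mult[OF gs.g_integrable] integrable_indicator_mult[OF g.g_integrable]
  have "prim (gs n) u - prim g u = (\<integral>v. indicator {..u} v * gs n v - indicator {..u} v * g v \<partial>unif)"
    using i by (simp add: g.prim_eq_integral gs.prim_eq_integral u)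
  then have "ennreal \<bar>prim (gs n) u - prim g u\<bar> \<le> (\<integral>\<^sup>+ v. ennreal \<bar>indicator {..u} v * gs n v - indicator {..u} v * g v\<bar> \<partial>unif)"
    using integral_norm_bound_ennreal[OF Bochner_Integration.integrable_diff[OF i]] by simp
  also have "\<dots> \<le> (L1_dist unif (gs n) g)"
    by (intro nn_integral_mono ennreal_leI) (auto split: split_indicator)
  finally show "ennreal \<bar>prim (gs n) u - prim g u\<bar> \<le> (L1_dist unif (gs n) g)" .
qed

lemma nn_integral_abs_ge_on_interval:
  fixes h :: "real \<Rightarrow> real"
  assumes "0 < s" "s \<le> t" "t < 1" "0 \<le> e" "\<And>x. s \<le> x \<Longrightarrow> x \<le> t \<Longrightarrow> e \<le> \<bar>h x\<bar>"
  shows "ennreal (e * (t - s)) \<le> (\<integral>\<^sup>+ x. ennreal \<bar>h x\<bar> \<partial>unif)"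
proof -
  have "ennreal (e * (t - s)) = (\<integral>\<^sup>+ x. ennreal e * indicator {s..t} x \<partial>lborel)"
    using assms by (simp add: nn_integral_cmult ennreal_mult)
  also have "\<dots> \<le> (\<integral>\<^sup>+ x. ennreal \<bar>h x\<bar> * indicator {0<..<1} x \<partial>lborel)"
    using assms by (intro nn_integral_mono) (auto intro!: ennreal_leI split: split_indicator)
  finally show ?thesis by (simp add: nn_integral_unif)
qed

text \<open>If \<open>fs n (us n)\<close> is too large, then by monotonicity \<open>fs n\<close> exceeds \<open>f\<close> by a fixed amount on
  an interval to the right of \<open>u\<close> whose length does not depend on \<open>n\<close>, which contradicts
  convergence in \<open>L\<^sup>1\<close>. If it is too small, the same happens to the left of \<open>u\<close>.\<close>
lemma mono_L1_tendsto_at_continuity: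
  fixes f :: "real \<Rightarrow> real" and fs :: "nat \<Rightarrow> real \<Rightarrow> real"
  assumes f: "mono_on {0<..<1} f" and fs: "\<And>n. mono_on {0<..<1} (fs n)"
    and L1: "(\<lambda>n. L1_dist unif (fs n) f) \<longlonglongrightarrow> 0"
    and u: "0 < u" "u < 1" "isCont f u" and us: "us \<longlonglongrightarrow> u"
  shows "(\<lambda>n. fs n (us n)) \<longlonglongrightarrow> f u"
proof (rule order_tendstoI)
  fix a assume a: "f u < a"
  define e where "e = (a - f u) / 2"
  have e: "e > 0" using a by (simp add: e_def)
  obtain d where d: "d > 0" "\<And>t. \<bar>t - u\<bar> < d \<Longrightarrow> \<bar>f t - f u\<bar> < e"
    using u(3) e unfolding continuous_at_eps_delta by (auto simp: dist_real_def)
  \<comment> \<open>The interval from \<open>u + \<delta>\<close> to \<open>u + 2 * \<delta>\<close> lies in the unit interval and within distance \<open>d\<close> of \<open>u\<close>.\<close>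
  define \<delta> where "\<delta> = min d (1 - u) / 3"
  have \<delta>: "\<delta> > 0" "2 * \<delta> < d" "u + 2 * \<delta> < 1"
  proof -
    show "\<delta> > 0" using d u by (simp add: \<delta>_def)
    have "\<delta> \<le> d / 3" "\<delta> \<le> (1 - u) / 3" unfolding \<delta>_def by auto
    then show "2 * \<delta> < d" "u + 2 * \<delta> < 1" using d(1) u(2) by (simp_all add: field_simps)
  qed
  have "\<forall>\<^sub>F n in sequentially. us n < u + \<delta>" by (rule order_tendstoD(2)[OF us]) (use \<delta> in simp)
  moreover have "\<forall>\<^sub>F n in sequentially. 0 < us n" by (rule order_tendstoD(1)[OF us]) (use u in simp)
  moreover have "\<forall>\<^sub>F n in sequentially. (L1_dist unif (fs n) f) < ennreal (e * \<delta>)"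
    by (rule order_tendstoD(2)[OF L1]) (use e \<delta> in simp)
  ultimately show "\<forall>\<^sub>F n in sequentially. fs n (us n) < a"
  proof eventually_elim
    case (elim n)
    show ?case
    proof (rule ccontr)
      assume *: "\<not> fs n (us n) < a"
      have "ennreal (e * ((u + 2 * \<delta>) - (u + \<delta>))) \<le> (L1_dist unif (fs n) f)"
      proof (rule nn_integral_abs_ge_on_interval)
        fix x assume x: "u + \<delta> \<le> x" "x \<le> u + 2 * \<delta>"
        have "fs n (us n) \<le> fs n x" using mono_onD[OF fs, of "us n" x n] x elim \<delta> u by auto
        moreover have "\<bar>f x - f u\<bar> < e" using x \<delta> by (intro d(2)) auto
        moreover have "a = f u + 2 * e" by (simp add: e_def field_simps)
        ultimately show "e \<le> \<bar>fs n x - f x\<bar>" using * by linarith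
      qed (use e \<delta> u in auto)
      then show False using elim by (simp add: not_less[symmetric])
    qed
  qed
next
  fix a assume a: "a < f u"
  define e where "e = (f u - a) / 2"
  have e: "e > 0" using a by (simp add: e_def)
  obtain d where d: "d > 0" "\<And>t. \<bar>t - u\<bar> < d \<Longrightarrow> \<bar>f t - f u\<bar> < e"
    using u(3) e unfolding continuous_at_eps_delta by (auto simp: dist_real_def)
  define \<delta> where "\<delta> = min d u / 3"
  have \<delta>: "\<delta> > 0" "2 * \<delta> < d" "0 < u - 2 * \<delta>"
  proof -
    show "\<delta> > 0" using d u by (simp add: \<delta>_def)
    have "\<delta> \<le> d / 3" "\<delta> \<le> u / 3" unfolding \<delta>_def by auto
    then show "2 * \<delta> < d" "0 < u - 2 * \<delta>" using d(1) u(1) by (simp_all add: field_simps)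
  qed
  have "\<forall>\<^sub>F n in sequentially. u - \<delta> < us n" by (rule order_tendstoD(1)[OF us]) (use \<delta> in simp)
  moreover have "\<forall>\<^sub>F n in sequentially. us n < 1" by (rule order_tendstoD(2)[OF us]) (use u in simp)
  moreover have "\<forall>\<^sub>F n in sequentially. (L1_dist unif (fs n) f) < ennreal (e * \<delta>)"
    by (rule order_tendstoD(2)[OF L1]) (use e \<delta> in simp)
  ultimately show "\<forall>\<^sub>F n in sequentially. a < fs n (us n)"
  proof eventually_elim
    case (elim n)
    show ?case
    proof (rule ccontr)
      assume *: "\<not> a < fs n (us n)"
      have "ennreal (e * ((u - \<delta>) - (u - 2 * \<delta>))) \<le> (L1_dist unif (fs n) f)"
      proof (rule nn_integral_abs_ge_on_interval)
        fix x assume x: "u - 2 * \<delta> \<le> x" "x \<le> u - \<delta>"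
        have "fs n x \<le> fs n (us n)" using mono_onD[OF fs, of x "us n" n] x elim \<delta> u by auto
        moreover have "\<bar>f x - f u\<bar> < e" using x \<delta> by (intro d(2)) auto
        moreover have "a = f u - 2 * e" by (simp add: e_def field_simps)
        ultimately show "e \<le> \<bar>fs n x - f x\<bar>" using * by linarith
      qed (use e \<delta> u in auto)
      then show False using elim by (simp add: not_less[symmetric])
    qed
  qed
qed

lemma countable_discontinuities_quantile:
  assumes "real_distribution \<mu>"
  shows "countable {u \<in> {0<..<1}. \<not> isCont (quantile \<mu>) u}"
  using mono_on_ctble_discont_open[OF open_greaterThanLessThan mono_on_quantile[OF assms]] by simp

locale quantile_sequence = lim: quantile_pair \<mu> \<nu>
  for \<mu> \<nu> :: "real measure" +
  fixes \<mu>s \<nu>s :: "nat \<Rightarrow> real measure"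
  assumes pairs: "\<And>n. IT_pair (\<mu>s n) (\<nu>s n)"
    and Q_L1: "(\<lambda>n. L1_dist unif (quantile (\<mu>s n)) (quantile \<mu>)) \<longlonglongrightarrow> 0"
    and R_L1: "(\<lambda>n. L1_dist unif (quantile (\<nu>s n)) (quantile \<nu>)) \<longlonglongrightarrow> 0"
begin

sublocale seq: IT_pair "\<mu>s n" "\<nu>s n" for n by (rule pairs)

lemma quantile_tendsto:
  assumes "0 < u" "u < 1"
  shows "isCont (quantile \<mu>) u \<Longrightarrow> (\<lambda>n. quantile (\<mu>s n) u) \<longlonglongrightarrow> quantile \<mu> u"
    and "isCont (quantile \<nu>) u \<Longrightarrow> us \<longlonglongrightarrow> u \<Longrightarrow> (\<lambda>n. quantile (\<nu>s n) (us n)) \<longlonglongrightarrow> quantile \<nu> u"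
  using mono_L1_tendsto_at_continuity[OF mono_on_quantile[OF lim.\<mu>] mono_on_quantile[OF seq.\<mu>] Q_L1 assms _ tendsto_const]
    mono_L1_tendsto_at_continuity[OF mono_on_quantile[OF lim.\<nu>] mono_on_quantile[OF seq.\<nu>] R_L1 assms]
  by auto

end

section \<open>Convergence of the lifted inverse transform kernels\<close>

lemma two_values_tendsto_in_measure:
  fixes ps as bs :: "nat \<Rightarrow> real"
  assumes "ps \<longlonglongrightarrow> p" "as \<longlonglongrightarrow> a" "bs \<longlonglongrightarrow> b"
  shows "(\<lambda>n. \<integral>\<^sup>+ v. ennreal (min 1 \<bar>(if v < ps n then as n else bs n) - (if v < p then a else b)\<bar>) \<partial>unif) \<longlonglongrightarrow> 0"
proof -
  let ?h = "\<lambda>n v. min 1 \<bar>(if v < ps n then as n else bs n) - (if v < p then a else b)\<bar>"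
  have "(\<lambda>n. \<integral>\<^sup>+ v. ennreal \<bar>?h n v - 0\<bar> \<partial>unif) \<longlonglongrightarrow> 0"
  proof (rule unif.bounded_convergence_L1[where B = 1])
    show "?h n \<in> borel_measurable unif" for n by (rule measurable_unif) measurable
    show "AE v in unif. (\<lambda>n. ?h n v) \<longlonglongrightarrow> 0"
    proof (rule AE_unif_countable[of "{p}"])
      fix v assume "v \<notin> {p}"
      then have "v < p \<or> p < v" by auto
      then have "(\<lambda>n. (if v < ps n then as n else bs n)) \<longlonglongrightarrow> (if v < p then a else b)"
      proof
        assume v: "v < p"
        have "\<forall>\<^sub>F n in sequentially. v < ps n" by (rule order_tendstoD(1)[OF assms(1) v])
        then have "\<forall>\<^sub>F n in sequentially. as n = (if v < ps n then as n else bs n)" by eventually_elim simp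
        then show ?thesis using Lim_transform_eventually[OF assms(2)] v by simp
      next
        assume v: "p < v"
        have "\<forall>\<^sub>F n in sequentially. ps n < v" by (rule order_tendstoD(2)[OF assms(1) v])
        then have "\<forall>\<^sub>F n in sequentially. bs n = (if v < ps n then as n else bs n)" by eventually_elim simp
        then show ?thesis using Lim_transform_eventually[OF assms(3)] v by simp
      qed
      then have "(\<lambda>n. ?h n v) \<longlonglongrightarrow> min 1 \<bar>(if v < p then a else b) - (if v < p then a else b)\<bar>"
        by (intro tendsto_intros)
      then show "(\<lambda>n. ?h n v) \<longlonglongrightarrow> 0" by simp
    qed simp
  qed auto
  then show ?thesis by simp
qed

context quantile_sequence
begin

lemma gap_L1:
  "(\<lambda>n. L1_dist unif (seq.gp n) lim.gp) \<longlonglongrightarrow> 0"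
  "(\<lambda>n. L1_dist unif (seq.gn n) lim.gn) \<longlonglongrightarrow> 0"
proof -
  have m: "seq.Q n \<in> borel_measurable unif" "seq.R n \<in> borel_measurable unif"
    "lim.Q \<in> borel_measurable unif" "lim.R \<in> borel_measurable unif" for n
    by (auto intro!: measurable_unif)
  let ?b = "\<lambda>n. (L1_dist unif (seq.Q n) lim.Q)
      + (L1_dist unif (seq.R n) lim.R)"
  have b: "?b \<longlonglongrightarrow> 0" using tendsto_add[OF Q_L1 R_L1] by simp
  have mx: "\<bar>max 0 x - max 0 y\<bar> \<le> \<bar>x - y\<bar>" for x y :: real by linarith
  have le: "(\<integral>\<^sup>+ v. ennreal \<bar>h n v\<bar> \<partial>unif) \<le> ?b n"
    if "\<And>v. \<bar>h n v\<bar> \<le> \<bar>seq.Q n v - lim.Q v\<bar> + \<bar>seq.R n v - lim.R v\<bar>" for h n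
  proof -
    have "(\<integral>\<^sup>+ v. ennreal \<bar>h n v\<bar> \<partial>unif)
      \<le> (\<integral>\<^sup>+ v. ennreal \<bar>seq.Q n v - lim.Q v\<bar> + ennreal \<bar>seq.R n v - lim.R v\<bar> \<partial>unif)"
      using that by (intro nn_integral_mono) (simp add: ennreal_leI flip: ennreal_plus)
    also have "\<dots> = ?b n" using m by (simp add: nn_integral_add)
    finally show ?thesis .
  qed
  show "(\<lambda>n. L1_dist unif (seq.gp n) lim.gp) \<longlonglongrightarrow> 0"
    unfolding pos_gap_def by (rule tendsto_zero_le[OF b], rule le, rule order_trans[OF mx]) linarith
  show "(\<lambda>n. L1_dist unif (seq.gn n) lim.gn) \<longlonglongrightarrow> 0"
    unfolding neg_gap_def by (rule tendsto_zero_le[OF b], rule le, rule order_trans[OF mx]) linarith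
qed

lemma prim_gap_tendsto:
  assumes "0 \<le> u" "u \<le> 1"
  shows "(\<lambda>n. prim (seq.gp n) u) \<longlonglongrightarrow> prim lim.gp u"
    and "(\<lambda>n. prim (seq.gn n) u) \<longlonglongrightarrow> prim lim.gn u"
  by (rule prim_tendsto[OF lim.unif_density_pos_gap seq.unif_density_pos_gap gap_L1(1) assms],
      rule prim_tendsto[OF lim.unif_density_neg_gap seq.unif_density_neg_gap gap_L1(2) assms])

theorem IT_pair_limit: "IT_pair \<mu> \<nu>"
proof
  show "prim lim.gn u \<le> prim lim.gp u" if "0 \<le> u" "u \<le> 1" for u
    by (rule LIMSEQ_le[OF prim_gap_tendsto(2)[OF that] prim_gap_tendsto(1)[OF that]])
      (use seq.dominated[OF that] in auto)
  have "(\<lambda>n. prim (seq.gp n) 1) \<longlonglongrightarrow> prim lim.gn 1"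
    using prim_gap_tendsto(2)[of 1] by (simp add: seq.balanced)
  then show "prim lim.gn 1 = prim lim.gp 1"
    using LIMSEQ_unique prim_gap_tendsto(1)[of 1] by simp
qed

end

locale IT_sequence = quantile_sequence +
  assumes abs_moment: "(\<lambda>n. \<integral>\<^sup>+ x. ennreal \<bar>x\<bar> \<partial>\<nu>s n) \<longlonglongrightarrow> (\<integral>\<^sup>+ x. ennreal \<bar>x\<bar> \<partial>\<nu>)"
    and abs_moment_finite: "(\<integral>\<^sup>+ x. ennreal \<bar>x\<bar> \<partial>\<nu>) < \<top>"
begin

sublocale lim: IT_pair \<mu> \<nu> by (rule IT_pair_limit)

text \<open>Levels at which the generalised inverse of the primitive may be discontinuous, since a flat
  piece contains a rational point, or may land at a discontinuity of the quantile function of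
  \<open>\<nu>\<close>.\<close>
definition bad_levels :: "(real \<Rightarrow> real) \<Rightarrow> real set" where
  "bad_levels g = prim g ` \<rat> \<union> prim g ` {u \<in> {0<..<1}. \<not> isCont lim.R u}"

lemma countable_bad_levels: "countable (bad_levels g)"
  unfolding bad_levels_def
  by (intro countable_Un countable_image countable_rat countable_discontinuities_quantile lim.\<nu>)

definition exceptional :: "real set" where
  "exceptional = {u \<in> {0<..<1}. \<not> isCont lim.Q u} \<union> {u \<in> {0<..<1}. \<not> isCont lim.R u}
    \<union> lim.top_level \<union> (\<Union>n. seq.top_level n)
    \<union> {u \<in> {0<..<1}. 0 < lim.gp u \<and> prim lim.gp u \<in> bad_levels lim.gn}
    \<union> {u \<in> {0<..<1}. 0 < lim.gn u \<and> prim lim.gn u \<in> bad_levels lim.gp}"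

lemma countable_exceptional: "countable exceptional"
  unfolding exceptional_def
  by (intro countable_Un countable_UN countable_discontinuities_quantile lim.\<mu> lim.\<nu>
      lim.countable_top_level seq.countable_top_level lim.P.countable_prim_levels lim.N.countable_prim_levels
      countable_bad_levels) auto

text \<open>The inverse of a primitive depends continuously on the primitive and on the level as long as
  the level is not flat. Then monotonicity of the quantile functions yields their convergence,
  because the limit point is a point of continuity.\<close>
lemma quantile_left_inverse01_tendsto:
  assumes g: "unif_density g" and gs: "\<And>n. unif_density (gs n)"
    and prim_lim: "\<And>u. 0 \<le> u \<Longrightarrow> u \<le> 1 \<Longrightarrow> (\<lambda>n. prim (gs n) u) \<longlonglongrightarrow> prim g u"
    and w: "0 < w" "w < prim g 1" "w \<notin> bad_levels g" and ws: "ws \<longlonglongrightarrow> w"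
  shows "(\<lambda>n. seq.R n (left_inverse01 (prim (gs n)) (ws n))) \<longlonglongrightarrow> lim.R (left_inverse01 (prim g) w)"
proof -
  interpret g: unif_density g by (rule g)
  note b = g.left_inverse01_level[OF w(1,2)]
  have "(\<lambda>n. left_inverse01 (prim (gs n)) (ws n)) \<longlonglongrightarrow> left_inverse01 (prim g) w"
  proof (rule g.left_inverse01_tendsto[OF w(1,2) ws])
    show "w < prim g v" if "left_inverse01 (prim g) w < v" "v \<le> 1" for v
      by (rule g.not_flat_level[OF w(1,2) _ that]) (use w(3) in \<open>auto simp: bad_levels_def\<close>)
    show "prim (gs n) s \<le> prim (gs n) t" if "0 \<le> s" "s \<le> t" "t \<le> 1" for n s t
      by (rule unif_density.prim_mono[OF gs that])
  qed (rule prim_lim)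
  moreover have "isCont lim.R (left_inverse01 (prim g) w)"
  proof (rule ccontr)
    assume "\<not> isCont lim.R (left_inverse01 (prim g) w)"
    then have "prim g (left_inverse01 (prim g) w) \<in> bad_levels g"
      using b(1,2) by (auto simp: bad_levels_def)
    then show False using w(3) by (simp add: b(3))
  qed
  ultimately show ?thesis using quantile_tendsto(2)[OF b(1,2)] by blast
qed

lemma partner_quantile_tendsto:
  assumes u: "0 < u" "u < 1" "u \<notin> exceptional" and ne: "lim.Q u \<noteq> lim.R u"
  shows "(\<lambda>n. seq.R n (seq.\<phi> n u)) \<longlonglongrightarrow> lim.R (lim.\<phi> u)"
    and "\<forall>\<^sub>F n in sequentially. seq.Q n u \<noteq> seq.R n u"
    and "lim.R (lim.\<phi> u) \<noteq> lim.R u"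
proof -
  have cont: "isCont lim.Q u" "isCont lim.R u" and top: "u \<notin> lim.top_level"
    using u by (auto simp: exceptional_def)
  have Qn: "(\<lambda>n. seq.Q n u) \<longlonglongrightarrow> lim.Q u" by (rule quantile_tendsto(1)[OF u(1,2) cont(1)])
  have Rn: "(\<lambda>n. seq.R n u) \<longlonglongrightarrow> lim.R u" by (rule quantile_tendsto(2)[OF u(1,2) cont(2) tendsto_const])
  have diff: "(\<lambda>n. seq.Q n u - seq.R n u) \<longlonglongrightarrow> lim.Q u - lim.R u"
    by (intro tendsto_intros Qn Rn)
  have "(\<lambda>n. seq.R n (seq.\<phi> n u)) \<longlonglongrightarrow> lim.R (lim.\<phi> u)
    \<and> (\<forall>\<^sub>F n in sequentially. seq.Q n u \<noteq> seq.R n u) \<and> lim.R (lim.\<phi> u) \<noteq> lim.R u"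
  proof (cases "lim.R u < lim.Q u")
    case True
    note below = lim.below_top(1)[OF u(1,2) top True]
    note ph = lim.phi_above[OF u(1,2) True below]
    have bad: "prim lim.gp u \<notin> bad_levels lim.gn"
      using u True by (auto simp: exceptional_def lim.gp_pos_iff)
    have w: "prim lim.gp u < prim lim.gn 1" using below by (simp add: lim.c_eq)
    have ev: "\<forall>\<^sub>F n in sequentially. seq.R n u < seq.Q n u"
      using order_tendstoD(1)[OF diff, of 0] True by simp
    have "(\<lambda>n. seq.R n (left_inverse01 (prim (seq.gn n)) (prim (seq.gp n) u))) \<longlonglongrightarrow> lim.R (lim.\<phi> u)"
      unfolding ph(1) using u
      by (intro quantile_left_inverse01_tendsto[OF lim.unif_density_neg_gap seq.unif_density_neg_gap
          prim_gap_tendsto(2) ph(2) w bad] prim_gap_tendsto(1)) auto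
    moreover have "\<forall>\<^sub>F n in sequentially.
        seq.R n (left_inverse01 (prim (seq.gn n)) (prim (seq.gp n) u)) = seq.R n (seq.\<phi> n u)"
      using ev by eventually_elim (simp add: IT_phi_def Psi_plus_eq_prim Psi_minus_eq_prim)
    ultimately have "(\<lambda>n. seq.R n (seq.\<phi> n u)) \<longlonglongrightarrow> lim.R (lim.\<phi> u)"
      by (rule Lim_transform_eventually)
    then show ?thesis using ph(6) True ev by (auto elim: eventually_mono)
  next
    case False
    then have True: "lim.Q u < lim.R u" using ne by simp
    note below = lim.below_top(2)[OF u(1,2) top True]
    note ph = lim.phi_below[OF u(1,2) True below]
    have bad: "prim lim.gn u \<notin> bad_levels lim.gp"
      using u True by (auto simp: exceptional_def lim.gn_pos_iff)
    have w: "prim lim.gn u < prim lim.gp 1" using below by (simp add: lim.c_eq)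
    have ev: "\<forall>\<^sub>F n in sequentially. seq.Q n u < seq.R n u"
      using order_tendstoD(2)[OF diff, of 0] True by simp
    have "(\<lambda>n. seq.R n (left_inverse01 (prim (seq.gp n)) (prim (seq.gn n) u))) \<longlonglongrightarrow> lim.R (lim.\<phi> u)"
      unfolding ph(1) using u
      by (intro quantile_left_inverse01_tendsto[OF lim.unif_density_pos_gap seq.unif_density_pos_gap
          prim_gap_tendsto(1) ph(2) w bad] prim_gap_tendsto(2)) auto
    moreover have "\<forall>\<^sub>F n in sequentially.
        seq.R n (left_inverse01 (prim (seq.gp n)) (prim (seq.gn n) u)) = seq.R n (seq.\<phi> n u)"
      using ev by eventually_elim (simp add: IT_phi_def Psi_plus_eq_prim Psi_minus_eq_prim)
    ultimately have "(\<lambda>n. seq.R n (seq.\<phi> n u)) \<longlonglongrightarrow> lim.R (lim.\<phi> u)"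
      by (rule Lim_transform_eventually)
    then show ?thesis using ph(6) True ev by (auto elim: eventually_mono)
  qed
  then show "(\<lambda>n. seq.R n (seq.\<phi> n u)) \<longlonglongrightarrow> lim.R (lim.\<phi> u)"
    "\<forall>\<^sub>F n in sequentially. seq.Q n u \<noteq> seq.R n u"
    "lim.R (lim.\<phi> u) \<noteq> lim.R u" by auto
qed

text \<open>Where the quantiles of \<open>\<mu>\<close> and \<open>\<nu>\<close> differ, the weight and both values converge. Where they
  agree the partners may behave erratically, but the mean distance of the lift from \<open>seq.R n u\<close> is
  the weight times the distance of the partner, that is \<open>\<bar>seq.Q n u - seq.R n u\<bar>\<close>, which tends to
  0.\<close>
lemma IT_lift_section_tendsto:
  assumes u: "0 < u" "u < 1" "u \<notin> exceptional"
  shows "(\<lambda>n. \<integral>\<^sup>+ v. ennreal (min 1 \<bar>IT_lift (\<mu>s n) (\<nu>s n) u v - IT_lift \<mu> \<nu> u v\<bar>) \<partial>unif) \<longlonglongrightarrow> 0"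
proof -
  have cont: "isCont lim.Q u" "isCont lim.R u"
    and top: "u \<notin> seq.top_level n" for n
    using u by (auto simp: exceptional_def)
  have Qn: "(\<lambda>n. seq.Q n u) \<longlonglongrightarrow> lim.Q u" by (rule quantile_tendsto(1)[OF u(1,2) cont(1)])
  have Rn: "(\<lambda>n. seq.R n u) \<longlonglongrightarrow> lim.R u" by (rule quantile_tendsto(2)[OF u(1,2) cont(2) tendsto_const])
  show ?thesis
  proof (cases "lim.Q u = lim.R u")
    case False
    note part = partner_quantile_tendsto[OF u False]
    have "(\<lambda>n. (seq.Q n u - seq.R n u)
        / (seq.R n (seq.\<phi> n u) - seq.R n u))
      \<longlonglongrightarrow> (lim.Q u - lim.R u) / (lim.R (lim.\<phi> u) - lim.R u)"
      using part(3) by (intro tendsto_intros Qn Rn part(1)) simp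
    moreover have "\<forall>\<^sub>F n in sequentially. (seq.Q n u - seq.R n u)
        / (seq.R n (seq.\<phi> n u) - seq.R n u) = seq.p n u"
      using part(2) by eventually_elim (simp add: IT_p_def)
    ultimately have "(\<lambda>n. seq.p n u)
        \<longlonglongrightarrow> (lim.Q u - lim.R u) / (lim.R (lim.\<phi> u) - lim.R u)"
      by (rule Lim_transform_eventually)
    also have "(lim.Q u - lim.R u) / (lim.R (lim.\<phi> u) - lim.R u) = lim.p u"
      using False by (simp add: IT_p_def)
    finally have "(\<lambda>n. seq.p n u) \<longlonglongrightarrow> lim.p u" .
    from two_values_tendsto_in_measure[OF this part(1) Rn] show ?thesis by (simp only: IT_lift_def)
  next
    case True
    show ?thesis
    proof (rule tendsto_zero_le)
      have "(\<lambda>n. \<bar>seq.Q n u - seq.R n u\<bar> + \<bar>seq.R n u - lim.R u\<bar>)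
          \<longlonglongrightarrow> \<bar>lim.Q u - lim.R u\<bar> + \<bar>lim.R u - lim.R u\<bar>"
        by (intro tendsto_intros Qn Rn)
      from tendsto_ennrealI[OF this]
      show "(\<lambda>n. ennreal (\<bar>seq.Q n u - seq.R n u\<bar> + \<bar>seq.R n u - lim.R u\<bar>)) \<longlonglongrightarrow> 0"
        using True by simp
      fix n
      have [measurable]: "IT_lift (\<mu>s n) (\<nu>s n) u \<in> borel_measurable unif"
        by (rule measurable_unif[OF borel_measurable_lift_section[OF seq.IT_lift_measurable]])
      have lim_const: "IT_lift \<mu> \<nu> u v = lim.R u" if "0 < v" for v
        using True that by (simp add: IT_lift_def IT_p_def)
      have "(\<integral>\<^sup>+ v. ennreal (min 1 \<bar>IT_lift (\<mu>s n) (\<nu>s n) u v - IT_lift \<mu> \<nu> u v\<bar>) \<partial>unif)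
        \<le> (\<integral>\<^sup>+ v. ennreal \<bar>IT_lift (\<mu>s n) (\<nu>s n) u v - seq.R n u\<bar>
            + ennreal \<bar>seq.R n u - lim.R u\<bar> \<partial>unif)"
        by (intro nn_integral_mono) (auto simp: lim_const intro!: ennreal_leI simp flip: ennreal_plus)
      also have "\<dots> = (\<integral>\<^sup>+ v. ennreal \<bar>IT_lift (\<mu>s n) (\<nu>s n) u v - seq.R n u\<bar> \<partial>unif)
          + ennreal \<bar>seq.R n u - lim.R u\<bar>"
        by (subst nn_integral_add) (auto simp: unif.emeasure_space_1[simplified])
      also have "(\<integral>\<^sup>+ v. ennreal \<bar>IT_lift (\<mu>s n) (\<nu>s n) u v - seq.R n u\<bar> \<partial>unif)
          = ennreal \<bar>seq.Q n u - seq.R n u\<bar>"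
      proof -
        note b = seq.IT_p_bounds[OF u(1,2) top, of n]
        have "(\<integral>\<^sup>+ v. ennreal \<bar>IT_lift (\<mu>s n) (\<nu>s n) u v - seq.R n u\<bar> \<partial>unif)
            = ennreal (seq.p n u) * ennreal \<bar>seq.R n (seq.\<phi> n u) - seq.R n u\<bar>"
          by (subst seq.nn_integral_IT_lift_section[OF u(1,2) top, of "\<lambda>y. ennreal \<bar>y - seq.R n u\<bar>" n]) simp
        also have "\<dots> = ennreal \<bar>seq.p n u * (seq.R n (seq.\<phi> n u) - seq.R n u)\<bar>"
          using b(1) by (simp add: ennreal_mult' abs_mult)
        finally show ?thesis by (simp only: b(3))
      qed
      finally show "(\<integral>\<^sup>+ v. ennreal (min 1 \<bar>IT_lift (\<mu>s n) (\<nu>s n) u v - IT_lift \<mu> \<nu> u v\<bar>) \<partial>unif)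
        \<le> ennreal (\<bar>seq.Q n u - seq.R n u\<bar> + \<bar>seq.R n u - lim.R u\<bar>)"
        by simp
    qed
  qed
qed

text \<open>Convergence in measure is improved by convergence of the norms, which are the first absolute
  moments of the second marginals.\<close>
theorem IT_lift_L1_tendsto:
  "(\<lambda>n. \<integral>\<^sup>+ u. L1_dist unif (IT_lift (\<mu>s n) (\<nu>s n) u) (IT_lift \<mu> \<nu> u) \<partial>unif) \<longlonglongrightarrow> 0"
proof -
  have mY: "jointly_measurable (IT_lift (\<mu>s n) (\<nu>s n))" for n
    by (rule seq.IT_lift_measurable)
  note mY0 = lim.IT_lift_measurable
  have mU [measurable]: "(\<lambda>z. IT_lift (\<mu>s n) (\<nu>s n) (fst z) (snd z)) \<in> borel_measurable (unif \<Otimes>\<^sub>M unif)"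
    "(\<lambda>z. IT_lift \<mu> \<nu> (fst z) (snd z)) \<in> borel_measurable (unif \<Otimes>\<^sub>M unif)" for n
    using measurable_compose[OF measurable_unif2_ident mY] measurable_compose[OF measurable_unif2_ident mY0] by auto
  have trunc: "(\<lambda>n. \<integral>\<^sup>+ z. ennreal (min 1 \<bar>IT_lift (\<mu>s n) (\<nu>s n) (fst z) (snd z) - IT_lift \<mu> \<nu> (fst z) (snd z)\<bar>)
      \<partial>(unif \<Otimes>\<^sub>M unif)) \<longlonglongrightarrow> 0"
  proof -
    let ?h = "\<lambda>n u v. ennreal (min 1 \<bar>IT_lift (\<mu>s n) (\<nu>s n) u v - IT_lift \<mu> \<nu> u v\<bar>)"
    have m: "(\<lambda>z. ?h n (fst z) (snd z)) \<in> borel_measurable (unif \<Otimes>\<^sub>M unif)" for n by measurable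
    have "(\<lambda>n. \<integral>\<^sup>+ u. (\<integral>\<^sup>+ v. ?h n u v \<partial>unif) \<partial>unif) \<longlonglongrightarrow> (\<integral>\<^sup>+ u. 0 \<partial>unif)"
    proof (rule nn_integral_dominated_convergence[where w = "\<lambda>_. 1"])
      show "(\<lambda>u. \<integral>\<^sup>+ v. ?h n u v \<partial>unif) \<in> borel_measurable unif" for n
        using m[of n] by (intro unif.borel_measurable_nn_integral) (simp add: case_prod_beta')
      have "(\<integral>\<^sup>+ v. ?h n u v \<partial>unif) \<le> (\<integral>\<^sup>+ v. 1 \<partial>unif)" for n u
        by (intro nn_integral_mono) simp
      then show "AE u in unif. (\<integral>\<^sup>+ v. ?h n u v \<partial>unif) \<le> 1" for n
        using unif.emeasure_space_1 by simp
      show "AE u in unif. (\<lambda>n. \<integral>\<^sup>+ v. ?h n u v \<partial>unif) \<longlonglongrightarrow> 0"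
        by (rule AE_unif_countable[OF countable_exceptional], rule IT_lift_section_tendsto)
    qed (use unif.emeasure_space_1 in simp_all)
    moreover have "(\<integral>\<^sup>+ z. ?h n (fst z) (snd z) \<partial>(unif \<Otimes>\<^sub>M unif)) = (\<integral>\<^sup>+ u. (\<integral>\<^sup>+ v. ?h n u v \<partial>unif) \<partial>unif)" for n
      using unif.nn_integral_fst[OF m[of n]] by simp
    ultimately show ?thesis by simp
  qed
  have norm: "(\<integral>\<^sup>+ z. ennreal (\<bar>IT_lift a b (fst z) (snd z)\<bar> powr 1) \<partial>(unif \<Otimes>\<^sub>M unif)) = (\<integral>\<^sup>+ x. ennreal \<bar>x\<bar> \<partial>b)"
    if ab: "IT_pair a b" for a b
  proof -
    interpret ab: IT_pair a b by (rule ab)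
    have "(\<integral>\<^sup>+ z. ennreal (\<bar>IT_lift a b (fst z) (snd z)\<bar> powr 1) \<partial>(unif \<Otimes>\<^sub>M unif))
        = (\<integral>\<^sup>+ u. \<integral>\<^sup>+ v. ennreal \<bar>IT_lift a b u v\<bar> \<partial>unif \<partial>unif)"
      using ab.IT_lift_measurable by (subst nn_integral_unif2) auto
    also have "\<dots> = (\<integral>\<^sup>+ x. ennreal \<bar>x\<bar> \<partial>b)" by (rule ab.nn_integral_IT_lift) simp
    finally show ?thesis .
  qed
  have "(\<lambda>n. \<integral>\<^sup>+ z. ennreal (\<bar>IT_lift (\<mu>s n) (\<nu>s n) (fst z) (snd z) - IT_lift \<mu> \<nu> (fst z) (snd z)\<bar> powr 1)
      \<partial>(unif \<Otimes>\<^sub>M unif)) \<longlonglongrightarrow> 0"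
    by (rule unif2.Lp_convergence_if_norm_convergence[OF order_refl mU trunc])
      (simp_all only: norm[OF pairs] norm[OF lim.IT_pair_axioms] abs_moment abs_moment_finite)
  moreover have "(\<integral>\<^sup>+ z. ennreal (\<bar>IT_lift (\<mu>s n) (\<nu>s n) (fst z) (snd z) - IT_lift \<mu> \<nu> (fst z) (snd z)\<bar> powr 1)
      \<partial>(unif \<Otimes>\<^sub>M unif)) = (\<integral>\<^sup>+ u. L1_dist unif (IT_lift (\<mu>s n) (\<nu>s n) u) (IT_lift \<mu> \<nu> u) \<partial>unif)" for n
    using mY mY0 by (subst nn_integral_unif2) auto
  ultimately show ?thesis by simp
qed

end

section \<open>Stability in the adapted Wasserstein distance\<close>

theorem proposition4p2:
  fixes \<rho> :: real and \<mu> \<nu> :: "real measure" and \<mu>s \<nu>s :: "nat \<Rightarrow> real measure"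
  assumes "\<rho> \<ge> 1"
    and "\<And>n. \<mu>s n \<in> prob_moment \<rho>" and "\<And>n. \<nu>s n \<in> prob_moment \<rho>"
    and "\<And>n. convex_le (\<mu>s n) (\<nu>s n)"
    and "\<mu> \<in> prob_moment \<rho>" and "\<nu> \<in> prob_moment \<rho>"
    and "(\<lambda>n. wasserstein \<rho> (\<mu>s n) \<mu>) \<longlonglongrightarrow> 0"
    and "(\<lambda>n. wasserstein \<rho> (\<nu>s n) \<nu>) \<longlonglongrightarrow> 0"
    and "\<And>x. measure \<mu> {x} > 0 \<Longrightarrow>
      \<exists>xs :: nat \<Rightarrow> real.
        (\<lambda>n. min (cdf (\<mu>s n) (xs n)) (cdf \<mu> x) - max (cdf_left (\<mu>s n) (xs n)) (cdf_left \<mu> x))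
          \<longlonglongrightarrow> measure \<mu> {x}"
  shows "(\<lambda>n. adapted_wasserstein \<rho> (IT_coupling (\<mu>s n) (\<nu>s n)) (IT_coupling \<mu> \<nu>)) \<longlonglongrightarrow> 0"
proof -
  note \<rho> = assms(1)
  note d\<mu>s = prob_momentD[OF assms(2)] and d\<nu>s = prob_momentD[OF assms(3)]
  note d\<mu> = prob_momentD[OF assms(5)] and d\<nu> = prob_momentD[OF assms(6)]
  note i\<mu>s = integrable_quantile[OF prob_moment_mono[OF assms(2) \<rho>]]
  note i\<nu>s = integrable_quantile[OF prob_moment_mono[OF assms(3) \<rho>]]
  note i\<mu> = integrable_quantile[OF prob_moment_mono[OF assms(5) \<rho>]]
  note i\<nu> = integrable_quantile[OF prob_moment_mono[OF assms(6) \<rho>]]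
  note Qc = wasserstein_tendsto_zero_quantile[OF \<rho> assms(2) assms(5) assms(7)]
  note Rc = wasserstein_tendsto_zero_quantile[OF \<rho> assms(3) assms(6) assms(8)]
  have pair_n: "IT_pair (\<mu>s n) (\<nu>s n)" for n
  proof -
    interpret quantile_pair "\<mu>s n" "\<nu>s n"
      by (intro quantile_pair.intro d\<mu>s d\<nu>s i\<mu>s i\<nu>s)
    show ?thesis by (rule convex_le_imp_IT_pair[OF assms(4)])
  qed
  interpret IT_sequence \<mu> \<nu> \<mu>s \<nu>s
    using prob_momentD(2)[OF prob_moment_mono[OF assms(6) \<rho>]]
    by (intro IT_sequence.intro IT_sequence_axioms.intro quantile_sequence.intro quantile_sequence_axioms.intro
        quantile_pair.intro d\<mu>(1) d\<nu>(1) i\<mu> i\<nu> pair_n Qc(1) Rc(1) Rc(4)) simp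
  have law: "(\<integral>\<^sup>+ u. \<integral>\<^sup>+ v. ennreal (\<bar>IT_lift (\<mu>s n) (\<nu>s n) u v\<bar> powr \<rho>) \<partial>unif \<partial>unif) = (\<integral>\<^sup>+ x. ennreal (\<bar>x\<bar> powr \<rho>) \<partial>\<nu>s n)"
    "(\<integral>\<^sup>+ u. \<integral>\<^sup>+ v. ennreal (\<bar>IT_lift \<mu> \<nu> u v\<bar> powr \<rho>) \<partial>unif \<partial>unif) = (\<integral>\<^sup>+ x. ennreal (\<bar>x\<bar> powr \<rho>) \<partial>\<nu>)"
    "(\<integral>\<^sup>+ u. \<integral>\<^sup>+ v. ennreal \<bar>IT_lift \<mu> \<nu> u v\<bar> \<partial>unif \<partial>unif) = (\<integral>\<^sup>+ x. ennreal \<bar>x\<bar> \<partial>\<nu>)" for n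
    by (rule seq.nn_integral_IT_lift, simp, rule lim.nn_integral_IT_lift, simp, rule lim.nn_integral_IT_lift, simp)
  have "(\<lambda>n. adapted_wasserstein \<rho> (lift_law (\<mu>s n) (IT_lift (\<mu>s n) (\<nu>s n))) (lift_law \<mu> (IT_lift \<mu> \<nu>))) \<longlonglongrightarrow> 0"
  proof (rule adapted_wasserstein_lift_law_tendsto_zero[OF \<rho> d\<mu>(1) d\<mu>s(1) lim.IT_lift_measurable
        seq.IT_lift_measurable Qc(2) Qc(1) IT_lift_L1_tendsto])
    fix x assume "0 < measure unif {u \<in> {0<..<1}. quantile \<mu> u = x}"
    then have pos: "measure \<mu> {x} > 0" by (simp only: measure_unif_quantile_eq[OF d\<mu>(1)])
    from assms(9)[OF pos]
    show "\<exists>xs. (\<lambda>n. emeasure unif {u \<in> {0<..<1}. quantile \<mu> u = x \<and> quantile (\<mu>s n) u \<noteq> xs n}) \<longlonglongrightarrow> 0"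
      using jump_overlap_imp_atom_inclusion[where \<mu>s = \<mu>s, OF d\<mu>(1) d\<mu>s(1) pos] by blast
  qed (simp_all only: law Rc(3) d\<nu>(2) abs_moment_finite)
  then show ?thesis by (simp only: seq.IT_coupling_eq_lift_law lim.IT_coupling_eq_lift_law)
qed

end
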